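(* Let $\mathbb{A} : L^2_{D_2} \to H^l_{D_2}$ be a bounded linear operator. Let $\mathcal{Y}_0, \mathcal{Z}_1$ be non-negative constants and let $\mathcal{Z}_2 : (0,\infty) \to [0,\infty)$ be a non-negative function such that $$\|\mathbb{A}\mathbb{F}(u_0)\|_l \le \mathcal{Y}_0,\qquad \|I_d - \mathbb{A}D\mathbb{F}(u_0)\|_{l} \le \mathcal{Z}_1,$$ $$\|\mathbb{A}\left(D\mathbb{F}(v) - D\mathbb{F}(u_0)\right)\|_l \le \mathcal{Z}_2(r)\,r \quad \text{for all } r>0 \text{ and all } v \in \overline{B_r(u_0)}.$$ If there exists $r>0$ such that $$\tfrac{1}{2}\mathcal{Z}_2(r)r^2 - (1-\mathcal{Z}_1)r + \mathcal{Y}_0 <0 \quad\text{and}\quad \mathcal{Z}_1 + \mathcal{Z}_2(r)r < 1,$$ then there exists a unique $\tilde{u} \in \overline{B_r(u_0)} \subset H^l_{D_2}$ such that $\mathbb{F}(\tilde{u})=0$.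
   Context: Fix $\mu>0$ and $\nu_1,\nu_2\in\mathbb{R}$. Functions are real-valued. The Fourier transform on $\mathbb{R}^2$ is $\hat u(\xi)=\int_{\mathbb{R}^2}u(x)e^{-2\pi i x\cdot\xi}dx$. Let $\mathbb{L}=(I_d+\Delta)^2+\mu I_d$, whose symbol is $l(\xi)=(1-|2\pi\xi|^2)^2+\mu$, let $\mathbb{G}(u)=\nu_1u^2+\nu_2u^3$ and $\mathbb{F}(u)=\mathbb{L}u+\mathbb{G}(u)$ (zeros of $\mathbb F$ are stationary solutions of the planar Swift-Hohenberg equation). $H^l=\{u\in L^2(\mathbb{R}^2):\int|\hat u(\xi)|^2 l(\xi)^2d\xi<\infty\}$ is a Hilbert space with norm $\|u\|_l=\|\mathbb{L}u\|_{2}$ ($\|\cdot\|_2$ being the $L^2(\mathbb{R}^2)$ norm); it equals $H^4(\mathbb{R}^2)$ with an equivalent norm. $L^2_{D_2}$ and $H^l_{D_2}$ are the closed subspaces of $L^2(\mathbb{R}^2)$ and $H^l$ of functions with $u(x_1,x_2)=u(-x_1,x_2)=u(x_1,-x_2)$. $\mathbb{F}$ maps $H^l_{D_2}$ smoothly into $L^2_{D_2}$, and $D\mathbb{F}(u)$ denotes its Fréchet derivative. For a bounded operator $H^l_{D_2}\to H^l_{D_2}$, $\|\cdot\|_l$ also denotes the operator norm. $u_0$ is a fixed element of $H^l_{D_2}$, supported in $[-d,d]^2$ for some fixed $0<d<\infty$, which on $(-d,d)^2$ is a finite linear combination of the functions $\cos(\pi n_1x_1/d)\cos(\pi n_2x_2/d)$,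 $n_1,n_2\in\{0,\dots,N_0\}$, for some $N_0\in\mathbb{N}$. $B_r(u_0)\subset H^l_{D_2}$ is the open ball of radius $r$ centered at $u_0$ for $\|\cdot\|_l$, and $\overline{B_r(u_0)}$ its closure. *)

theory Defs
  imports "HOL-Analysis.Analysis"
begin

text \<open>
  Elements of \<open>L\<^sup>2\<close> are represented by Borel functions, and equality of elements is equality
  almost everywhere. Operators act on representatives, and are required to respect
  equality almost everywhere.
\<close>

type_synonym plane = "real \<times> real"

definition ae_eq :: "(plane \<Rightarrow> 'b) \<Rightarrow> (plane \<Rightarrow> 'b) \<Rightarrow> bool"  (infix \<open>=ae\<close> 50) where
  "f =ae g \<longleftrightarrow> (AE x in lborel. f x = g x)"

definition L2 :: "(plane \<Rightarrow> 'b::real_normed_vector) set" where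
  "L2 = {f \<in> borel_measurable lborel. integrable lborel (\<lambda>x. (norm (f x))\<^sup>2)}"

definition norm2 :: "(plane \<Rightarrow> 'b::real_normed_vector) \<Rightarrow> real" where
  "norm2 f = sqrt (LINT x|lborel. (norm (f x))\<^sup>2)"


section \<open>Fourier transform\<close>

definition fourier_integral :: "(plane \<Rightarrow> real) \<Rightarrow> plane \<Rightarrow> complex" where
  "fourier_integral u \<xi> =
     (LINT x|lborel. of_real (u x) * exp (- (2 * of_real pi * \<i> * of_real (x \<bullet> \<xi>))))"

text \<open>
  The integral need not converge for \<open>u \<in> L\<^sup>2\<close>. As usual, the transform of \<open>u\<close> is then the
  \<open>L\<^sup>2\<close> limit of the transforms of the truncations of \<open>u\<close> to balls of radius \<open>n\<close>
  (which are integrable). The limit is expressed with the nonnegative integral, so that a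
  difference which is not square integrable counts as infinitely large.
\<close>

definition has_fourier :: "(plane \<Rightarrow> real) \<Rightarrow> (plane \<Rightarrow> complex) \<Rightarrow> bool" where
  "has_fourier u g \<longleftrightarrow> g \<in> L2 \<and>
     (\<lambda>n. \<integral>\<^sup>+ \<xi>. ennreal ((norm
        (fourier_integral (\<lambda>x. indicator (ball 0 (real n)) x * u x) \<xi> - g \<xi>))\<^sup>2) \<partial>lborel)
       \<longlonglongrightarrow> 0"

definition fourier :: "(plane \<Rightarrow> real) \<Rightarrow> plane \<Rightarrow> complex" where
  "fourier u = (SOME g. has_fourier u g)"


section \<open>Function spaces and the Swift-Hohenberg operator\<close>

definition symbol_l :: "real \<Rightarrow> plane \<Rightarrow> real" where
  "symbol_l \<mu> \<xi> = (1 - (norm ((2 * pi) *\<^sub>R \<xi>))\<^sup>2)\<^sup>2 + \<mu>"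

definition Hl :: "real \<Rightarrow> (plane \<Rightarrow> real) set" where
  "Hl \<mu> = {u \<in> L2. integrable lborel (\<lambda>\<xi>. (norm (fourier u \<xi>))\<^sup>2 * (symbol_l \<mu> \<xi>)\<^sup>2)}"

text \<open>The operator \<open>(I + \<Delta>)\<^sup>2 + \<mu> I\<close>, as the Fourier multiplier with its symbol.\<close>

definition LL :: "real \<Rightarrow> (plane \<Rightarrow> real) \<Rightarrow> plane \<Rightarrow> real" where
  "LL \<mu> u = (SOME f. f \<in> L2 \<and> fourier f =ae (\<lambda>\<xi>. of_real (symbol_l \<mu> \<xi>) * fourier u \<xi>))"

definition norm_l :: "real \<Rightarrow> (plane \<Rightarrow> real) \<Rightarrow> real" where
  "norm_l \<mu> u = norm2 (LL \<mu> u)"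

definition D2_symmetric :: "(plane \<Rightarrow> real) \<Rightarrow> bool" where
  "D2_symmetric u \<longleftrightarrow>
     u =ae (\<lambda>(x\<^sub>1, x\<^sub>2). u (- x\<^sub>1, x\<^sub>2)) \<and> u =ae (\<lambda>(x\<^sub>1, x\<^sub>2). u (x\<^sub>1, - x\<^sub>2))"

definition L2_D2 :: "(plane \<Rightarrow> real) set" where
  "L2_D2 = {u \<in> L2. D2_symmetric u}"

definition Hl_D2 :: "real \<Rightarrow> (plane \<Rightarrow> real) set" where
  "Hl_D2 \<mu> = {u \<in> Hl \<mu>. D2_symmetric u}"

definition GG :: "real \<Rightarrow> real \<Rightarrow> (plane \<Rightarrow> real) \<Rightarrow> plane \<Rightarrow> real" where
  "GG \<nu>\<^sub>1 \<nu>\<^sub>2 u = (\<lambda>x. \<nu>\<^sub>1 * (u x)\<^sup>2 + \<nu>\<^sub>2 * (u x) ^ 3)"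

definition FF :: "real \<Rightarrow> real \<Rightarrow> real \<Rightarrow> (plane \<Rightarrow> real) \<Rightarrow> plane \<Rightarrow> real" where
  "FF \<mu> \<nu>\<^sub>1 \<nu>\<^sub>2 u = (\<lambda>x. LL \<mu> u x + GG \<nu>\<^sub>1 \<nu>\<^sub>2 u x)"

text \<open>The closure is taken in \<open>Hl_D2 \<mu>\<close> with respect to \<open>norm_l \<mu>\<close>.\<close>

definition ball_l :: "real \<Rightarrow> (plane \<Rightarrow> real) \<Rightarrow> real \<Rightarrow> (plane \<Rightarrow> real) set" where
  "ball_l \<mu> u r = {v \<in> Hl_D2 \<mu>. norm_l \<mu> (\<lambda>x. v x - u x) < r}"

definition closure_l :: "real \<Rightarrow> (plane \<Rightarrow> real) set \<Rightarrow> (plane \<Rightarrow> real) set" where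
  "closure_l \<mu> S = {v \<in> Hl_D2 \<mu>. \<forall>\<epsilon>>0. \<exists>w\<in>S. norm_l \<mu> (\<lambda>x. v x - w x) < \<epsilon>}"


section \<open>Bounded operators and Frechet derivatives\<close>

text \<open>
  The library's \<open>bounded_linear\<close>, \<open>onorm\<close>, \<open>has_derivative\<close> and \<open>frechet_derivative\<close> need the
  normed spaces to be types. These are the same notions for sets \<open>X\<close>, \<open>Y\<close> of functions modulo
  equality almost everywhere, with norms \<open>nX\<close>, \<open>nY\<close>.
\<close>

definition bounded_linear_op ::
  "(plane \<Rightarrow> real) set \<Rightarrow> ((plane \<Rightarrow> real) \<Rightarrow> real) \<Rightarrow>
   (plane \<Rightarrow> real) set \<Rightarrow> ((plane \<Rightarrow> real) \<Rightarrow> real) \<Rightarrow>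
   ((plane \<Rightarrow> real) \<Rightarrow> plane \<Rightarrow> real) \<Rightarrow> bool" where
  "bounded_linear_op X nX Y nY T \<longleftrightarrow>
     (\<forall>f\<in>X. T f \<in> Y) \<and>
     (\<forall>f\<in>X. \<forall>g\<in>X. f =ae g \<longrightarrow> T f =ae T g) \<and>
     (\<forall>f\<in>X. \<forall>g\<in>X. T (\<lambda>x. f x + g x) =ae (\<lambda>x. T f x + T g x)) \<and>
     (\<forall>f\<in>X. \<forall>c. T (\<lambda>x. c * f x) =ae (\<lambda>x. c * T f x)) \<and>
     (\<exists>K. \<forall>f\<in>X. nY (T f) \<le> K * nX f)"

definition onorm_l :: "real \<Rightarrow> ((plane \<Rightarrow> real) \<Rightarrow> plane \<Rightarrow> real) \<Rightarrow> real" where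
  "onorm_l \<mu> T = (SUP h\<in>Hl_D2 \<mu>. norm_l \<mu> (T h) / norm_l \<mu> h)"

definition has_frechet_derivative_on ::
  "(plane \<Rightarrow> real) set \<Rightarrow> ((plane \<Rightarrow> real) \<Rightarrow> real) \<Rightarrow>
   (plane \<Rightarrow> real) set \<Rightarrow> ((plane \<Rightarrow> real) \<Rightarrow> real) \<Rightarrow>
   ((plane \<Rightarrow> real) \<Rightarrow> plane \<Rightarrow> real) \<Rightarrow> (plane \<Rightarrow> real) \<Rightarrow>
   ((plane \<Rightarrow> real) \<Rightarrow> plane \<Rightarrow> real) \<Rightarrow> bool" where
  "has_frechet_derivative_on X nX Y nY F u D \<longleftrightarrow>
     (\<forall>v\<in>X. F v \<in> Y) \<and>
     bounded_linear_op X nX Y nY D \<and>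
     (\<forall>\<epsilon>>0. \<exists>\<delta>>0. \<forall>h\<in>X. nX h < \<delta> \<longrightarrow>
        nY (\<lambda>x. F (\<lambda>y. u y + h y) x - F u x - D h x) \<le> \<epsilon> * nX h)"

definition DFF :: "real \<Rightarrow> real \<Rightarrow> real \<Rightarrow> (plane \<Rightarrow> real) \<Rightarrow>
    (plane \<Rightarrow> real) \<Rightarrow> plane \<Rightarrow> real" where
  "DFF \<mu> \<nu>\<^sub>1 \<nu>\<^sub>2 u =
     (SOME D. has_frechet_derivative_on (Hl_D2 \<mu>) (norm_l \<mu>) L2_D2 norm2 (FF \<mu> \<nu>\<^sub>1 \<nu>\<^sub>2) u D)"

end

theory Submission
  imports Defs "HOL-Probability.Probability"
begin

text \<open>
  The proof is a Newton-Kantorovich argument for the map \<open>u \<mapsto> u - A (F u)\<close> on the closed ball of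
  radius \<open>r\<close> about \<open>u\<^sub>0\<close> (\<open>newton_kantorovich\<close>). Write \<open>J\<close> for the derivative of \<open>F\<close> at \<open>u\<^sub>0\<close>.
  The two inequalities on the constants say that this map sends the ball into itself and contracts
  with factor \<open>Z\<^sub>1 + Z\<^sub>2 r * r\<close>, so it has exactly one fixed point, at which \<open>A (F u) = 0\<close>.

  Both estimates must come from the bound on \<open>A (DF (u\<^sub>0 + w) - DF u\<^sub>0)\<close> at the single radius \<open>r\<close>.
  This is possible because the nonlinear term is cubic: \<open>DF (u\<^sub>0 + w) - DF u\<^sub>0\<close> is a polynomial of degree at
  most two in \<open>w\<close> without constant term, and the increments of \<open>F\<close> are given exactly by quadrature rules with
  nodes in the ball. Simpson's rule yields the contraction (\<open>F_increment_Simpson\<close>), and a rule with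
  nodes \<open>w\<close> and \<open>-w\<close>, whose weights have absolute sum \<open>1/2\<close>, yields the factor \<open>1/2\<close> in the
  quadratic condition (\<open>F_increment_center\<close>).

  That \<open>A (F u) = 0\<close> implies \<open>F u = 0\<close> is the injectivity of \<open>A\<close> (\<open>A_injective\<close>). Since \<open>A J\<close> is
  close to the identity, it is injective, and \<open>J\<close> is bounded below. Moreover \<open>J = L + V\<close>, with \<open>V\<close> the
  multiplication by a bounded real function, is symmetric. A symmetric operator of this kind that is
  bounded below is onto (\<open>J_surjective\<close>), so the injectivity of \<open>A J\<close> passes to \<open>A\<close>.

  What remains is the analysis of the space: it is complete (\<open>HD_complete\<close>), \<open>L\<close> is a symmetric
  bijection onto the square integrable functions (\<open>L_surjective\<close>, \<open>L_symmetric\<close>), and its elements are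
  bounded functions because the inverse of the symbol is square integrable (\<open>sup_le_nl\<close>), which makes
  \<open>F\<close> differentiable (\<open>F_has_derivative\<close>). All of this rests on Plancherel's theorem for the transform
  defined by truncation. The isometry comes from a Gaussian regularization (\<open>fint_isometric\<close>), and
  the inversion formula from the isometry and Fubini's theorem (\<open>has_ft_inverse\<close>).
\<close>

section \<open>Square integrable functions\<close>

text \<open>
  The unqualified name of this fact denotes its version for the gauge integral.
\<close>

lemmas integrable_domI = Bochner_Integration.integrable_bound

abbreviation L2_lim :: "(nat \<Rightarrow> plane \<Rightarrow> 'b::real_normed_vector) \<Rightarrow> (plane \<Rightarrow> 'b) \<Rightarrow> bool" where
  "L2_lim f g \<equiv> (\<lambda>n. norm2 (\<lambda>x. f n x - g x)) \<longlonglongrightarrow> 0"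

lemma L2_measurable [measurable_dest]: "f \<in> L2 \<Longrightarrow> f \<in> borel_measurable borel"
  by (simp add: L2_def)

lemma L2_integrable: "f \<in> L2 \<Longrightarrow> integrable lborel (\<lambda>x. (norm (f x))\<^sup>2)"
  by (simp add: L2_def)

lemma norm2_nonneg [simp]: "0 \<le> norm2 f"
  by (simp add: norm2_def)

lemma norm2_squared: "(norm2 f)\<^sup>2 = (LINT x|lborel. (norm (f x))\<^sup>2)"
  by (simp add: norm2_def)

lemma nn_integral_L2:
  assumes "f \<in> L2"
  shows "(\<integral>\<^sup>+x. ennreal ((norm (f x))\<^sup>2) \<partial>lborel) = ennreal ((norm2 f)\<^sup>2)"
  using L2_integrable[OF assms] by (simp add: norm2_squared nn_integral_eq_integral)

lemma L2_I_bound: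
  fixes f :: "plane \<Rightarrow> 'b::{banach,second_countable_topology}"
  assumes [measurable]: "f \<in> borel_measurable borel" and "0 \<le> c"
    and le: "(\<integral>\<^sup>+x. ennreal ((norm (f x))\<^sup>2) \<partial>lborel) \<le> ennreal (c\<^sup>2)"
  shows "f \<in> L2" "norm2 f \<le> c"
proof -
  have "integrable lborel (\<lambda>x. (norm (f x))\<^sup>2)"
    using le by (intro integrableI_bounded) (auto simp: top_unique less_top[symmetric])
  then show L2: "f \<in> L2" by (simp add: L2_def)
  have "(norm2 f)\<^sup>2 \<le> c\<^sup>2"
    using le nn_integral_L2[OF L2] by simp
  then show "norm2 f \<le> c" using \<open>0 \<le> c\<close> by (rule power2_le_imp_le)
qed

lemma L2_dominated:
  fixes f :: "plane \<Rightarrow> 'b::{banach,second_countable_topology}"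
    and g :: "plane \<Rightarrow> 'c::{banach,second_countable_topology}"
  assumes [measurable]: "f \<in> borel_measurable borel" and g: "g \<in> L2" and "0 \<le> c"
    and le: "AE x in lborel. norm (f x) \<le> c * norm (g x)"
  shows "f \<in> L2" "norm2 f \<le> c * norm2 g"
proof -
  note [measurable] = L2_measurable[OF g]
  have "(\<integral>\<^sup>+x. ennreal ((norm (f x))\<^sup>2) \<partial>lborel)
      \<le> (\<integral>\<^sup>+x. ennreal (c\<^sup>2) * ennreal ((norm (g x))\<^sup>2) \<partial>lborel)"
  proof (rule nn_integral_mono_AE, use le in eventually_elim)
    case (elim x)
    then have "(norm (f x))\<^sup>2 \<le> (c * norm (g x))\<^sup>2" by (rule power_mono) simp
    then show ?case by (simp add: ennreal_mult'[symmetric] power_mult_distrib ennreal_leI)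
  qed
  also have "\<dots> = ennreal (c\<^sup>2) * ennreal ((norm2 g)\<^sup>2)"
    by (simp add: nn_integral_cmult nn_integral_L2[OF g])
  also have "\<dots> = ennreal ((c * norm2 g)\<^sup>2)"
    by (simp add: ennreal_mult'[symmetric] power_mult_distrib)
  finally show "f \<in> L2" "norm2 f \<le> c * norm2 g"
    using L2_I_bound[of f "c * norm2 g"] \<open>0 \<le> c\<close> by auto
qed

text \<open>
  The second part is the Cauchy-Schwarz inequality.
\<close>

lemma integrable_norm_mult_L2:
  fixes f :: "plane \<Rightarrow> 'b::{banach,second_countable_topology}"
    and g :: "plane \<Rightarrow> 'c::{banach,second_countable_topology}"
  assumes f: "f \<in> L2" and g: "g \<in> L2"
  shows "integrable lborel (\<lambda>x. norm (f x) * norm (g x))"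
    and "(LINT x|lborel. norm (f x) * norm (g x)) \<le> norm2 f * norm2 g"
proof -
  note [measurable] = L2_measurable[OF f] L2_measurable[OF g]
  show int: "integrable lborel (\<lambda>x. norm (f x) * norm (g x))"
  proof (rule integrable_domI)
    show "integrable lborel (\<lambda>x. (norm (f x))\<^sup>2 + (norm (g x))\<^sup>2)"
      using L2_integrable[OF f] L2_integrable[OF g] by simp
    show "AE x in lborel. norm (norm (f x) * norm (g x)) \<le> norm ((norm (f x))\<^sup>2 + (norm (g x))\<^sup>2)"
    proof (rule AE_I2)
      fix x
      have "0 \<le> (norm (f x) - norm (g x))\<^sup>2" "0 \<le> norm (f x) * norm (g x)" by simp_all
      then have "norm (f x) * norm (g x) \<le> (norm (f x))\<^sup>2 + (norm (g x))\<^sup>2"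
        unfolding power2_diff by linarith
      then show "norm (norm (f x) * norm (g x)) \<le> norm ((norm (f x))\<^sup>2 + (norm (g x))\<^sup>2)"
        by simp
    qed
  qed simp
  have nn: "(\<integral>\<^sup>+x. ennreal (norm (f x)) * ennreal (norm (g x)) \<partial>lborel)
      = ennreal (LINT x|lborel. norm (f x) * norm (g x))"
    using int by (simp add: nn_integral_eq_integral ennreal_mult'[symmetric])
  have "ennreal ((LINT x|lborel. norm (f x) * norm (g x))\<^sup>2)
      \<le> (\<integral>\<^sup>+x. (ennreal (norm (f x)))\<^sup>2 \<partial>lborel) * (\<integral>\<^sup>+x. (ennreal (norm (g x)))\<^sup>2 \<partial>lborel)"
    using Cauchy_Schwarz_nn_integral[of "\<lambda>x. ennreal (norm (f x))" lborel "\<lambda>x. ennreal (norm (g x))"]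
    by (simp add: nn ennreal_power)
  also have "\<dots> = ennreal ((norm2 f * norm2 g)\<^sup>2)"
    by (simp add: ennreal_power nn_integral_L2 f g ennreal_mult'[symmetric] power_mult_distrib)
  finally have "(LINT x|lborel. norm (f x) * norm (g x))\<^sup>2 \<le> (norm2 f * norm2 g)\<^sup>2"
    by simp
  then show "(LINT x|lborel. norm (f x) * norm (g x)) \<le> norm2 f * norm2 g"
    by (rule power2_le_imp_le) simp
qed

lemma L2_add:
  fixes f g :: "plane \<Rightarrow> 'b::{banach,second_countable_topology}"
  assumes f: "f \<in> L2" and g: "g \<in> L2"
  shows "(\<lambda>x. f x + g x) \<in> L2" "norm2 (\<lambda>x. f x + g x) \<le> norm2 f + norm2 g"
proof -
  note [measurable] = L2_measurable[OF f] L2_measurable[OF g]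
  note int = L2_integrable[OF f] L2_integrable[OF g] integrable_norm_mult_L2(1)[OF f g]
  have pt: "(norm (f x + g x))\<^sup>2 \<le> (norm (f x))\<^sup>2 + 2 * (norm (f x) * norm (g x)) + (norm (g x))\<^sup>2" for x
    using power_mono[OF norm_triangle_ineq[of "f x" "g x"], of 2] by (simp add: power2_sum)
  have "(\<integral>\<^sup>+x. ennreal ((norm (f x + g x))\<^sup>2) \<partial>lborel)
      \<le> (\<integral>\<^sup>+x. ennreal ((norm (f x))\<^sup>2 + 2 * (norm (f x) * norm (g x)) + (norm (g x))\<^sup>2) \<partial>lborel)"
    by (intro nn_integral_mono ennreal_leI pt)
  also have "\<dots> = ennreal (LINT x|lborel. (norm (f x))\<^sup>2 + 2 * (norm (f x) * norm (g x)) + (norm (g x))\<^sup>2)"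
    using int by (intro nn_integral_eq_integral) auto
  also have "(LINT x|lborel. (norm (f x))\<^sup>2 + 2 * (norm (f x) * norm (g x)) + (norm (g x))\<^sup>2)
      = (norm2 f)\<^sup>2 + 2 * (LINT x|lborel. norm (f x) * norm (g x)) + (norm2 g)\<^sup>2"
    using int by (simp add: norm2_squared)
  also have "ennreal \<dots> \<le> ennreal ((norm2 f + norm2 g)\<^sup>2)"
    using integrable_norm_mult_L2(2)[OF f g] by (intro ennreal_leI) (simp add: power2_sum)
  finally show "(\<lambda>x. f x + g x) \<in> L2" "norm2 (\<lambda>x. f x + g x) \<le> norm2 f + norm2 g"
    using L2_I_bound[of "\<lambda>x. f x + g x" "norm2 f + norm2 g"] by auto
qed

lemma L2_minus:
  fixes f :: "plane \<Rightarrow> 'b::{banach,second_countable_topology}"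
  assumes "f \<in> L2" shows "(\<lambda>x. - f x) \<in> L2" "norm2 (\<lambda>x. - f x) = norm2 f"
  using assms by (simp_all add: L2_def norm2_def)

lemma L2_diff:
  fixes f g :: "plane \<Rightarrow> 'b::{banach,second_countable_topology}"
  assumes f: "f \<in> L2" and g: "g \<in> L2"
  shows "(\<lambda>x. f x - g x) \<in> L2" "norm2 (\<lambda>x. f x - g x) \<le> norm2 f + norm2 g"
  using L2_add[OF f L2_minus(1)[OF g]] L2_minus[OF g] by simp_all

lemma L2_cmult:
  fixes f :: "plane \<Rightarrow> 'b::{banach,second_countable_topology,real_normed_field}"
  assumes f: "f \<in> L2"
  shows "(\<lambda>x. c * f x) \<in> L2" "norm2 (\<lambda>x. c * f x) = norm c * norm2 f"
proof -
  note [measurable] = L2_measurable[OF f]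
  show "(\<lambda>x. c * f x) \<in> L2"
    using L2_integrable[OF f] by (simp add: L2_def norm_mult power_mult_distrib)
  show "norm2 (\<lambda>x. c * f x) = norm c * norm2 f"
    by (simp add: norm2_def norm_mult power_mult_distrib real_sqrt_mult)
qed

lemma norm2_cong_AE:
  fixes f g :: "plane \<Rightarrow> 'b::{banach,second_countable_topology}"
  assumes [measurable]: "f \<in> borel_measurable borel" "g \<in> borel_measurable borel"
    and eq: "AE x in lborel. f x = g x"
  shows "norm2 f = norm2 g"
  unfolding norm2_def using eq by (intro arg_cong[where f=sqrt] integral_cong_AE) auto

lemma L2_cong_AE:
  fixes f g :: "plane \<Rightarrow> 'b::{banach,second_countable_topology}"
  assumes g: "g \<in> borel_measurable borel" and f: "f \<in> L2"
    and eq: "AE x in lborel. g x = f x"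
  shows "g \<in> L2"
  proof (rule L2_dominated(1)[OF g f, of 1])
  show "AE x in lborel. norm (g x) \<le> 1 * norm (f x)"
    using eq by eventually_elim simp
qed simp

lemma norm2_eq_0_iff:
  fixes f :: "plane \<Rightarrow> 'b::{banach,second_countable_topology}"
  assumes "f \<in> L2"
  shows "norm2 f = 0 \<longleftrightarrow> (AE x in lborel. f x = 0)"
  using L2_integrable[OF assms] integral_nonneg_eq_0_iff_AE[of lborel "\<lambda>x. (norm (f x))\<^sup>2"]
  by (simp add: norm2_def)

lemma norm2_zero [simp]: "norm2 (\<lambda>x. 0) = 0"
  by (simp add: norm2_def)

lemma L2_zero [simp]: "(\<lambda>x. 0) \<in> L2"
  by (simp add: L2_def)

lemma norm2_triangle_sub:
  fixes f g :: "plane \<Rightarrow> 'b::{banach,second_countable_topology}"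
  assumes "f \<in> L2" "g \<in> L2"
  shows "norm2 f \<le> norm2 g + norm2 (\<lambda>x. f x - g x)"
  using L2_add(2)[OF assms(2) L2_diff(1)[OF assms]] by simp

lemma norm2_diff_commute: "norm2 (\<lambda>x. f x - g x) = norm2 (\<lambda>x. g x - f x)"
  by (simp add: norm2_def norm_minus_commute)

lemma norm2_triangle_diff:
  fixes f g h :: "plane \<Rightarrow> 'b::{banach,second_countable_topology}"
  assumes "f \<in> L2" "g \<in> L2" "h \<in> L2"
  shows "norm2 (\<lambda>x. f x - h x) \<le> norm2 (\<lambda>x. f x - g x) + norm2 (\<lambda>x. g x - h x)"
  using L2_add(2)[OF L2_diff(1)[OF assms(1,2)] L2_diff(1)[OF assms(2,3)]] by simp

text \<open>
  Fatou's lemma, in the form in which it turns a uniform bound along an almost everywhere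
  convergent sequence into square integrability of the limit.
\<close>

lemma norm2_Fatou:
  fixes f :: "nat \<Rightarrow> plane \<Rightarrow> 'b::{banach,second_countable_topology}"
  assumes f: "\<And>n. f n \<in> L2" and [measurable]: "g \<in> borel_measurable borel"
    and lim: "AE x in lborel. (\<lambda>n. f n x) \<longlonglongrightarrow> g x"
    and le: "eventually (\<lambda>n. norm2 (f n) \<le> c) sequentially"
  shows "g \<in> L2" "norm2 g \<le> c"
proof -
  note [measurable] = L2_measurable[OF f]
  obtain n where "norm2 (f n) \<le> c" using eventually_happens[OF le] by auto
  then have "0 \<le> c" using norm2_nonneg[of "f n"] by linarith
  have "(\<integral>\<^sup>+x. ennreal ((norm (g x))\<^sup>2) \<partial>lborel)
      = (\<integral>\<^sup>+x. liminf (\<lambda>n. ennreal ((norm (f n x))\<^sup>2)) \<partial>lborel)"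
  proof (rule nn_integral_cong_AE, use lim in eventually_elim)
    case (elim x)
    then have "(\<lambda>n. ennreal ((norm (f n x))\<^sup>2)) \<longlonglongrightarrow> ennreal ((norm (g x))\<^sup>2)"
      by (intro tendsto_intros)
    then show ?case by (metis lim_imp_Liminf sequentially_bot)
  qed
  also have "\<dots> \<le> liminf (\<lambda>n. \<integral>\<^sup>+x. ennreal ((norm (f n x))\<^sup>2) \<partial>lborel)"
    by (rule nn_integral_liminf) simp
  also have "\<dots> = liminf (\<lambda>n. ennreal ((norm2 (f n))\<^sup>2))"
    by (simp add: nn_integral_L2[OF f])
  also have "\<dots> \<le> liminf (\<lambda>n. ennreal (c\<^sup>2))"
    by (rule Liminf_mono, use le in eventually_elim) (simp add: power_mono)
  finally have "(\<integral>\<^sup>+x. ennreal ((norm (g x))\<^sup>2) \<partial>lborel) \<le> ennreal (c\<^sup>2)"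
    by (simp add: Liminf_const)
  then show "g \<in> L2" "norm2 g \<le> c" using L2_I_bound[of g c] \<open>0 \<le> c\<close> by auto
qed

text \<open>
  With the weights \<open>2^n\<close> the sum of \<open>2^n * (norm (f (Suc n) x - f n x))\<^sup>2\<close> still has a finite
  integral. So at almost every point the increments are \<open>O(2^(-n/2))\<close> and the sequence converges.
\<close>

lemma L2_rapidly_Cauchy_limit:
  fixes f :: "nat \<Rightarrow> plane \<Rightarrow> 'b::{banach,second_countable_topology}"
  assumes f: "\<And>n. f n \<in> L2"
    and fast: "\<And>n. norm2 (\<lambda>x. f (Suc n) x - f n x) \<le> (1/2)^n"
  shows "\<exists>g. g \<in> borel_measurable borel \<and> (AE x in lborel. (\<lambda>n. f n x) \<longlonglongrightarrow> g x)"
proof -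
  note [measurable] = L2_measurable[OF f]
  have "(\<integral>\<^sup>+x. (\<Sum>n. ennreal (2^n * (norm (f (Suc n) x - f n x))\<^sup>2)) \<partial>lborel)
      = (\<Sum>n. \<integral>\<^sup>+x. ennreal (2^n * (norm (f (Suc n) x - f n x))\<^sup>2) \<partial>lborel)"
    by (rule nn_integral_suminf) simp
  also have "\<dots> = (\<Sum>n. ennreal (2^n * (norm2 (\<lambda>x. f (Suc n) x - f n x))\<^sup>2))"
    by (simp add: ennreal_mult' nn_integral_cmult nn_integral_L2[OF L2_diff(1)[OF f f]])
  also have "\<dots> \<le> (\<Sum>n. ennreal ((1/2)^n))"
  proof (rule suminf_le)
    fix n
    have "2^n * (norm2 (\<lambda>x. f (Suc n) x - f n x))\<^sup>2 \<le> 2^n * ((1/2)^n)\<^sup>2"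
      by (intro mult_left_mono power_mono fast) auto
    also have "\<dots> = (1/2)^n" by (simp add: power2_eq_square power_one_over field_simps)
    finally show "ennreal (2^n * (norm2 (\<lambda>x. f (Suc n) x - f n x))\<^sup>2) \<le> ennreal ((1/2)^n)"
      by (rule ennreal_leI)
  qed auto
  also have "\<dots> = ennreal (\<Sum>n. (1/2)^n)"
    by (rule suminf_ennreal2) (auto intro: summable_geometric)
  also have "\<dots> < \<infinity>" by simp
  finally have "(\<integral>\<^sup>+x. (\<Sum>n. ennreal (2^n * (norm (f (Suc n) x - f n x))\<^sup>2)) \<partial>lborel) \<noteq> \<infinity>" by simp
  then have "AE x in lborel. (\<Sum>n. ennreal (2^n * (norm (f (Suc n) x - f n x))\<^sup>2)) \<noteq> \<infinity>"
    by (intro nn_integral_noteq_infinite) auto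
  then have conv: "AE x in lborel. convergent (\<lambda>n. f n x)"
  proof eventually_elim
    case (elim x)
    let ?a = "\<lambda>n. 2^n * (norm (f (Suc n) x - f n x))\<^sup>2"
    have "summable ?a"
      using elim by (intro summable_suminf_not_top) auto
    then have "Bseq ?a"
      by (intro convergent_imp_Bseq convergentI[OF summable_LIMSEQ_zero])
    then obtain C where "\<And>n. norm (?a n) \<le> C" by (rule BseqE) blast
    then have C: "?a n \<le> C" for n by (metis abs_ge_self order_trans real_norm_def)
    have geo: "norm (f (Suc n) x - f n x) \<le> sqrt C * (1 / sqrt 2)^n" for n
    proof -
      have "(norm (f (Suc n) x - f n x))\<^sup>2 \<le> C / 2^n" using C[of n] by (simp add: field_simps)
      then have "norm (f (Suc n) x - f n x) \<le> sqrt (C / 2^n)" by (rule real_le_rsqrt)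
      then show ?thesis by (simp add: real_sqrt_divide real_sqrt_power power_divide)
    qed
    have "summable (\<lambda>n. sqrt C * (1 / sqrt 2)^n)"
      by (rule summable_mult, rule summable_geometric) simp
    then have "summable (\<lambda>n. f (Suc n) x - f n x)"
      by (rule summable_comparison_test'[where N=0]) (rule geo)
    then have "convergent (\<lambda>n. \<Sum>i<n. f (Suc i) x - f i x)"
      by (simp add: summable_iff_convergent)
    then have "convergent (\<lambda>n. (f n x - f 0 x) + f 0 x)"
      unfolding sum_lessThan_telescope[of "\<lambda>i. f i x"] by (intro convergent_add convergent_const)
    then show ?case by simp
  qed
  have "(\<lambda>x. lim (\<lambda>n. f n x)) \<in> borel_measurable borel" by measurable
  moreover have "AE x in lborel. (\<lambda>n. f n x) \<longlonglongrightarrow> lim (\<lambda>n. f n x)"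
    using conv by eventually_elim (simp add: convergent_LIMSEQ_iff)
  ultimately show ?thesis by blast
qed

text \<open>
  The theorem of Riesz and Fischer: a rapidly Cauchy subsequence converges almost everywhere, and
  Fatou's lemma transfers the Cauchy estimates to its limit.
\<close>

theorem L2_complete:
  fixes f :: "nat \<Rightarrow> plane \<Rightarrow> 'b::{banach,second_countable_topology}"
  assumes f: "\<And>n. f n \<in> L2"
    and Cauchy: "\<And>e. e > 0 \<Longrightarrow> \<exists>N. \<forall>m\<ge>N. \<forall>n\<ge>N. norm2 (\<lambda>x. f m x - f n x) < e"
  shows "\<exists>g\<in>L2. L2_lim f g"
proof -
  note [measurable] = L2_measurable[OF f]
  have "\<exists>N. \<forall>k. \<forall>m\<ge>N k. \<forall>n\<ge>N k. norm2 (\<lambda>x. f m x - f n x) < (1/2)^k"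
    by (intro choice allI Cauchy) simp
  then obtain N where N: "\<And>k m n. N k \<le> m \<Longrightarrow> N k \<le> n \<Longrightarrow> norm2 (\<lambda>x. f m x - f n x) < (1/2)^k"
    by blast
  define s where "s k = (\<Sum>i\<le>k. N i) + k" for k
  have sN: "N k \<le> s k" for k
    unfolding s_def by (rule trans_le_add1, rule member_le_sum) auto
  have mono: "s k \<le> s (Suc k)" "k \<le> s k" for k by (auto simp: s_def)
  have "norm2 (\<lambda>x. f (s (Suc k)) x - f (s k) x) \<le> (1/2)^k" for k
    using N[of k "s (Suc k)" "s k"] sN[of k] mono(1)[of k] by simp
  then obtain g where [measurable]: "g \<in> borel_measurable borel"
    and lim: "AE x in lborel. (\<lambda>k. f (s k) x) \<longlonglongrightarrow> g x"
    using L2_rapidly_Cauchy_limit[of "\<lambda>k. f (s k)"] f by blast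
  have close: "(\<lambda>x. f n x - g x) \<in> L2 \<and> norm2 (\<lambda>x. f n x - g x) \<le> e"
    if e: "\<And>m. m \<ge> K \<Longrightarrow> norm2 (\<lambda>x. f n x - f m x) \<le> e" for n K e
  proof -
    have "AE x in lborel. (\<lambda>k. f n x - f (s k) x) \<longlonglongrightarrow> f n x - g x"
      using lim by eventually_elim (intro tendsto_intros)
    moreover have "eventually (\<lambda>k. norm2 (\<lambda>x. f n x - f (s k) x) \<le> e) sequentially"
      using eventually_ge_at_top[of K] by eventually_elim (use mono(2) le_trans in \<open>blast intro: e\<close>)
    ultimately show ?thesis
      using norm2_Fatou[of "\<lambda>k x. f n x - f (s k) x" "\<lambda>x. f n x - g x" e] L2_diff(1)[OF f f] by simp
  qed
  have conv: "\<exists>K. \<forall>n\<ge>K. (\<lambda>x. f n x - g x) \<in> L2 \<and> norm2 (\<lambda>x. f n x - g x) \<le> e" if "e > 0" for e :: real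
  proof -
    obtain K where "\<forall>m\<ge>K. \<forall>n\<ge>K. norm2 (\<lambda>x. f m x - f n x) < e" using Cauchy[OF \<open>e > 0\<close>] by blast
    then show ?thesis using close[of K] by (meson less_imp_le)
  qed
  obtain n where "(\<lambda>x. f n x - g x) \<in> L2" using conv[of 1] by auto
  from L2_diff(1)[OF f[of n] this] have "g \<in> L2" by simp
  moreover have "L2_lim f g"
  proof (rule LIMSEQ_I)
    fix e :: real assume "e > 0"
    then show "\<exists>no. \<forall>n\<ge>no. norm (norm2 (\<lambda>x. f n x - g x) - 0) < e"
      using conv[of "e/2"] by fastforce
  qed
  ultimately show ?thesis by blast
qed

section \<open>Integration on the plane\<close>

lemma borel_measurable_cnj [measurable (raw)]:
  assumes "f \<in> borel_measurable M"
  shows "(\<lambda>x. cnj (f x)) \<in> borel_measurable M"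
  by (rule borel_measurable_continuous_on[OF _ assms]) (intro continuous_intros)

lemma integrable_tensor:
  fixes f :: "'a::euclidean_space \<Rightarrow> 'c::{real_normed_field,banach,second_countable_topology}"
    and g :: "'b::euclidean_space \<Rightarrow> 'c"
  assumes f: "integrable lborel f" and g: "integrable lborel g"
  shows "integrable (lborel \<Otimes>\<^sub>M lborel) (\<lambda>(x, y). f x * g y)"
proof (rule lborel_pair.Fubini_integrable)
  have [measurable]: "f \<in> borel_measurable borel" "g \<in> borel_measurable borel"
    using f g by (auto dest: borel_measurable_integrable)
  show "(\<lambda>(x, y). f x * g y) \<in> borel_measurable (lborel \<Otimes>\<^sub>M lborel)" by measurable
  show "integrable lborel (\<lambda>x. LINT y|lborel. norm (case (x, y) of (x, y) \<Rightarrow> f x * g y))"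
    using f by (simp add: norm_mult)
  show "AE x in lborel. integrable lborel (\<lambda>y. case (x, y) of (x, y) \<Rightarrow> f x * g y)"
    using g by simp
qed

lemma integral_tensor_plane:
  fixes f g :: "real \<Rightarrow> 'c::{real_normed_field,banach,second_countable_topology}"
  assumes f: "integrable lborel f" and g: "integrable lborel g"
  shows "integrable lborel (\<lambda>x::plane. f (fst x) * g (snd x))"
    and "(LINT x|lborel. f (fst (x::plane)) * g (snd x)) = (LINT s|lborel. f s) * (LINT s|lborel. g s)"
proof -
  have int: "integrable (lborel \<Otimes>\<^sub>M lborel) (\<lambda>(x, y). f x * g y)"
    by (rule integrable_tensor[OF f g])
  then show "integrable lborel (\<lambda>x::plane. f (fst x) * g (snd x))"
    by (simp add: lborel_prod case_prod_beta')
  show "(LINT x|lborel. f (fst (x::plane)) * g (snd x)) = (LINT s|lborel. f s) * (LINT s|lborel. g s)"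
    using lborel_pair.integral_fst[OF int] by (simp add: lborel_prod case_prod_beta')
qed

lemma integral_plane_affine:
  fixes f :: "plane \<Rightarrow> 'b::{banach,second_countable_topology}" and c :: real
  assumes [measurable]: "f \<in> borel_measurable borel" and c: "c \<noteq> 0"
  shows "(LINT x|lborel. f x) = c\<^sup>2 *\<^sub>R (LINT x|lborel. f (t + c *\<^sub>R x))"
  by (subst lborel_affine[OF c, of t])
     (simp add: integral_density integral_distr power2_eq_square)

section \<open>The Fourier integral\<close>

definition fkernel :: "plane \<Rightarrow> plane \<Rightarrow> complex" where
  "fkernel x \<xi> = exp (- (2 * of_real pi * \<i> * of_real (x \<bullet> \<xi>)))"

text \<open>
  The transform has to be defined for complex functions, since inverting it means applying it to
  transforms.
\<close>

definition fint :: "(plane \<Rightarrow> complex) \<Rightarrow> plane \<Rightarrow> complex" where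
  "fint f \<xi> = (LINT x|lborel. f x * fkernel x \<xi>)"

lemma fkernel_commute: "fkernel x \<xi> = fkernel \<xi> x"
  by (simp add: fkernel_def inner_commute)

lemma norm_fkernel [simp]: "norm (fkernel x \<xi>) = 1"
  by (simp add: fkernel_def)

lemma cnj_fkernel: "cnj (fkernel x \<xi>) = fkernel (- x) \<xi>"
  by (simp add: fkernel_def exp_cnj)

lemma fkernel_add: "fkernel \<xi> (x + y) = fkernel \<xi> x * fkernel \<xi> y"
  by (simp add: fkernel_def exp_add[symmetric] algebra_simps)

lemma measurable_fkernel [measurable (raw)]:
  assumes [measurable]: "f \<in> borel_measurable M" "g \<in> borel_measurable M"
  shows "(\<lambda>x. fkernel (f x) (g x)) \<in> borel_measurable M"
  unfolding fkernel_def by measurable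

lemma integrable_fkernel:
  assumes "integrable lborel f"
  shows "integrable lborel (\<lambda>x. f x * fkernel x \<xi>)"
proof -
  have [measurable]: "f \<in> borel_measurable borel" using assms by (auto dest: borel_measurable_integrable)
  show ?thesis
    by (rule integrable_domI[OF assms]) (auto simp: norm_mult)
qed

lemma measurable_fint [measurable]:
  assumes [measurable]: "f \<in> borel_measurable borel"
  shows "fint f \<in> borel_measurable borel"
  unfolding fint_def[abs_def] by measurable

lemma norm_fint_le:
  shows "norm (fint f \<xi>) \<le> (LINT x|lborel. norm (f x))"
proof -
  have "norm (fint f \<xi>) \<le> (LINT x|lborel. norm (f x * fkernel x \<xi>))"
    unfolding fint_def by (rule integral_norm_bound)
  then show ?thesis by (simp add: norm_mult)
qed

lemma fint_diff:
  assumes "integrable lborel f" "integrable lborel g"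
  shows "fint (\<lambda>x. f x - g x) \<xi> = fint f \<xi> - fint g \<xi>"
  using assms by (simp add: fint_def left_diff_distrib integrable_fkernel)

lemma fint_add:
  assumes "integrable lborel f" "integrable lborel g"
  shows "fint (\<lambda>x. f x + g x) \<xi> = fint f \<xi> + fint g \<xi>"
  using assms by (simp add: fint_def distrib_right integrable_fkernel)

lemma fint_cmult: "fint (\<lambda>x. c * f x) \<xi> = c * fint f \<xi>"
  by (simp add: fint_def mult.assoc)

text \<open>
  Fubini's theorem. This symmetry evaluates the Gaussian regularization, and after passage to the
  limit it yields the inversion formula.
\<close>

lemma fint_pairing:
  assumes f: "integrable lborel f" and g: "integrable lborel g"
  shows "(LINT \<xi>|lborel. fint f \<xi> * g \<xi>) = (LINT x|lborel. f x * fint g x)"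
proof -
  have [measurable]: "f \<in> borel_measurable borel" "g \<in> borel_measurable borel"
    using f g by (auto dest: borel_measurable_integrable)
  have int: "integrable (lborel \<Otimes>\<^sub>M lborel) (\<lambda>(x, \<xi>). f x * g \<xi> * fkernel x \<xi>)"
    by (rule integrable_domI[OF integrable_tensor[OF f g]])
       (auto simp: norm_mult case_prod_beta)
  have "(LINT \<xi>|lborel. fint f \<xi> * g \<xi>) = (LINT \<xi>|lborel. LINT x|lborel. f x * g \<xi> * fkernel x \<xi>)"
    unfolding fint_def integral_mult_left_zero[symmetric] by (simp add: mult_ac)
  also have "\<dots> = (LINT x|lborel. LINT \<xi>|lborel. f x * g \<xi> * fkernel x \<xi>)"
    by (rule lborel_pair.Fubini_integral[OF int])
  also have "\<dots> = (LINT x|lborel. f x * fint g x)"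
    unfolding fint_def integral_mult_right_zero[symmetric]
    by (simp add: mult_ac fkernel_commute)
  finally show ?thesis .
qed

section \<open>The Gaussian\<close>

definition gauss :: "plane \<Rightarrow> real" where
  "gauss z = std_normal_density (fst z) * std_normal_density (snd z)"

lemma gauss_eq: "gauss z = exp (- (norm z)\<^sup>2 / 2) / (2 * pi)"
  by (simp add: gauss_def std_normal_density_def norm_prod_def real_sqrt_mult exp_add[symmetric]
      add_divide_distrib field_simps)

lemma measurable_gauss [measurable]: "gauss \<in> borel_measurable borel"
  unfolding gauss_def[abs_def] borel_prod[symmetric] by measurable

lemma gauss_nonneg [simp]: "0 \<le> gauss z"
  by (simp add: gauss_eq)

lemma integrable_gauss [simp]: "integrable lborel gauss"
  unfolding gauss_def[abs_def] by (rule integral_tensor_plane) auto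

lemma integral_gauss [simp]: "(LINT z|lborel. gauss z) = 1"
  unfolding gauss_def[abs_def] by (subst integral_tensor_plane) auto

text \<open>
  This is the characteristic function of the standard normal distribution.
\<close>

lemma fourier_std_normal_density:
  "(LINT s|lborel. complex_of_real (std_normal_density s) * exp (\<i> * of_real (t * s)))
    = of_real (exp (- t\<^sup>2 / 2))"
  "integrable lborel (\<lambda>s. complex_of_real (std_normal_density s) * exp (\<i> * of_real (t * s)))"
proof -
  have "char std_normal_distribution t
      = (LINT s|lborel. complex_of_real (std_normal_density s) * exp (\<i> * of_real (t * s)))"
    unfolding char_def by (subst integral_density) (auto simp: scaleR_conv_of_real)
  then show "(LINT s|lborel. complex_of_real (std_normal_density s) * exp (\<i> * of_real (t * s)))
    = of_real (exp (- t\<^sup>2 / 2))" by (simp add: char_std_normal_distribution)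
  show "integrable lborel (\<lambda>s. complex_of_real (std_normal_density s) * exp (\<i> * of_real (t * s)))"
    by (rule integrable_domI[OF integrable_normal_density[where \<mu>=0 and \<sigma>=1]])
       (auto simp: norm_mult)
qed

lemma fourier_gauss:
  "(LINT z|lborel. complex_of_real (gauss z) * exp (\<i> * of_real (t \<bullet> z)))
    = of_real (exp (- (norm t)\<^sup>2 / 2))"
proof -
  have "(LINT z|lborel. complex_of_real (gauss z) * exp (\<i> * of_real (t \<bullet> z)))
    = (LINT z|lborel. (complex_of_real (std_normal_density (fst z)) * exp (\<i> * of_real (fst t * fst z))) *
        (complex_of_real (std_normal_density (snd z)) * exp (\<i> * of_real (snd t * snd z))))"
    by (intro Bochner_Integration.integral_cong)
       (simp_all add: gauss_def inner_prod_def distrib_left exp_add mult_ac)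
  also have "\<dots> = of_real (exp (- (fst t)\<^sup>2 / 2)) * of_real (exp (- (snd t)\<^sup>2 / 2))"
    by (subst integral_tensor_plane) (simp_all only: fourier_std_normal_density)
  also have "\<dots> = of_real (exp (- (norm t)\<^sup>2 / 2))"
    by (simp add: norm_prod_def exp_add[symmetric] of_real_mult[symmetric] add_divide_distrib
        del: of_real_mult)
  finally show ?thesis .
qed

lemma integrable_gauss_scaled:
  assumes "c \<noteq> 0" shows "integrable lborel (\<lambda>\<xi>. gauss (c *\<^sub>R \<xi>))"
proof (rule ccontr)
  assume "\<not> ?thesis"
  then have "(LINT \<xi>|lborel. gauss (c *\<^sub>R \<xi>)) = 0" by (rule not_integrable_integral_eq)
  then show False using integral_plane_affine[of gauss c 0] assms by simp
qed

text \<open>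
  As \<open>c\<close> grows, the weight on the left tends to \<open>1\<close>, while its transform is the normal density
  concentrated at scale \<open>1 / c\<close>.
\<close>

lemma fint_gauss_scaled:
  assumes c: "c > 0"
  shows "fint (\<lambda>\<xi>. of_real (2 * pi * gauss ((2 * pi / c) *\<^sub>R \<xi>))) t = of_real (c\<^sup>2 * gauss (c *\<^sub>R t))"
proof -
  have "fint (\<lambda>\<xi>. of_real (2 * pi * gauss ((2 * pi / c) *\<^sub>R \<xi>))) t
     = (LINT \<xi>|lborel. of_real (2 * pi * gauss ((2 * pi / c) *\<^sub>R \<xi>)) * fkernel \<xi> t)"
    by (simp add: fint_def)
  also have "\<dots> = (c / (2 * pi))\<^sup>2 *\<^sub>R
       (LINT z|lborel. of_real (2 * pi * gauss z) * fkernel ((c / (2 * pi)) *\<^sub>R z) t)"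
    using c by (subst integral_plane_affine[of _ "c / (2 * pi)" 0]) auto
  also have "(LINT z|lborel. of_real (2 * pi * gauss z) * fkernel ((c / (2 * pi)) *\<^sub>R z) t)
      = of_real (2 * pi) * (LINT z|lborel. of_real (gauss z) * exp (\<i> * of_real ((- (c *\<^sub>R t)) \<bullet> z)))"
    unfolding integral_mult_right_zero[symmetric]
    by (intro Bochner_Integration.integral_cong) (auto simp: fkernel_def inner_commute field_simps)
  also have "\<dots> = of_real (2 * pi * exp (- (norm (c *\<^sub>R t))\<^sup>2 / 2))"
    unfolding fourier_gauss by simp
  also have "(c / (2 * pi))\<^sup>2 *\<^sub>R \<dots> = of_real ((c / (2 * pi))\<^sup>2 * (2 * pi * exp (- (norm (c *\<^sub>R t))\<^sup>2 / 2)))"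
    by (simp add: scaleR_conv_of_real)
  also have "(c / (2 * pi))\<^sup>2 * (2 * pi * exp (- (norm (c *\<^sub>R t))\<^sup>2 / 2)) = c\<^sup>2 * gauss (c *\<^sub>R t)"
    by (simp add: gauss_eq power2_eq_square)
  finally show ?thesis .
qed

section \<open>The Fourier integral is isometric\<close>

text \<open>
  The integral of \<open>(norm (fint f \<xi>))\<^sup>2\<close> is not known to be finite beforehand, so it is computed with a Gaussian
  weight. Two applications of the pairing move both transforms onto the weight, whose transform is
  again Gaussian; what is left is \<open>f\<close> integrated against a local average of its conjugate.
\<close>

lemma fint_gauss_regularized:
  assumes f: "integrable lborel f" and c: "c > 0"
  shows "(LINT \<xi>|lborel. fint f \<xi> * (cnj (fint f \<xi>) * of_real (2 * pi * gauss ((2 * pi / c) *\<^sub>R \<xi>))))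
    = (LINT x|lborel. f x * (LINT z|lborel. cnj (f (x - (1 / c) *\<^sub>R z)) * of_real (gauss z)))"
proof -
  define W where "W \<xi> = complex_of_real (2 * pi * gauss ((2 * pi / c) *\<^sub>R \<xi>))" for \<xi>
  have [measurable]: "f \<in> borel_measurable borel" using f by (auto dest: borel_measurable_integrable)
  have intW: "integrable lborel W"
    unfolding W_def using c integrable_gauss_scaled[of "2 * pi / c"] by simp
  then have [measurable]: "W \<in> borel_measurable borel" by (auto dest: borel_measurable_integrable)
  have fW: "fint W t = of_real (c\<^sup>2 * gauss (c *\<^sub>R t))" for t
    using fint_gauss_scaled[OF c, of t] by (simp add: W_def[abs_def])
  have intf': "integrable lborel (\<lambda>y. cnj (f (- y)))"
  proof -
    have "integrable (distr lborel borel (\<lambda>x. 0 + (-1) *\<^sub>R x)) f"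
      using f by (subst (asm) lborel_affine[of "-1" 0]) (auto simp: density_1)
    then show ?thesis by (subst (asm) integrable_distr_eq) auto
  qed
  have conj: "cnj (fint f \<xi>) = fint (\<lambda>y. cnj (f (- y))) \<xi>" for \<xi>
  proof -
    have "cnj (fint f \<xi>) = (LINT y|lborel. cnj (f y) * fkernel (- y) \<xi>)"
      using integral_bounded_linear'[OF bounded_linear_cnj bounded_linear_cnj, of lborel "\<lambda>y. f y * fkernel y \<xi>"]
      by (simp add: fint_def cnj_fkernel)
    also have "\<dots> = fint (\<lambda>y. cnj (f (- y))) \<xi>"
      by (subst integral_plane_affine[of _ "-1" 0]) (auto simp: fint_def)
    finally show ?thesis .
  qed
  have inner: "fint (\<lambda>\<xi>. cnj (fint f \<xi>) * W \<xi>) x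
      = (LINT z|lborel. cnj (f (x - (1 / c) *\<^sub>R z)) * of_real (gauss z))" for x
  proof -
    have "fint (\<lambda>\<xi>. cnj (fint f \<xi>) * W \<xi>) x
        = (LINT \<xi>|lborel. fint (\<lambda>y. cnj (f (- y))) \<xi> * (W \<xi> * fkernel \<xi> x))"
      by (subst fint_def) (simp only: conj mult.assoc)
    also have "\<dots> = (LINT y|lborel. cnj (f (- y)) * fint (\<lambda>\<xi>. W \<xi> * fkernel \<xi> x) y)"
      by (rule fint_pairing[OF intf' integrable_fkernel[OF intW]])
    also have "\<dots> = (LINT y|lborel. cnj (f (- y)) * fint W (x + y))"
      unfolding fint_def by (simp only: mult.assoc fkernel_add)
    also have "\<dots> = (LINT y|lborel. cnj (f (- y)) * of_real (c\<^sup>2 * gauss (c *\<^sub>R (x + y))))"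
      unfolding fW ..
    also have "\<dots> = (LINT z|lborel. cnj (f (x - (1 / c) *\<^sub>R z)) * of_real (gauss z))"
      using c by (subst integral_plane_affine[of _ "1 / c" "- x"])
        (auto simp: scaleR_conv_of_real power_divide algebra_simps simp flip: integral_mult_right_zero)
    finally show ?thesis .
  qed
  have "integrable lborel (\<lambda>\<xi>. cnj (fint f \<xi>) * W \<xi>)"
  proof (rule integrable_domI)
    show "integrable lborel (\<lambda>\<xi>. (LINT x|lborel. norm (f x)) *\<^sub>R W \<xi>)" using intW by simp
    show "AE \<xi> in lborel. norm (cnj (fint f \<xi>) * W \<xi>) \<le> norm ((LINT x|lborel. norm (f x)) *\<^sub>R W \<xi>)"
      by (auto simp: norm_mult intro!: mult_right_mono norm_fint_le)
  qed measurable
  from fint_pairing[OF f this] show ?thesis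
    unfolding inner unfolding W_def .
qed

lemma norm2_dominated_convergence:
  fixes f :: "nat \<Rightarrow> plane \<Rightarrow> 'b::{banach,second_countable_topology}"
  assumes f[measurable]: "\<And>n. f n \<in> borel_measurable borel" "g \<in> borel_measurable borel"
    and lim: "AE x in lborel. (\<lambda>n. f n x) \<longlonglongrightarrow> g x"
    and w: "integrable lborel (\<lambda>x. (w x)\<^sup>2)" and [measurable]: "w \<in> borel_measurable borel"
    and le: "\<And>n. AE x in lborel. norm (f n x - g x) \<le> w x"
  shows "L2_lim f g"
proof -
  have "(\<lambda>n. LINT x|lborel. (norm (f n x - g x))\<^sup>2) \<longlonglongrightarrow> (LINT x|(lborel::plane measure). (0::real))"
  proof (rule integral_dominated_convergence[where w="\<lambda>x. (w x)\<^sup>2"])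
    show "AE x in lborel. (\<lambda>n. (norm (f n x - g x))\<^sup>2) \<longlonglongrightarrow> 0"
      using lim
    proof eventually_elim
      case (elim x)
      then have "(\<lambda>n. (norm (f n x - g x))\<^sup>2) \<longlonglongrightarrow> (norm (g x - g x))\<^sup>2" by (intro tendsto_intros)
      then show ?case by simp
    qed
    show "AE x in lborel. norm ((norm (f n x - g x))\<^sup>2) \<le> (w x)\<^sup>2" for n
      using le[of n] by eventually_elim (simp add: power_mono)
  qed (use w in auto)
  then have "(\<lambda>n. sqrt (LINT x|lborel. (norm (f n x - g x))\<^sup>2)) \<longlonglongrightarrow> sqrt 0"
    by (intro tendsto_intros) simp
  then show ?thesis by (simp add: norm2_def)
qed

lemma norm2_tendsto:
  fixes f :: "nat \<Rightarrow> plane \<Rightarrow> 'b::{banach,second_countable_topology}"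
  assumes f: "\<And>n. f n \<in> L2" and g: "g \<in> L2" and lim: "L2_lim f g"
  shows "(\<lambda>n. norm2 (f n)) \<longlonglongrightarrow> norm2 g"
proof (rule LIM_zero_cancel, rule Lim_null_comparison[OF _ lim], rule always_eventually, rule allI)
  show "norm (norm2 (f n) - norm2 g) \<le> norm2 (\<lambda>x. f n x - g x)" for n
    using norm2_triangle_sub[OF f[of n] g] norm2_triangle_sub[OF g f[of n]]
      norm2_diff_commute[of g "f n"] by simp
qed

definition bdd_cont :: "(plane \<Rightarrow> complex) \<Rightarrow> bool" where
  "bdd_cont f \<longleftrightarrow> continuous_on UNIV f \<and> bounded (range f)"

lemma bdd_contE:
  assumes "bdd_cont f" 
  obtains M where "continuous_on UNIV f" "f \<in> borel_measurable borel" "0 \<le> M" "\<And>x. norm (f x) \<le> M"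
proof -
  obtain M where "\<And>x. norm (f x) \<le> M" using assms by (auto simp: bdd_cont_def bounded_iff)
  moreover from this[of undefined] have "0 \<le> M" by (rule order_trans[OF norm_ge_zero])
  ultimately show thesis
    using assms that[of M] by (auto simp: bdd_cont_def intro: borel_measurable_continuous_onI)
qed

lemma bounded_integrable_L2:
  fixes f :: "plane \<Rightarrow> 'b::{banach,second_countable_topology}"
  assumes f: "integrable lborel f" and M: "\<And>x. norm (f x) \<le> M"
  shows "f \<in> L2"
proof -
  have [measurable]: "f \<in> borel_measurable borel" using f by (auto dest: borel_measurable_integrable)
  have "integrable lborel (\<lambda>x. (norm (f x))\<^sup>2)"
  proof (rule integrable_domI)
    show "integrable lborel (\<lambda>x. M * norm (f x))" using f by (intro integrable_mult_right integrable_norm)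
    have "norm (f x) * norm (f x) \<le> \<bar>M\<bar> * norm (f x)" for x
      by (rule mult_right_mono[OF order_trans[OF M abs_ge_self]]) simp
    then show "AE x in lborel. norm ((norm (f x))\<^sup>2) \<le> norm (M * norm (f x))"
      by (intro AE_I2) (simp add: power2_eq_square abs_mult)
  qed simp
  then show ?thesis by (simp add: L2_def)
qed

text \<open>
  In the regularized identity let the weight tend to \<open>1\<close>. By continuity the local averages of the
  conjugate of \<open>f\<close> tend to it pointwise and boundedly, so the right side tends to \<open>(norm2 f)\<^sup>2\<close>.
  On the left, Fatou's lemma first shows that the transform is square integrable, and dominated
  convergence then identifies the limit.
\<close>

lemma fint_isometric_bdd_cont:
  assumes f: "integrable lborel f" and bc: "bdd_cont f"
  shows "fint f \<in> L2" "norm2 (fint f) = norm2 f"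
proof -
  obtain M where cont: "continuous_on UNIV f" and [measurable]: "f \<in> borel_measurable borel"
    and M: "0 \<le> M" "\<And>x. norm (f x) \<le> M" using bdd_contE[OF bc] by metis
  have L2: "f \<in> L2" by (rule bounded_integrable_L2[OF f M(2)])
  define c where "c n = 2 * pi * real (Suc n)" for n
  have c: "c n > 0" for n by (simp add: c_def)
  have c0: "(\<lambda>n. 1 / c n) \<longlonglongrightarrow> 0"
    unfolding c_def by real_asymp
  have c1: "(\<lambda>n. 2 * pi / c n) \<longlonglongrightarrow> 0"
    unfolding c_def by real_asymp
  define W where "W n \<xi> = 2 * pi * gauss ((2 * pi / c n) *\<^sub>R \<xi>)" for n \<xi>
  have [measurable]: "W n \<in> borel_measurable borel" for n unfolding W_def by measurable
  have W01: "0 \<le> W n \<xi>" "W n \<xi> \<le> 1" for n \<xi>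
    by (simp_all add: W_def gauss_eq)
  have W1: "(\<lambda>n. W n \<xi>) \<longlonglongrightarrow> 1" for \<xi>
  proof -
    have "(\<lambda>n. exp (- (norm ((2 * pi / c n) *\<^sub>R \<xi>))\<^sup>2 / 2)) \<longlonglongrightarrow> exp (- (norm (0 *\<^sub>R \<xi>))\<^sup>2 / 2)"
      by (intro tendsto_intros c1) simp
    then show ?thesis by (simp add: W_def gauss_eq)
  qed
  have int1: "integrable lborel (\<lambda>\<xi>. (norm (fint f \<xi>))\<^sup>2 * W n \<xi>)" for n
  proof (rule integrable_domI)
    show "integrable lborel (\<lambda>\<xi>. (LINT x|lborel. norm (f x))\<^sup>2 * W n \<xi>)"
      unfolding W_def using integrable_gauss_scaled[of "2 * pi / c n"] c[of n] by simp
    show "AE \<xi> in lborel. norm ((norm (fint f \<xi>))\<^sup>2 * W n \<xi>) \<le> norm ((LINT x|lborel. norm (f x))\<^sup>2 * W n \<xi>)"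
      by (auto simp: abs_mult intro!: mult_right_mono power_mono norm_fint_le)
  qed measurable
  define I where "I n = (LINT \<xi>|lborel. (norm (fint f \<xi>))\<^sup>2 * W n \<xi>)" for n
  define A where "A n x = (LINT z|lborel. cnj (f (x - (1 / c n) *\<^sub>R z)) * of_real (gauss z))" for n x
  have I: "of_real (I n) = (LINT x|lborel. f x * A n x)" for n
  proof -
    have "complex_of_real (I n) = (LINT \<xi>|lborel. of_real ((norm (fint f \<xi>))\<^sup>2 * W n \<xi>))"
      unfolding I_def by (rule integral_complex_of_real[symmetric])
    also have "\<dots> = (LINT \<xi>|lborel. fint f \<xi> * (cnj (fint f \<xi>) * of_real (2 * pi * gauss ((2 * pi / c n) *\<^sub>R \<xi>))))"
      by (simp only: W_def of_real_mult complex_norm_square mult.assoc)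
    also have "\<dots> = (LINT x|lborel. f x * A n x)"
      unfolding A_def by (rule fint_gauss_regularized[OF f c])
    finally show ?thesis .
  qed
  have Ameas[measurable]: "A n \<in> borel_measurable borel" for n
    unfolding A_def by measurable
  have A_le: "norm (A n x) \<le> M" for n x
  proof -
    have "norm (A n x) \<le> (LINT z|lborel. norm (cnj (f (x - (1 / c n) *\<^sub>R z)) * complex_of_real (gauss z)))"
      unfolding A_def by (rule integral_norm_bound)
    also have "\<dots> \<le> (LINT z|lborel. M * gauss z)"
      by (rule integral_mono') (auto simp: norm_mult intro!: mult_right_mono mult_nonneg_nonneg M)
    finally have "norm (A n x) \<le> (LINT z|lborel. M * gauss z)" .
    then show ?thesis by simp
  qed
  have A_lim: "(\<lambda>n. A n x) \<longlonglongrightarrow> cnj (f x)" for x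
  proof -
    have "(\<lambda>n. A n x) \<longlonglongrightarrow> (LINT z|lborel. cnj (f x) * of_real (gauss z))"
      unfolding A_def
    proof (rule integral_dominated_convergence[where w="\<lambda>z. M * gauss z"])
      show "AE z in lborel. (\<lambda>n. cnj (f (x - (1 / c n) *\<^sub>R z)) * of_real (gauss z))
          \<longlonglongrightarrow> cnj (f x) * of_real (gauss z)"
      proof (rule AE_I2)
        fix z
        have "(\<lambda>n. x - (1 / c n) *\<^sub>R z) \<longlonglongrightarrow> x - 0 *\<^sub>R z" by (intro tendsto_intros c0)
        then have "(\<lambda>n. f (x - (1 / c n) *\<^sub>R z)) \<longlonglongrightarrow> f x"
          using continuous_on_tendsto_compose[OF cont, of _ x] by simp
        then show "(\<lambda>n. cnj (f (x - (1 / c n) *\<^sub>R z)) * of_real (gauss z))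
          \<longlonglongrightarrow> cnj (f x) * of_real (gauss z)" by (intro tendsto_intros)
      qed
      show "AE z in lborel. norm (cnj (f (x - (1 / c n) *\<^sub>R z)) * complex_of_real (gauss z)) \<le> M * gauss z" for n
        by (auto simp: norm_mult intro!: mult_right_mono M)
    qed auto
    then show ?thesis by simp
  qed
  have "(\<lambda>n. complex_of_real (I n)) \<longlonglongrightarrow> (LINT x|lborel. f x * cnj (f x))"
    unfolding I
  proof (rule integral_dominated_convergence[where w="\<lambda>x. M * norm (f x)"])
    show "AE x in lborel. (\<lambda>n. f x * A n x) \<longlonglongrightarrow> f x * cnj (f x)"
      by (intro AE_I2 tendsto_intros A_lim)
    show "AE x in lborel. norm (f x * A n x) \<le> M * norm (f x)" for n
      using mult_left_mono[OF A_le[of n] norm_ge_zero[of "f _"]] by (intro AE_I2) (simp add: norm_mult mult.commute)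
  qed (use f in auto)
  also have "(LINT x|lborel. f x * cnj (f x)) = complex_of_real ((norm2 f)\<^sup>2)"
    unfolding norm2_squared by (simp flip: complex_norm_square of_real_power)
  finally have I_lim: "I \<longlonglongrightarrow> (norm2 f)\<^sup>2" by (subst (asm) tendsto_of_real_iff)
  have "(\<integral>\<^sup>+\<xi>. ennreal ((norm (fint f \<xi>))\<^sup>2) \<partial>lborel)
      = (\<integral>\<^sup>+\<xi>. liminf (\<lambda>n. ennreal ((norm (fint f \<xi>))\<^sup>2 * W n \<xi>)) \<partial>lborel)"
  proof (rule nn_integral_cong)
    fix \<xi>
    have "(\<lambda>n. ennreal ((norm (fint f \<xi>))\<^sup>2 * W n \<xi>)) \<longlonglongrightarrow> ennreal ((norm (fint f \<xi>))\<^sup>2 * 1)"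
      by (intro tendsto_intros W1)
    then show "ennreal ((norm (fint f \<xi>))\<^sup>2) = liminf (\<lambda>n. ennreal ((norm (fint f \<xi>))\<^sup>2 * W n \<xi>))"
      by (metis lim_imp_Liminf mult.right_neutral sequentially_bot)
  qed
  also have "\<dots> \<le> liminf (\<lambda>n. \<integral>\<^sup>+\<xi>. ennreal ((norm (fint f \<xi>))\<^sup>2 * W n \<xi>) \<partial>lborel)"
    by (rule nn_integral_liminf) simp
  also have "\<dots> = liminf (\<lambda>n. ennreal (I n))"
    unfolding I_def using int1 W01 by (subst nn_integral_eq_integral) auto
  also have "\<dots> = ennreal ((norm2 f)\<^sup>2)"
    by (intro lim_imp_Liminf tendsto_intros I_lim) simp
  finally show L2F: "fint f \<in> L2" using L2_I_bound(1)[of "fint f" "norm2 f"] by simp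
  have "I \<longlonglongrightarrow> (LINT \<xi>|lborel. (norm (fint f \<xi>))\<^sup>2)"
    unfolding I_def
  proof (rule integral_dominated_convergence[where w="\<lambda>\<xi>. (norm (fint f \<xi>))\<^sup>2"])
    show "AE \<xi> in lborel. (\<lambda>n. (norm (fint f \<xi>))\<^sup>2 * W n \<xi>) \<longlonglongrightarrow> (norm (fint f \<xi>))\<^sup>2"
      using tendsto_mult[OF tendsto_const W1] by (intro AE_I2) (metis mult.right_neutral)
    show "AE \<xi> in lborel. norm ((norm (fint f \<xi>))\<^sup>2 * W n \<xi>) \<le> (norm (fint f \<xi>))\<^sup>2" for n
      using W01[of n] by (intro AE_I2) (simp add: abs_mult mult_left_le)
  qed (use L2_integrable[OF L2F] in auto)
  then have "(norm2 (fint f))\<^sup>2 = (norm2 f)\<^sup>2"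
    using I_lim LIMSEQ_unique by (metis norm2_squared)
  then show "norm2 (fint f) = norm2 f" by simp
qed

lemma dominated_approx:
  fixes g :: "nat \<Rightarrow> plane \<Rightarrow> complex"
  assumes [measurable]: "\<And>n. g n \<in> borel_measurable borel" "f \<in> borel_measurable borel"
    and lim: "AE x in lborel. (\<lambda>n. g n x) \<longlonglongrightarrow> f x"
    and w: "integrable lborel w" "integrable lborel (\<lambda>x. (w x)\<^sup>2)"
    and le: "\<And>n x. norm (g n x - f x) \<le> w x" and "e > 0"
  shows "\<exists>n. (LINT x|lborel. norm (g n x - f x)) < e \<and> norm2 (\<lambda>x. g n x - f x) < e"
proof -
  have [measurable]: "w \<in> borel_measurable borel" using w(1) by (auto dest: borel_measurable_integrable)
  have 2: "L2_lim g f"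
    by (rule norm2_dominated_convergence[OF _ _ lim w(2)]) (use le in auto)
  have "(\<lambda>n. LINT x|lborel. norm (g n x - f x)) \<longlonglongrightarrow> (LINT x|(lborel::plane measure). (0::real))"
  proof (rule integral_dominated_convergence[where w=w])
    show "AE x in lborel. (\<lambda>n. norm (g n x - f x)) \<longlonglongrightarrow> 0"
      using lim by eventually_elim (auto intro!: tendsto_norm_zero simp: LIM_zero)
  qed (use w le in auto)
  then have 1: "(\<lambda>n. LINT x|lborel. norm (g n x - f x)) \<longlonglongrightarrow> 0" by simp
  have "eventually (\<lambda>n. (LINT x|lborel. norm (g n x - f x)) < e \<and> norm2 (\<lambda>x. g n x - f x) < e) sequentially"
    using order_tendstoD(2)[OF 1 \<open>e > 0\<close>] order_tendstoD(2)[OF 2 \<open>e > 0\<close>] by eventually_elim simp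
  then show ?thesis by (auto dest: eventually_happens)
qed

lemma L1_L2_approx_bounded:
  fixes f :: "plane \<Rightarrow> complex"
  assumes f: "integrable lborel f" "f \<in> L2" and "e > 0"
  shows "\<exists>g R. g \<in> borel_measurable borel \<and> 0 \<le> R \<and> (\<forall>x. norm (g x) \<le> R) \<and>
    (\<forall>x. norm x > R \<longrightarrow> g x = 0) \<and>
    integrable lborel g \<and> g \<in> L2 \<and> (LINT x|lborel. norm (g x - f x)) < e \<and> norm2 (\<lambda>x. g x - f x) < e"
proof -
  note [measurable] = L2_measurable[OF f(2)]
  define g where "g n x = (if norm (f x) \<le> real n \<and> norm x \<le> real n then f x else 0)" for n x
  have [measurable]: "g n \<in> borel_measurable borel" for n unfolding g_def by measurable
  have le: "norm (g n x) \<le> norm (f x)" "norm (g n x - f x) \<le> norm (f x)" for n x by (auto simp: g_def)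
  have g: "integrable lborel (g n)" "g n \<in> L2" for n
    by (rule integrable_domI[OF f(1)]; simp add: le(1))
       (rule L2_dominated(1)[OF _ f(2), of _ 1]; simp add: le(1))
  have lim: "(\<lambda>n. g n x) \<longlonglongrightarrow> f x" for x
  proof (rule tendsto_eventually)
    show "eventually (\<lambda>n. g n x = f x) sequentially"
      using eventually_ge_at_top[of "nat \<lceil>norm (f x) + norm x\<rceil>"]
    proof eventually_elim
      case (elim n)
      then have "norm (f x) + norm x \<le> real n" by linarith
      then have "norm (f x) \<le> real n" "norm x \<le> real n"
        using norm_ge_zero[of x] norm_ge_zero[of "f x"] by linarith+
      then show ?case by (simp add: g_def)
    qed
  qed
  obtain n where n: "(LINT x|lborel. norm (g n x - f x)) < e" "norm2 (\<lambda>x. g n x - f x) < e"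
    using dominated_approx[of g f "\<lambda>x. norm (f x)" e] f L2_integrable[OF f(2)] lim le(2) \<open>e > 0\<close> by auto
  have "norm (g n x) \<le> real n" "norm x > real n \<Longrightarrow> g n x = 0" for x by (auto simp: g_def)
  then show ?thesis using g n by (intro exI[of _ "g n"] exI[of _ "real n"]) auto
qed

text \<open>
  A measurable function is an almost everywhere limit of continuous functions. Clipping their values
  to the disc of radius \<open>R\<close> and cutting them off outside a ball makes this convergence dominated,
  without changing the limit.
\<close>

lemma bounded_approx_bdd_cont:
  fixes f :: "plane \<Rightarrow> complex"
  assumes [measurable]: "f \<in> borel_measurable borel" and R: "0 \<le> R" "\<And>x. norm (f x) \<le> R"
    "\<And>x. norm x > R \<Longrightarrow> f x = 0" and "e > 0"
  shows "\<exists>g. bdd_cont g \<and> integrable lborel g \<and> (LINT x|lborel. norm (g x - f x)) < e \<and>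
    norm2 (\<lambda>x. g x - f x) < e"
proof -
  have "f measurable_on UNIV"
    by (rule lebesgue_measurable_imp_measurable_on) (auto intro: measurable_completion)
  then obtain N h where N: "negligible N" and h: "\<And>n. continuous_on UNIV (h n)"
    and hlim: "\<And>x. x \<notin> N \<Longrightarrow> (\<lambda>n. h n x) \<longlonglongrightarrow> f x"
    by (auto simp: measurable_on_def)
  have AE_N: "AE x in lborel. x \<notin> N"
    using AE_not_in[of N lebesgue] N by (simp add: negligible_iff_null_sets AE_completion_iff)
  define clip where "clip = closest_point (cball (0::complex) R)"
  have clip_cont: "continuous_on UNIV clip"
    unfolding clip_def using R by (intro continuous_on_closest_point) auto
  have clip_le: "norm (clip z) \<le> R" for z
    using closest_point_in_set[of "cball (0::complex) R" z] R by (auto simp: clip_def)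
  have clip_id: "norm z \<le> R \<Longrightarrow> clip z = z" for z
    using closest_point_self[of z "cball (0::complex) R"] by (auto simp: clip_def)
  define \<phi> where "\<phi> x = max 0 (min 1 (R + 1 - norm x))" for x :: plane
  have \<phi>: "continuous_on UNIV \<phi>" "0 \<le> \<phi> x" "\<phi> x \<le> 1" "norm x \<le> R \<Longrightarrow> \<phi> x = 1" "norm x > R + 1 \<Longrightarrow> \<phi> x = 0" for x
    unfolding \<phi>_def by (auto intro!: continuous_intros)
  define g where "g n x = of_real (\<phi> x) * clip (h n x)" for n x
  define w where "w x = 2 * R * indicator (cball (0::plane) (R + 1)) x" for x
  have cont: "continuous_on UNIV (g n)" for n
    unfolding g_def
    by (intro continuous_intros \<phi>(1) continuous_on_compose2[OF clip_cont h]) auto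
  then have [measurable]: "g n \<in> borel_measurable borel" for n by (rule borel_measurable_continuous_onI)
  have g_le: "norm (g n x) \<le> R * indicator (cball 0 (R + 1)) x" for n x
  proof (cases "norm x > R + 1")
    case False
    have "\<phi> x * norm (clip (h n x)) \<le> 1 * R" using \<phi>(2-5)[of x] clip_le R by (intro mult_mono) auto
    then show ?thesis using False \<phi>(2-5)[of x] by (simp add: g_def norm_mult)
  qed (simp add: g_def \<phi>(5))
  have f_le: "norm (f x) \<le> R * indicator (cball 0 (R + 1)) x" for x
    using R(2)[of x] R(3)[of x] by (cases "norm x > R") (auto simp: indicator_def)
  have le: "norm (g n x - f x) \<le> w x" for n x
    using norm_triangle_ineq4[of "g n x" "f x"] g_le[of n x] f_le[of x] by (simp add: w_def)
  have intind: "integrable lborel (indicator (cball (0::plane) (R + 1)) :: plane \<Rightarrow> real)"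
    using emeasure_lborel_cball_finite by (intro integrable_real_indicator) auto
  have w: "integrable lborel w" "integrable lborel (\<lambda>x. (w x)\<^sup>2)"
    using intind by (auto simp: w_def[abs_def] power_mult_distrib power2_eq_square[of "indicator _ _"]
      simp flip: indicator_inter_arith)
  have g: "integrable lborel (g n)" for n
    by (rule integrable_domI[OF integrable_mult_right[OF intind, of R]])
      (use g_le[of n] R in \<open>auto simp: abs_mult\<close>)
  have bc: "bdd_cont (g n)" for n
  proof -
    have "norm (g n x) \<le> R" for x
      using g_le[of n x] R(1) by (cases "x \<in> cball 0 (R + 1)") simp_all
    then show ?thesis using cont[of n] by (auto simp: bdd_cont_def bounded_iff)
  qed
  have lim: "AE x in lborel. (\<lambda>n. g n x) \<longlonglongrightarrow> f x"
    using AE_N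
  proof eventually_elim
    case (elim x)
    have "(\<lambda>n. clip (h n x)) \<longlonglongrightarrow> clip (f x)"
      using continuous_on_tendsto_compose[OF clip_cont hlim[OF elim]] by simp
    then have "(\<lambda>n. g n x) \<longlonglongrightarrow> of_real (\<phi> x) * clip (f x)"
      unfolding g_def by (intro tendsto_intros)
    also have "of_real (\<phi> x) * clip (f x) = f x"
      using R(2,3)[of x] clip_id[of "f x"] \<phi>(4)[of x] by (cases "norm x \<le> R") auto
    finally show ?case .
  qed
  obtain n where "(LINT x|lborel. norm (g n x - f x)) < e" "norm2 (\<lambda>x. g n x - f x) < e"
    using dominated_approx[OF _ _ lim w le \<open>e > 0\<close>] by auto
  then show ?thesis using bc g by blast
qed

lemma L1_L2_approx_bdd_cont:
  fixes f :: "plane \<Rightarrow> complex"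
  assumes f: "integrable lborel f" "f \<in> L2" and "e > 0"
  shows "\<exists>g. bdd_cont g \<and> integrable lborel g \<and> g \<in> L2 \<and> (LINT x|lborel. norm (g x - f x)) < e \<and>
    norm2 (\<lambda>x. g x - f x) < e"
proof -
  obtain h R where h: "h \<in> borel_measurable borel" "0 \<le> R" "\<And>x. norm (h x) \<le> R"
    "\<And>x. norm x > R \<Longrightarrow> h x = 0" "integrable lborel h" "h \<in> L2"
    "(LINT x|lborel. norm (h x - f x)) < e / 2" "norm2 (\<lambda>x. h x - f x) < e / 2"
    using L1_L2_approx_bounded[OF f, of "e / 2"] \<open>e > 0\<close> by auto
  obtain g where g: "bdd_cont g" "integrable lborel g" "(LINT x|lborel. norm (g x - h x)) < e / 2"
    "norm2 (\<lambda>x. g x - h x) < e / 2"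
    using bounded_approx_bdd_cont[OF h(1-4), of "e / 2"] \<open>e > 0\<close> by auto
  have gL2: "g \<in> L2" using g(1,2) bdd_contE bounded_integrable_L2 by metis
  have "(LINT x|lborel. norm (g x - f x)) \<le> (LINT x|lborel. norm (g x - h x) + norm (h x - f x))"
  proof (rule integral_mono')
    show "norm (g x - f x) \<le> norm (g x - h x) + norm (h x - f x)" for x
      using norm_triangle_ineq[of "g x - h x" "h x - f x"] by simp
  qed (use g h f in auto)
  also have "\<dots> = (LINT x|lborel. norm (g x - h x)) + (LINT x|lborel. norm (h x - f x))"
    using g h f by simp
  finally have "(LINT x|lborel. norm (g x - f x)) < e" using g h by simp
  moreover have "norm2 (\<lambda>x. g x - f x) < e"
    using norm2_triangle_diff[OF gL2 h(6) f(2)] g h by simp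
  ultimately show ?thesis using g gL2 by blast
qed

text \<open>
  Approximate \<open>f\<close> by bounded continuous functions in both norms. Convergence in the first makes the
  transforms converge pointwise, and convergence in the second makes them Cauchy in the square norm
  by the isometry already proved, so Fatou's lemma identifies the pointwise limit as their limit.
\<close>

theorem fint_isometric:
  assumes f: "integrable lborel f" "f \<in> L2"
  shows "fint f \<in> L2" "norm2 (fint f) = norm2 f"
proof -
  note [measurable] = L2_measurable[OF f(2)]
  have "\<forall>n. \<exists>g. bdd_cont g \<and> integrable lborel g \<and> g \<in> L2 \<and> (LINT x|lborel. norm (g x - f x)) < 1 / real (Suc n) \<and>
    norm2 (\<lambda>x. g x - f x) < 1 / real (Suc n)"
    by (intro allI L1_L2_approx_bdd_cont[OF f]) simp
  from choice[OF this] obtain g where g: "\<And>n. bdd_cont (g n)" "\<And>n. integrable lborel (g n)" "\<And>n. g n \<in> L2"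
    "\<And>n. (LINT x|lborel. norm (g n x - f x)) < 1 / real (Suc n)"
    "\<And>n. norm2 (\<lambda>x. g n x - f x) < 1 / real (Suc n)" by blast
  note fg = fint_isometric_bdd_cont[OF g(2,1)]
  have inv0: "(\<lambda>n. 1 / real (Suc n)) \<longlonglongrightarrow> 0" by real_asymp
  have lim2: "L2_lim g f"
    by (rule tendsto_sandwich[OF _ _ tendsto_const inv0]; intro always_eventually allI) (simp, rule less_imp_le[OF g(5)])
  have lim1: "(\<lambda>n. LINT x|lborel. norm (g n x - f x)) \<longlonglongrightarrow> 0"
    by (rule tendsto_sandwich[OF _ _ tendsto_const inv0]; intro always_eventually allI) (simp, rule less_imp_le[OF g(4)])
  have pointwise: "(\<lambda>n. fint (g n) \<xi>) \<longlonglongrightarrow> fint f \<xi>" for \<xi>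
  proof (rule LIM_zero_cancel, rule Lim_null_comparison[OF _ lim1], rule always_eventually, rule allI)
    show "norm (fint (g n) \<xi> - fint f \<xi>) \<le> (LINT x|lborel. norm (g n x - f x))" for n
      using norm_fint_le[of "\<lambda>x. g n x - f x" \<xi>] by (simp add: fint_diff g(2) f(1))
  qed
  have diff: "norm2 (\<lambda>\<xi>. fint (g m) \<xi> - fint (g n) \<xi>) = norm2 (\<lambda>x. g m x - g n x)" for m n
  proof -
    have "bdd_cont (\<lambda>x. g m x - g n x)"
      using g(1)[of m] g(1)[of n]
      by (auto simp: bdd_cont_def intro!: continuous_intros bounded_minus_comp)
    then show ?thesis
      using fint_isometric_bdd_cont(2)[of "\<lambda>x. g m x - g n x"] g(2)
      by (simp add: fint_diff[OF g(2) g(2), abs_def])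
  qed
  have close: "(\<lambda>\<xi>. fint (g m) \<xi> - fint f \<xi>) \<in> L2 \<and>
      norm2 (\<lambda>\<xi>. fint (g m) \<xi> - fint f \<xi>) \<le> 2 / real (Suc m)" for m
  proof -
    have "eventually (\<lambda>n. norm2 (\<lambda>\<xi>. fint (g m) \<xi> - fint (g n) \<xi>) \<le> 2 / real (Suc m)) sequentially"
      using eventually_ge_at_top[of m]
    proof eventually_elim
      case (elim n)
      have "norm2 (\<lambda>x. g m x - g n x) \<le> norm2 (\<lambda>x. g m x - f x) + norm2 (\<lambda>x. f x - g n x)"
        by (rule norm2_triangle_diff[OF g(3) f(2) g(3)])
      also have "\<dots> \<le> 1 / real (Suc m) + 1 / real (Suc n)"
        using g(5)[of m] g(5)[of n] by (simp add: norm2_diff_commute[of f])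
      also have "1 / real (Suc n) \<le> 1 / real (Suc m)" using elim by (simp add: frac_le)
      finally show ?case by (simp add: diff)
    qed
    moreover have "AE \<xi> in lborel. (\<lambda>n. fint (g m) \<xi> - fint (g n) \<xi>) \<longlonglongrightarrow> fint (g m) \<xi> - fint f \<xi>"
      by (intro AE_I2 tendsto_intros pointwise)
    ultimately show ?thesis
      using norm2_Fatou[of "\<lambda>n \<xi>. fint (g m) \<xi> - fint (g n) \<xi>" "\<lambda>\<xi>. fint (g m) \<xi> - fint f \<xi>" "2 / real (Suc m)"]
        L2_diff(1)[OF fg(1) fg(1)] L2_measurable[OF fg(1)]
      by simp
  qed
  show L2: "fint f \<in> L2"
    using L2_diff(1)[OF fg(1)[of 0] conjunct1[OF close[of 0]]] by simp
  have "(\<lambda>m. 2 / real (Suc m)) \<longlonglongrightarrow> 0" by real_asymp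
  then have "(\<lambda>n. norm2 (\<lambda>\<xi>. fint (g n) \<xi> - fint f \<xi>)) \<longlonglongrightarrow> 0"
    by (rule Lim_null_comparison[rotated]) (use close in auto)
  then have "(\<lambda>n. norm2 (g n)) \<longlonglongrightarrow> norm2 (fint f)"
    using norm2_tendsto[OF fg(1) L2] by (simp add: fg(2))
  then show "norm2 (fint f) = norm2 f"
    using norm2_tendsto[OF g(3) f(2) lim2] LIMSEQ_unique by blast
qed

section \<open>The Fourier transform on square integrable functions\<close>

lemma L2_limit_unique:
  fixes f :: "nat \<Rightarrow> plane \<Rightarrow> 'b::{banach,second_countable_topology}"
  assumes f: "\<And>n. f n \<in> L2" and g: "g \<in> L2" "L2_lim f g"
    and h: "h \<in> L2" "L2_lim f h"
  shows "AE x in lborel. g x = h x"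
proof -
  have "norm2 (\<lambda>x. g x - h x) \<le> norm2 (\<lambda>x. f n x - g x) + norm2 (\<lambda>x. f n x - h x)" for n
    using norm2_triangle_diff[OF g(1) f h(1), of n] norm2_diff_commute[of g "f n"] by simp
  moreover have "(\<lambda>n. norm2 (\<lambda>x. f n x - g x) + norm2 (\<lambda>x. f n x - h x)) \<longlonglongrightarrow> 0"
    using tendsto_add[OF g(2) h(2)] by simp
  ultimately have "norm2 (\<lambda>x. g x - h x) \<le> 0" by (intro LIMSEQ_le_const) auto
  then have "norm2 (\<lambda>x. g x - h x) = 0" using norm2_nonneg by (rule antisym)
  then show ?thesis using norm2_eq_0_iff[OF L2_diff(1)[OF g(1) h(1)]] by simp
qed

lemma integrable_mult_L2:
  fixes f g :: "plane \<Rightarrow> 'b::{banach,second_countable_topology,real_normed_field}"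
  assumes f: "f \<in> L2" and g: "g \<in> L2"
  shows "integrable lborel (\<lambda>x. f x * g x)" "norm (LINT x|lborel. f x * g x) \<le> norm2 f * norm2 g"
proof -
  note [measurable] = L2_measurable[OF f] L2_measurable[OF g]
  show "integrable lborel (\<lambda>x. f x * g x)"
    by (rule integrable_domI[OF integrable_norm_mult_L2(1)[OF f g]])
      (auto simp: norm_mult)
  have "norm (LINT x|lborel. f x * g x) \<le> (LINT x|lborel. norm (f x * g x))"
    by (rule integral_norm_bound)
  then show "norm (LINT x|lborel. f x * g x) \<le> norm2 f * norm2 g"
    using integrable_norm_mult_L2(2)[OF f g] by (simp add: norm_mult)
qed

lemma integral_mult_L2_tendsto:
  fixes f g :: "plane \<Rightarrow> 'b::{banach,second_countable_topology,real_normed_field}"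
  assumes fn: "\<And>n. fn n \<in> L2" and f: "f \<in> L2" "L2_lim fn f"
    and gn: "\<And>n. gn n \<in> L2" and g: "g \<in> L2" "L2_lim gn g"
  shows "(\<lambda>n. LINT x|lborel. fn n x * gn n x) \<longlonglongrightarrow> (LINT x|lborel. f x * g x)"
proof (rule LIM_zero_cancel, rule Lim_null_comparison, rule always_eventually, rule allI)
  fix n
  have "(LINT x|lborel. fn n x * gn n x) - (LINT x|lborel. f x * g x)
      = (LINT x|lborel. (fn n x - f x) * gn n x) + (LINT x|lborel. f x * (gn n x - g x))"
    using integrable_mult_L2(1)[OF fn gn, of n n] integrable_mult_L2(1)[OF f(1) g(1)]
      integrable_mult_L2(1)[OF f(1) gn, of n]
    by (simp add: left_diff_distrib right_diff_distrib)
  also have "norm \<dots> \<le> norm2 (\<lambda>x. fn n x - f x) * norm2 (gn n) + norm2 f * norm2 (\<lambda>x. gn n x - g x)"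
    by (intro norm_triangle_le add_mono integrable_mult_L2 L2_diff fn gn f g)
  finally show "norm ((LINT x|lborel. fn n x * gn n x) - (LINT x|lborel. f x * g x))
    \<le> norm2 (\<lambda>x. fn n x - f x) * norm2 (gn n) + norm2 f * norm2 (\<lambda>x. gn n x - g x)" .
next
  have "(\<lambda>n. norm2 (\<lambda>x. fn n x - f x) * norm2 (gn n) + norm2 f * norm2 (\<lambda>x. gn n x - g x))
      \<longlonglongrightarrow> 0 * norm2 g + norm2 f * 0"
    by (intro tendsto_intros f g norm2_tendsto gn)
  then show "(\<lambda>n. norm2 (\<lambda>x. fn n x - f x) * norm2 (gn n) + norm2 f * norm2 (\<lambda>x. gn n x - g x)) \<longlonglongrightarrow> 0"
    by simp
qed

definition trunc :: "nat \<Rightarrow> (plane \<Rightarrow> complex) \<Rightarrow> plane \<Rightarrow> complex" where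
  "trunc n f x = of_real (indicator (ball 0 (real n)) x) * f x"

lemma measurable_trunc [measurable]:
  assumes [measurable]: "f \<in> borel_measurable borel"
  shows "trunc n f \<in> borel_measurable borel"
proof -
  have [measurable]: "(indicator (ball 0 (real n)) :: plane \<Rightarrow> real) \<in> borel_measurable borel"
    by (rule borel_measurable_indicator) simp
  show ?thesis unfolding trunc_def[abs_def] by simp
qed

lemma trunc_L2:
  assumes f: "f \<in> L2"
  shows "trunc n f \<in> L2" "integrable lborel (trunc n f)"
proof -
  note [measurable] = L2_measurable[OF f]
  show "trunc n f \<in> L2"
    by (rule L2_dominated(1)[OF _ f, of _ 1]) (auto simp: trunc_def norm_mult indicator_def)
  have "integrable lborel (indicator (ball (0::plane) (real n)) :: plane \<Rightarrow> real)"
    using emeasure_lborel_ball_finite by (intro integrable_real_indicator) auto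
  then have ind: "(indicator (ball (0::plane) (real n)) :: plane \<Rightarrow> real) \<in> L2"
    by (rule bounded_integrable_L2[where M=1]) (auto simp: indicator_def)
  show "integrable lborel (trunc n f)"
    by (rule integrable_domI[OF integrable_norm_mult_L2(1)[OF ind f]])
      (auto simp: trunc_def norm_mult)
qed

lemma trunc_pointwise: "eventually (\<lambda>n. trunc n f x = f x) sequentially"
  using eventually_gt_at_top[of "nat \<lceil>norm x\<rceil>"]
proof eventually_elim
  case (elim n)
  then have "norm x < real n" by linarith
  then show ?case by (simp add: trunc_def)
qed

lemma norm_trunc_le: "norm (trunc n f x) \<le> norm (f x)" "norm (trunc n f x - f x) \<le> norm (f x)"
  by (auto simp: trunc_def indicator_def)

lemma trunc_tendsto:
  assumes f: "f \<in> L2"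
  shows "L2_lim (\<lambda>n. trunc n f) f"
proof -
  note [measurable] = L2_measurable[OF f] L2_measurable[OF trunc_L2(1)[OF f]]
  show ?thesis
    by (rule norm2_dominated_convergence[where w="\<lambda>x. norm (f x)"])
      (use L2_integrable[OF f] in \<open>auto intro!: tendsto_eventually trunc_pointwise norm_trunc_le\<close>)
qed

lemma fint_trunc_L2:
  assumes "f \<in> L2" shows "fint (trunc n f) \<in> L2" "norm2 (fint (trunc n f)) = norm2 (trunc n f)"
  using fint_isometric[OF trunc_L2(2,1)[OF assms]] by auto

text \<open>
  The analogue of \<open>has_fourier\<close> for complex functions. It is a relation rather than a function,
  because a transform is determined only almost everywhere.
\<close>

definition has_ft :: "(plane \<Rightarrow> complex) \<Rightarrow> (plane \<Rightarrow> complex) \<Rightarrow> bool" where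
  "has_ft f g \<longleftrightarrow> f \<in> L2 \<and> g \<in> L2 \<and> L2_lim (\<lambda>n. fint (trunc n f)) g"

lemma has_ftD:
  assumes "has_ft f g"
  shows "f \<in> L2" "g \<in> L2" "L2_lim (\<lambda>n. fint (trunc n f)) g"
  using assms by (auto simp: has_ft_def)

theorem has_ft_exists:
  assumes f: "f \<in> L2" shows "\<exists>g. has_ft f g"
proof -
  have "\<exists>g\<in>L2. L2_lim (\<lambda>n. fint (trunc n f)) g"
  proof (rule L2_complete[OF fint_trunc_L2(1)[OF f]])
    fix e :: real assume "e > 0"
    then obtain N where N: "\<And>n. n \<ge> N \<Longrightarrow> norm2 (\<lambda>x. trunc n f x - f x) < e / 2"
      using LIMSEQ_D[OF trunc_tendsto[OF f], of "e / 2"] by auto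
    have "norm2 (\<lambda>x. fint (trunc m f) x - fint (trunc n f) x) < e" if "m \<ge> N" "n \<ge> N" for m n
    proof -
      have "fint (\<lambda>x. trunc m f x - trunc n f x) = (\<lambda>x. fint (trunc m f) x - fint (trunc n f) x)"
        by (intro ext fint_diff trunc_L2 f)
      then have "norm2 (\<lambda>x. fint (trunc m f) x - fint (trunc n f) x) = norm2 (\<lambda>x. trunc m f x - trunc n f x)"
        using fint_isometric(2)[of "\<lambda>x. trunc m f x - trunc n f x"] trunc_L2[OF f]
        by (simp add: L2_diff)
      also have "\<dots> \<le> norm2 (\<lambda>x. trunc m f x - f x) + norm2 (\<lambda>x. f x - trunc n f x)"
        by (intro norm2_triangle_diff trunc_L2 f)
      finally show ?thesis using N[OF that(1)] N[OF that(2)] norm2_diff_commute[of f "trunc n f"] by simp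
    qed
    then show "\<exists>N. \<forall>m\<ge>N. \<forall>n\<ge>N. norm2 (\<lambda>x. fint (trunc m f) x - fint (trunc n f) x) < e" by blast
  qed
  then show ?thesis using f by (auto simp: has_ft_def)
qed

lemma has_ft_unique:
  assumes "has_ft f g" "has_ft f h" shows "AE x in lborel. g x = h x"
  using L2_limit_unique[OF fint_trunc_L2(1)] assms by (auto simp: has_ft_def)

lemma has_ft_isometric:
  assumes "has_ft f g" shows "norm2 g = norm2 f"
proof (rule LIMSEQ_unique)
  note f = has_ftD[OF assms]
  show "(\<lambda>n. norm2 (fint (trunc n f))) \<longlonglongrightarrow> norm2 g"
    by (rule norm2_tendsto[OF fint_trunc_L2(1)[OF f(1)] f(2,3)])
  show "(\<lambda>n. norm2 (fint (trunc n f))) \<longlonglongrightarrow> norm2 f"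
    unfolding fint_trunc_L2(2)[OF f(1)]
    by (rule norm2_tendsto[OF trunc_L2(1)[OF f(1)] f(1) trunc_tendsto[OF f(1)]])
qed

lemma has_ft_add:
  assumes f: "has_ft f f'" and g: "has_ft g g'"
  shows "has_ft (\<lambda>x. f x + g x) (\<lambda>\<xi>. f' \<xi> + g' \<xi>)"
proof -
  note f = has_ftD[OF f] and g = has_ftD[OF g]
  have eq: "fint (trunc n (\<lambda>x. f x + g x)) \<xi> = fint (trunc n f) \<xi> + fint (trunc n g) \<xi>" for n \<xi>
    using fint_add[OF trunc_L2(2)[OF f(1)] trunc_L2(2)[OF g(1)], of n n \<xi>]
    by (simp add: trunc_def[abs_def] distrib_left)
  have "(\<lambda>n. norm2 (\<lambda>\<xi>. fint (trunc n (\<lambda>x. f x + g x)) \<xi> - (f' \<xi> + g' \<xi>))) \<longlonglongrightarrow> 0"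
  proof (rule Lim_null_comparison[OF always_eventually])
    have "norm2 (\<lambda>\<xi>. (fint (trunc n f) \<xi> - f' \<xi>) + (fint (trunc n g) \<xi> - g' \<xi>))
        \<le> norm2 (\<lambda>\<xi>. fint (trunc n f) \<xi> - f' \<xi>) + norm2 (\<lambda>\<xi>. fint (trunc n g) \<xi> - g' \<xi>)" for n
      by (intro L2_add L2_diff fint_trunc_L2 f g)
    then show "\<forall>n. norm (norm2 (\<lambda>\<xi>. fint (trunc n (\<lambda>x. f x + g x)) \<xi> - (f' \<xi> + g' \<xi>)))
        \<le> norm2 (\<lambda>\<xi>. fint (trunc n f) \<xi> - f' \<xi>) + norm2 (\<lambda>\<xi>. fint (trunc n g) \<xi> - g' \<xi>)"
      by (simp add: eq add_diff_add)
    show "(\<lambda>n. norm2 (\<lambda>\<xi>. fint (trunc n f) \<xi> - f' \<xi>) + norm2 (\<lambda>\<xi>. fint (trunc n g) \<xi> - g' \<xi>)) \<longlonglongrightarrow> 0"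
      using tendsto_add[OF f(3) g(3)] by simp
  qed
  then show ?thesis using L2_add(1)[OF f(1) g(1)] L2_add(1)[OF f(2) g(2)] by (simp add: has_ft_def)
qed

lemma has_ft_cmult:
  assumes f: "has_ft f f'"
  shows "has_ft (\<lambda>x. c * f x) (\<lambda>\<xi>. c * f' \<xi>)"
proof -
  note f = has_ftD[OF f]
  have eq: "fint (trunc n (\<lambda>x. c * f x)) \<xi> = c * fint (trunc n f) \<xi>" for n \<xi>
    using fint_cmult[of c "trunc n f" \<xi>] by (simp add: trunc_def[abs_def] mult_ac)
  have "(\<lambda>n. norm c * norm2 (\<lambda>\<xi>. fint (trunc n f) \<xi> - f' \<xi>)) \<longlonglongrightarrow> norm c * 0"
    by (intro tendsto_intros f)
  then show ?thesis
    using L2_cmult[OF f(1), of c] L2_cmult[OF f(2), of c]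
    by (simp add: has_ft_def eq right_diff_distrib[symmetric] L2_cmult(2) L2_diff(1) fint_trunc_L2(1) f)
qed

lemma has_ft_diff:
  assumes f: "has_ft f f'" and g: "has_ft g g'"
  shows "has_ft (\<lambda>x. f x - g x) (\<lambda>\<xi>. f' \<xi> - g' \<xi>)"
  using has_ft_add[OF f has_ft_cmult[OF g, of "-1"]] by simp

lemma has_ft_cong_AE:
  assumes f: "has_ft f g" and eq: "AE x in lborel. f x = f2 x" "AE x in lborel. g x = g2 x"
    and [measurable]: "f2 \<in> borel_measurable borel" "g2 \<in> borel_measurable borel"
  shows "has_ft f2 g2"
proof -
  note f = has_ftD[OF f]
  note [measurable] = L2_measurable[OF f(1)] L2_measurable[OF f(2)]
  have L2: "f2 \<in> L2" "g2 \<in> L2"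
    using L2_cong_AE[OF _ f(1), of f2] L2_cong_AE[OF _ f(2), of g2] eq by (auto simp: eq_commute)
  have 1: "fint (trunc n f) = fint (trunc n f2)" for n
  proof
    show "fint (trunc n f) \<xi> = fint (trunc n f2) \<xi>" for \<xi>
      unfolding fint_def
    proof (rule integral_cong_AE)
      show "AE x in lborel. trunc n f x * fkernel x \<xi> = trunc n f2 x * fkernel x \<xi>"
        using eq(1) by eventually_elim (simp add: trunc_def)
    qed measurable
  qed
  have "norm2 (\<lambda>\<xi>. fint (trunc n f) \<xi> - g \<xi>) = norm2 (\<lambda>\<xi>. fint (trunc n f) \<xi> - g2 \<xi>)" for n
    using L2_measurable[OF fint_trunc_L2(1)[OF f(1)], of n]
    by (intro norm2_cong_AE) (simp_all, use eq(2) in eventually_elim, simp)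
  then show ?thesis using f(3) L2 by (simp add: has_ft_def 1)
qed

lemma has_ft_injective:
  assumes f: "has_ft f f'" and g: "has_ft g g'" and eq: "AE \<xi> in lborel. f' \<xi> = g' \<xi>"
  shows "AE x in lborel. f x = g x"
proof -
  have d: "has_ft (\<lambda>x. f x - g x) (\<lambda>\<xi>. f' \<xi> - g' \<xi>)" by (rule has_ft_diff[OF f g])
  have "norm2 (\<lambda>\<xi>. f' \<xi> - g' \<xi>) = 0"
    using norm2_eq_0_iff[OF has_ftD(2)[OF d]] eq by simp
  then show ?thesis
    using has_ft_isometric[OF d] norm2_eq_0_iff[OF has_ftD(1)[OF d]] by simp
qed

lemma has_ft_pairing:
  assumes f: "has_ft f f'" and g: "has_ft g g'"
  shows "(LINT \<xi>|lborel. f' \<xi> * g \<xi>) = (LINT x|lborel. f x * g' x)"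
proof (rule LIMSEQ_unique)
  note f = has_ftD[OF f] and g = has_ftD[OF g]
  show "(\<lambda>n. LINT \<xi>|lborel. fint (trunc n f) \<xi> * trunc n g \<xi>) \<longlonglongrightarrow> (LINT \<xi>|lborel. f' \<xi> * g \<xi>)"
    by (intro integral_mult_L2_tendsto fint_trunc_L2 trunc_L2 trunc_tendsto f g)
  show "(\<lambda>n. LINT \<xi>|lborel. fint (trunc n f) \<xi> * trunc n g \<xi>) \<longlonglongrightarrow> (LINT x|lborel. f x * g' x)"
    unfolding fint_pairing[OF trunc_L2(2)[OF f(1)] trunc_L2(2)[OF g(1)]]
    by (intro integral_mult_L2_tendsto fint_trunc_L2 trunc_L2 trunc_tendsto f g)
qed

text \<open>
  The transforms of the truncations converge pointwise by dominated convergence, and their limit in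
  the square norm must be the same function.
\<close>

lemma has_ft_integrable:
  assumes f: "has_ft f g" and int: "integrable lborel f"
  shows "AE \<xi> in lborel. g \<xi> = fint f \<xi>"
proof -
  note f = has_ftD[OF f]
  note [measurable] = L2_measurable[OF f(1)] L2_measurable[OF f(2)] L2_measurable[OF trunc_L2(1)[OF f(1)]]
  have pt: "(\<lambda>n. fint (trunc n f) \<xi> - g \<xi>) \<longlonglongrightarrow> fint f \<xi> - g \<xi>" for \<xi>
    unfolding fint_def
  proof (intro tendsto_diff tendsto_const integral_dominated_convergence[where w="\<lambda>x. norm (f x)"])
    show "AE x in lborel. (\<lambda>n. trunc n f x * fkernel x \<xi>) \<longlonglongrightarrow> f x * fkernel x \<xi>"
      by (intro AE_I2 tendsto_intros tendsto_eventually trunc_pointwise)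
  qed (use int norm_trunc_le in \<open>auto simp: norm_mult\<close>)
  have "(\<lambda>\<xi>. fint f \<xi> - g \<xi>) \<in> L2 \<and> norm2 (\<lambda>\<xi>. fint f \<xi> - g \<xi>) \<le> e" if "e > 0" for e
  proof -
    have "eventually (\<lambda>n. norm2 (\<lambda>\<xi>. fint (trunc n f) \<xi> - g \<xi>) \<le> e) sequentially"
      using order_tendstoD(2)[OF f(3) that] by (rule eventually_mono) simp
    then show ?thesis
      using norm2_Fatou[of "\<lambda>n \<xi>. fint (trunc n f) \<xi> - g \<xi>" "\<lambda>\<xi>. fint f \<xi> - g \<xi>" e] pt
        L2_diff(1)[OF fint_trunc_L2(1)[OF f(1)] f(2)] by simp
  qed
  note close = this
  have "norm2 (\<lambda>\<xi>. fint f \<xi> - g \<xi>) \<le> 0"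
    by (rule field_le_epsilon) (use close in simp)
  then have "norm2 (\<lambda>\<xi>. fint f \<xi> - g \<xi>) = 0" using norm2_nonneg by (rule antisym)
  then have "AE \<xi> in lborel. fint f \<xi> - g \<xi> = 0"
    using norm2_eq_0_iff[OF conjunct1[OF close[of 1]]] by simp
  then show ?thesis by eventually_elim simp
qed

text \<open>
  With \<open>a\<close> and \<open>b\<close> equal to \<open>1\<close> or \<open>-1\<close> this covers the two generators of the symmetry group and
  also \<open>x \<mapsto> - x\<close>, which relates the transforms of a function and of its conjugate.
\<close>

definition reflect :: "real \<Rightarrow> real \<Rightarrow> plane \<Rightarrow> plane" where
  "reflect a b x = (a * fst x, b * snd x)"

lemma measurable_reflect [measurable]: "reflect a b \<in> borel_measurable borel"
  unfolding reflect_def[abs_def] borel_prod[symmetric] by measurable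

lemma distr_reflect:
  assumes "\<bar>a\<bar> = 1" "\<bar>b\<bar> = 1"
  shows "distr lborel borel (reflect a b) = lborel"
proof -
  define c where "c j = (if j = (1, 0) then a else b)" for j :: plane
  have T: "0 + (\<Sum>j\<in>Basis. (c j * (x \<bullet> j)) *\<^sub>R j) = reflect a b x" for x :: plane
    by (simp add: Basis_prod_def c_def reflect_def inner_prod_def)
  have P: "(\<Prod>j\<in>(Basis::plane set). \<bar>c j\<bar>) = 1"
    using assms by (intro prod.neutral) (auto simp: c_def)
  have "c j \<noteq> 0" for j using assms by (auto simp: c_def)
  then have "lborel = density (distr lborel borel (reflect a b)) (\<lambda>_. 1)"
    using lborel_affine_euclidean[of c 0] by (simp add: T[simplified] P)
  then show ?thesis by (simp add: density_1)
qed

lemma integral_reflect: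
  fixes f :: "plane \<Rightarrow> 'b::{banach,second_countable_topology}"
  assumes "\<bar>a\<bar> = 1" "\<bar>b\<bar> = 1" and [measurable]: "f \<in> borel_measurable borel"
  shows "(LINT x|lborel. f (reflect a b x)) = (LINT x|lborel. f x)"
  using integral_distr[of "reflect a b" lborel borel f] by (simp add: distr_reflect assms)

lemma AE_reflect:
  assumes ab: "\<bar>a\<bar> = 1" "\<bar>b\<bar> = 1" and P: "AE x in lborel. P x"
  shows "AE x in lborel. P (reflect a b x)"
proof -
  obtain N where N: "N \<in> null_sets lborel" "{x. \<not> P x} \<subseteq> N"
    using P by (auto simp: eventually_ae_filter)
  have "AE x in distr lborel borel (reflect a b). x \<notin> N"
    unfolding distr_reflect[OF ab] using N(1) by (rule AE_not_in)
  moreover have "{x \<in> space borel. x \<notin> N} \<in> sets borel" using N(1) by auto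
  ultimately have "AE x in lborel. reflect a b x \<notin> N" by (subst (asm) AE_distr_iff) auto
  then show ?thesis by (rule eventually_mono) (use N(2) in auto)
qed

lemma L2_reflect:
  fixes f :: "plane \<Rightarrow> 'b::{banach,second_countable_topology}"
  assumes ab: "\<bar>a\<bar> = 1" "\<bar>b\<bar> = 1"  and f: "f \<in> L2"
  shows "(\<lambda>x. f (reflect a b x)) \<in> L2" "norm2 (\<lambda>x. f (reflect a b x)) = norm2 f"
proof -
  note [measurable] = L2_measurable[OF f]
  show n: "norm2 (\<lambda>x. f (reflect a b x)) = norm2 f"
    using integral_reflect[OF ab, of "\<lambda>x. (norm (f x))\<^sup>2"] by (simp add: norm2_def)
  have "integrable (distr lborel borel (reflect a b)) (\<lambda>x. (norm (f x))\<^sup>2)"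
    unfolding distr_reflect[OF ab] by (rule L2_integrable[OF f])
  then have "integrable lborel (\<lambda>x. (norm (f (reflect a b x)))\<^sup>2)"
    by (subst (asm) integrable_distr_eq) auto
  then show "(\<lambda>x. f (reflect a b x)) \<in> L2" by (simp add: L2_def)
qed

lemma reflect_inner: "\<bar>a\<bar> = 1 \<Longrightarrow> \<bar>b\<bar> = 1 \<Longrightarrow> reflect a b x \<bullet> reflect a b y = x \<bullet> y"
  by (auto simp: reflect_def inner_prod_def abs_if split: if_splits)

lemma norm_reflect: "\<bar>a\<bar> = 1 \<Longrightarrow> \<bar>b\<bar> = 1 \<Longrightarrow> norm (reflect a b x) = norm x"
  by (simp add: norm_eq_sqrt_inner reflect_inner)

lemma has_ft_reflect:
  assumes ab: "\<bar>a\<bar> = 1" "\<bar>b\<bar> = 1" and f: "has_ft f g"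
  shows "has_ft (\<lambda>x. f (reflect a b x)) (\<lambda>\<xi>. g (reflect a b \<xi>))"
proof -
  note f = has_ftD[OF f]
  note [measurable] = L2_measurable[OF f(1)]
  have t: "trunc n (\<lambda>x. f (reflect a b x)) = (\<lambda>x. trunc n f (reflect a b x))" for n
    by (simp add: trunc_def[abs_def] indicator_def norm_reflect[OF ab])
  have "fint (\<lambda>x. trunc n f (reflect a b x)) \<xi> = fint (trunc n f) (reflect a b \<xi>)" for n \<xi>
  proof -
    have "fint (\<lambda>x. trunc n f (reflect a b x)) \<xi>
        = (LINT x|lborel. trunc n f (reflect a b x) * fkernel (reflect a b x) (reflect a b \<xi>))"
      by (simp add: fint_def fkernel_def reflect_inner[OF ab])
    also have "\<dots> = fint (trunc n f) (reflect a b \<xi>)"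
      unfolding fint_def by (rule integral_reflect[OF ab]) simp
    finally show ?thesis .
  qed
  moreover have "norm2 (\<lambda>\<xi>. fint (trunc n f) (reflect a b \<xi>) - g (reflect a b \<xi>))
      = norm2 (\<lambda>\<xi>. fint (trunc n f) \<xi> - g \<xi>)" for n
    by (rule L2_reflect(2)[OF ab L2_diff(1)[OF fint_trunc_L2(1)[OF f(1)] f(2)]])
  ultimately show ?thesis using f(3) L2_reflect(1)[OF ab f(1)] L2_reflect(1)[OF ab f(2)]
    by (simp add: has_ft_def t)
qed

lemma L2_cnj: "f \<in> L2 \<Longrightarrow> (\<lambda>x. cnj (f x)) \<in> L2" "norm2 (\<lambda>x. cnj (f x)) = norm2 f"
  by (auto simp: L2_def norm2_def)

lemma has_ft_cnj:
  assumes f: "has_ft f g"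
  shows "has_ft (\<lambda>x. cnj (f x)) (\<lambda>\<xi>. cnj (g (- \<xi>)))"
proof -
  note f = has_ftD[OF f]
  have m: "- x = reflect (-1) (-1) x" for x by (simp add: reflect_def prod_eq_iff)
  have t: "trunc n (\<lambda>x. cnj (f x)) = (\<lambda>x. cnj (trunc n f x))" for n
    by (simp add: trunc_def[abs_def])
  have "fint (\<lambda>x. cnj (trunc n f x)) \<xi> = cnj (fint (trunc n f) (- \<xi>))" for n \<xi>
  proof -
    have "cnj (fkernel x (- \<xi>)) = fkernel x \<xi>" for x by (simp add: cnj_fkernel) (simp add: fkernel_def)
    then show ?thesis
      using Bochner_Integration.integral_cnj[of lborel "\<lambda>x. trunc n f x * fkernel x (- \<xi>)"] by (simp add: fint_def)
  qed
  moreover have "norm2 (\<lambda>\<xi>. cnj (fint (trunc n f) (- \<xi>)) - cnj (g (- \<xi>)))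
      = norm2 (\<lambda>\<xi>. fint (trunc n f) \<xi> - g \<xi>)" for n
    unfolding complex_cnj_diff[symmetric] L2_cnj(2) m
    by (rule L2_reflect(2)) (auto intro: L2_diff(1)[OF fint_trunc_L2(1)[OF f(1)] f(2)])
  moreover have "(\<lambda>\<xi>. cnj (g (- \<xi>))) \<in> L2"
    unfolding m by (intro L2_cnj L2_reflect f) auto
  ultimately show ?thesis using f(3) L2_cnj(1)[OF f(1)] by (simp add: has_ft_def t)
qed

text \<open>
  The conjugate of the transform of the conjugate is the inverse transform. Let \<open>w\<close> be the transform
  of the conjugate of \<open>k\<close>. The isometry gives \<open>norm2 w = norm2 k = norm2 h\<close>, and the pairing shows
  that the inner product of \<open>w\<close> and \<open>h\<close> is \<open>(norm2 k)\<^sup>2\<close>. Two vectors of equal length with this inner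
  product coincide.
\<close>

theorem has_ft_inverse:
  assumes k: "has_ft (\<lambda>\<xi>. cnj (h \<xi>)) k"
  shows "has_ft (\<lambda>x. cnj (k x)) h"
proof -
  note kL2 = has_ftD(2)[OF k]
  have hL2: "h \<in> L2" using L2_cnj(1)[OF has_ftD(1)[OF k]] by simp
  obtain w where w: "has_ft (\<lambda>x. cnj (k x)) w" using has_ft_exists L2_cnj(1)[OF kL2] by blast
  note wL2 = has_ftD(2)[OF w]
  note [measurable] = L2_measurable[OF hL2] L2_measurable[OF wL2]
  have nk: "norm2 k = norm2 h" using has_ft_isometric[OF k] by (simp add: L2_cnj)
  have nw: "norm2 w = norm2 h" using has_ft_isometric[OF w] nk by (simp add: L2_cnj)
  have cross: "(LINT \<xi>|lborel. w \<xi> * cnj (h \<xi>)) = of_real ((norm2 h)\<^sup>2)"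
  proof -
    have "(LINT \<xi>|lborel. w \<xi> * cnj (h \<xi>)) = (LINT x|lborel. k x * cnj (k x))"
      using has_ft_pairing[OF w k] by (simp add: mult.commute)
    also have "\<dots> = of_real ((norm2 k)\<^sup>2)"
      unfolding norm2_squared by (simp flip: complex_norm_square of_real_power)
    finally show ?thesis by (simp add: nk)
  qed
  have int: "integrable lborel (\<lambda>\<xi>. w \<xi> * cnj (h \<xi>))"
    by (rule integrable_mult_L2(1)[OF wL2 L2_cnj(1)[OF hL2]])
  define p where "p \<xi> = Re (w \<xi> * cnj (h \<xi>))" for \<xi>
  have p: "integrable lborel p" "(LINT \<xi>|lborel. p \<xi>) = (norm2 h)\<^sup>2"
    using integrable_Re[OF int] integral_Re[OF int] cross unfolding p_def[abs_def] by simp_all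
  have "(norm2 (\<lambda>\<xi>. w \<xi> - h \<xi>))\<^sup>2
      = (LINT \<xi>|lborel. (norm (w \<xi>))\<^sup>2 + (norm (h \<xi>))\<^sup>2 - 2 * p \<xi>)"
    unfolding norm2_squared p_def
    by (intro Bochner_Integration.integral_cong refl)
       (simp only: cmod_power2, simp add: power2_eq_square algebra_simps)
  also have "\<dots> = (norm2 w)\<^sup>2 + (norm2 h)\<^sup>2 - 2 * (norm2 h)\<^sup>2"
    using p L2_integrable[OF wL2] L2_integrable[OF hL2] by (simp add: norm2_squared)
  also have "\<dots> = 0" by (simp add: nw)
  finally have "AE \<xi> in lborel. w \<xi> = h \<xi>"
    using norm2_eq_0_iff[OF L2_diff(1)[OF wL2 hL2]] by simp
  then show ?thesis
    by (intro has_ft_cong_AE[OF w]) (use L2_measurable[OF L2_cnj(1)[OF kL2]] in auto)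
qed

lemma has_ft_surjective:
  assumes "h \<in> L2" shows "\<exists>f. has_ft f h"
  using has_ft_exists[OF L2_cnj(1)[OF assms]] has_ft_inverse by blast

text \<open>
  For integrable \<open>h\<close> the inverse transform is given by the absolutely convergent integral.
\<close>

lemma has_ft_sup_bound:
  assumes f: "has_ft f h" and h: "integrable lborel h"
  shows "AE x in lborel. norm (f x) \<le> (LINT \<xi>|lborel. norm (h \<xi>))"
proof -
  obtain k where k: "has_ft (\<lambda>\<xi>. cnj (h \<xi>)) k"
    using has_ft_exists[OF L2_cnj(1)[OF has_ftD(2)[OF f]]] by blast
  have "AE x in lborel. k x = fint (\<lambda>\<xi>. cnj (h \<xi>)) x"
    by (rule has_ft_integrable[OF k]) (use h in simp)
  moreover have "AE x in lborel. f x = cnj (k x)"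
    by (rule has_ft_injective[OF f has_ft_inverse[OF k]]) simp
  ultimately show ?thesis
  proof eventually_elim
    case (elim x)
    then show ?case using norm_fint_le[of "\<lambda>\<xi>. cnj (h \<xi>)" x] by simp
  qed
qed

section \<open>Real functions\<close>

abbreviation cx :: "(plane \<Rightarrow> real) \<Rightarrow> plane \<Rightarrow> complex" where
  "cx u \<equiv> (\<lambda>x. complex_of_real (u x))"

lemma L2_cx: "u \<in> L2 \<Longrightarrow> cx u \<in> L2" "norm2 (cx u) = norm2 u"
  by (auto simp: L2_def norm2_def)

text \<open>
  By the symmetry of \<open>h\<close>, a preimage of \<open>h\<close> and its conjugate have the same transform, so they agree
  almost everywhere and the preimage may be taken real.
\<close>

lemma has_ft_real:
  assumes h: "h \<in> L2" and herm: "AE \<xi> in lborel. h (- \<xi>) = cnj (h \<xi>)"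
  shows "\<exists>u. u \<in> L2 \<and> has_ft (cx u) h"
proof -
  obtain f where f: "has_ft f h" using has_ft_surjective[OF h] by blast
  note [measurable] = L2_measurable[OF has_ftD(1)[OF f]] L2_measurable[OF h]
  have "AE x in lborel. cnj (f x) = f x"
    by (rule has_ft_injective[OF has_ft_cnj[OF f] f])
       (use herm in eventually_elim, simp)
  then have eq: "AE x in lborel. f x = of_real (Re (f x))"
    by eventually_elim (metis complex_cnj_cancel_iff complex_is_Real_iff of_real_Re Reals_cnj_iff)
  have L2: "(\<lambda>x. Re (f x)) \<in> L2"
    by (rule L2_dominated(1)[OF _ has_ftD(1)[OF f], of _ 1]) (auto simp: abs_Re_le_cmod)
  show ?thesis
    by (intro exI[of _ "\<lambda>x. Re (f x)"] conjI L2 has_ft_cong_AE[OF f]) (use eq in auto)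
qed

text \<open>
  Links the theory for complex functions to the transform of real functions; on square integrable
  functions the limit of extended nonnegative integrals is a limit of norms.
\<close>

lemma has_fourier_iff:
  assumes u: "u \<in> L2"
  shows "has_fourier u g \<longleftrightarrow> has_ft (cx u) g"
proof -
  have fi: "fourier_integral (\<lambda>x. indicator (ball 0 (real n)) x * u x) \<xi> = fint (trunc n (cx u)) \<xi>" for n \<xi>
    by (simp add: fourier_integral_def fint_def trunc_def fkernel_def)
  have "(\<lambda>n. \<integral>\<^sup>+ \<xi>. ennreal ((norm (fint (trunc n (cx u)) \<xi> - g \<xi>))\<^sup>2) \<partial>lborel)
      = (\<lambda>n. ennreal ((norm2 (\<lambda>\<xi>. fint (trunc n (cx u)) \<xi> - g \<xi>))\<^sup>2))" if "g \<in> L2"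
    by (intro ext nn_integral_L2 L2_diff fint_trunc_L2 L2_cx u that)
  moreover have "(\<lambda>n. ennreal ((norm2 (\<lambda>\<xi>. fint (trunc n (cx u)) \<xi> - g \<xi>))\<^sup>2)) \<longlonglongrightarrow> 0 \<longleftrightarrow>
      L2_lim (\<lambda>n. fint (trunc n (cx u))) g" (is "?A \<longleftrightarrow> ?B")
  proof
    assume ?A
    then have "(\<lambda>n. (norm2 (\<lambda>\<xi>. fint (trunc n (cx u)) \<xi> - g \<xi>))\<^sup>2) \<longlonglongrightarrow> 0"
      by (subst (asm) ennreal_0[symmetric], subst (asm) tendsto_ennreal_iff) auto
    then have "(\<lambda>n. sqrt ((norm2 (\<lambda>\<xi>. fint (trunc n (cx u)) \<xi> - g \<xi>))\<^sup>2)) \<longlonglongrightarrow> sqrt 0"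
      by (intro tendsto_intros)
    then show ?B by simp
  next
    assume ?B
    then have "(\<lambda>n. ennreal ((norm2 (\<lambda>\<xi>. fint (trunc n (cx u)) \<xi> - g \<xi>))\<^sup>2)) \<longlonglongrightarrow> ennreal (0\<^sup>2)"
      by (intro tendsto_intros)
    then show ?A by simp
  qed
  ultimately show ?thesis
    using L2_cx(1)[OF u] unfolding has_fourier_def has_ft_def fi by (cases "g \<in> L2") simp_all
qed

lemma has_ft_fourier:
  assumes u: "u \<in> L2" shows "has_ft (cx u) (fourier u)"
proof -
  have "\<exists>g. has_fourier u g" using has_ft_exists[OF L2_cx(1)[OF u]] by (simp add: has_fourier_iff[OF u])
  then have "has_fourier u (fourier u)" unfolding fourier_def by (rule someI_ex)
  then show ?thesis by (simp add: has_fourier_iff[OF u])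
qed

lemma fourier_eq:
  assumes "u \<in> L2" "has_ft (cx u) g" shows "AE \<xi> in lborel. fourier u \<xi> = g \<xi>"
  using has_ft_unique[OF has_ft_fourier] assms by blast

section \<open>The spaces and the linear operator\<close>

lemma measurable_symbol [measurable]: "symbol_l \<mu> \<in> borel_measurable borel"
  unfolding symbol_l_def[abs_def] by measurable

lemma symbol_reflect: "\<bar>a\<bar> = 1 \<Longrightarrow> \<bar>b\<bar> = 1 \<Longrightarrow> symbol_l \<mu> (reflect a b \<xi>) = symbol_l \<mu> \<xi>"
  by (simp add: symbol_l_def norm_reflect)

lemma symbol_minus [simp]: "symbol_l \<mu> (- \<xi>) = symbol_l \<mu> \<xi>"
  by (simp add: symbol_l_def)

lemma integrable_inverse_1_plus_square_real: "integrable lborel (\<lambda>s::real. inverse (1 + s\<^sup>2))"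
  using integrable_inverse_1_plus_square by (simp add: set_integrable_def)

text \<open>
  The symbol has degree four, so a multiple of it dominates \<open>(1 + x\<^sup>2) * (1 + y\<^sup>2)\<close>, and the square of
  its inverse is bounded by a product of two integrable functions of one variable.
\<close>

lemma inverse_symbol_L2:
  assumes "\<mu> > 0"
  shows "(\<lambda>\<xi>. inverse (symbol_l \<mu> \<xi>)) \<in> L2"
proof -
  \<comment> \<open>The constants come from \<open>(1 + q)\<^sup>2 \<le> 8 + 2 * (1 - q)\<^sup>2\<close> with \<open>q = (norm (2 * pi * \<xi>))\<^sup>2\<close>.\<close>
  define K where "K = 8 / \<mu> + 2"
  have K: "K > 0" using assms by (simp add: K_def add_pos_pos)
  have lower: "(1 + (fst \<xi>)\<^sup>2) * (1 + (snd \<xi>)\<^sup>2) \<le> K * symbol_l \<mu> \<xi>" for \<xi> :: plane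
  proof -
    define s where "s = (norm \<xi>)\<^sup>2"
    have s: "s = (fst \<xi>)\<^sup>2 + (snd \<xi>)\<^sup>2" by (simp add: s_def norm_prod_def)
    then have "0 \<le> s" by simp
    define q where "q = (2 * pi)\<^sup>2 * s"
    have "1 \<le> (2 * pi)\<^sup>2" using pi_gt3 by (intro one_le_power) simp
    then have sq: "s \<le> q" unfolding q_def using \<open>0 \<le> s\<close> by (simp add: mult_le_cancel_right1)
    have "(fst \<xi>)\<^sup>2 \<le> s" "(snd \<xi>)\<^sup>2 \<le> s" by (simp_all add: s)
    then have "(1 + (fst \<xi>)\<^sup>2) * (1 + (snd \<xi>)\<^sup>2) \<le> (1 + s) * (1 + s)"
      using \<open>0 \<le> s\<close> by (intro mult_mono) auto
    also have "\<dots> \<le> (1 + q) * (1 + q)" using sq \<open>0 \<le> s\<close> by (intro mult_mono) auto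
    also have "\<dots> \<le> 8 + 2 * (1 - q)\<^sup>2"
      using zero_le_power2[of "3 - q"] by (simp add: power2_eq_square algebra_simps)
    also have "\<dots> \<le> K * ((1 - q)\<^sup>2 + \<mu>)"
      using assms by (simp add: K_def field_simps)
    also have "(1 - q)\<^sup>2 + \<mu> = symbol_l \<mu> \<xi>"
      by (simp add: symbol_l_def q_def s_def power_mult_distrib)
    finally show ?thesis .
  qed
  have pos: "0 < symbol_l \<mu> \<xi>" for \<xi> using assms by (simp add: symbol_l_def add_nonneg_pos)
  have "integrable lborel (\<lambda>\<xi>::plane. K\<^sup>2 * (inverse (1 + (fst \<xi>)\<^sup>2) * inverse (1 + (snd \<xi>)\<^sup>2)))"
    by (intro integrable_mult_right integral_tensor_plane integrable_inverse_1_plus_square_real)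
  then have "integrable lborel (\<lambda>\<xi>. (inverse (symbol_l \<mu> \<xi>))\<^sup>2)"
  proof (rule integrable_domI)
    show "AE \<xi> in lborel. norm ((inverse (symbol_l \<mu> \<xi>))\<^sup>2)
      \<le> norm (K\<^sup>2 * (inverse (1 + (fst \<xi>)\<^sup>2) * inverse (1 + (snd \<xi>)\<^sup>2)))"
    proof (rule AE_I2)
      fix \<xi> :: plane
      define p where "p = (1 + (fst \<xi>)\<^sup>2) * (1 + (snd \<xi>)\<^sup>2)"
      have "1 * 1 \<le> p" unfolding p_def by (intro mult_mono) auto
      then have "p \<ge> 1" by simp
      have "inverse (symbol_l \<mu> \<xi>) \<le> K * inverse p"
        using lower[of \<xi>] pos[of \<xi>] \<open>p \<ge> 1\<close> by (simp add: p_def[symmetric] field_simps)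
      then have "(inverse (symbol_l \<mu> \<xi>))\<^sup>2 \<le> (K * inverse p)\<^sup>2"
        using pos[of \<xi>] by (intro power_mono) (auto intro: less_imp_le)
      also have "\<dots> = K\<^sup>2 * (inverse p * inverse p)" by (simp add: power2_eq_square)
      also have "\<dots> \<le> K\<^sup>2 * (inverse p * 1)"
        using \<open>p \<ge> 1\<close> by (intro mult_left_mono) (auto simp: inverse_le_1_iff)
      finally show "norm ((inverse (symbol_l \<mu> \<xi>))\<^sup>2) \<le> norm (K\<^sup>2 * (inverse (1 + (fst \<xi>)\<^sup>2) * inverse (1 + (snd \<xi>)\<^sup>2)))"
        by (simp add: p_def abs_mult)
    qed
  qed measurable
  then show ?thesis by (simp add: L2_def)
qed

lemma fourier_L2: "u \<in> L2 \<Longrightarrow> fourier u \<in> L2"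
  by (rule has_ftD(2)[OF has_ft_fourier])

lemma fourier_hermitian:
  assumes "u \<in> L2" shows "AE \<xi> in lborel. fourier u (- \<xi>) = cnj (fourier u \<xi>)"
proof -
  have "AE \<xi> in lborel. fourier u \<xi> = cnj (fourier u (- \<xi>))"
    by (rule fourier_eq[OF assms]) (use has_ft_cnj[OF has_ft_fourier[OF assms]] in simp)
  then show ?thesis by eventually_elim (metis complex_cnj_cnj)
qed

lemma ae_eq_refl [simp]: "f =ae f"
  by (simp add: ae_eq_def)

lemma ae_eq_sym: "f =ae g \<Longrightarrow> g =ae f"
  by (simp add: ae_eq_def eq_commute)

lemma ae_eq_trans [trans]: "f =ae g \<Longrightarrow> g =ae h \<Longrightarrow> f =ae h"
  unfolding ae_eq_def by (auto elim: eventually_elim2)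

lemma ae_eq_compose2: "f =ae g \<Longrightarrow> f' =ae g' \<Longrightarrow> (\<lambda>x. \<phi> (f x) (f' x)) =ae (\<lambda>x. \<phi> (g x) (g' x))"
  unfolding ae_eq_def by (auto elim: eventually_elim2)

lemma norm2_ae_cong:
  fixes f g :: "plane \<Rightarrow> 'b::{banach,second_countable_topology}"
  shows "f \<in> L2 \<Longrightarrow> g \<in> L2 \<Longrightarrow> f =ae g \<Longrightarrow> norm2 f = norm2 g"
  by (rule norm2_cong_AE) (auto simp: ae_eq_def L2_measurable)

lemma integral_ae_cong:
  fixes f g :: "plane \<Rightarrow> 'b::{banach,second_countable_topology}"
  assumes "f \<in> borel_measurable borel" "g \<in> borel_measurable borel" "f =ae g"
  shows "(LINT x|lborel. f x) = (LINT x|lborel. g x)"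
  using assms by (intro integral_cong_AE) (auto simp: ae_eq_def)

text \<open>
  By the inversion formula the transform of the conjugate of \<open>fourier b\<close> is \<open>b\<close> itself, so this is an
  instance of the pairing.
\<close>

lemma parseval:
  assumes a: "a \<in> L2" and b: "b \<in> L2"
  shows "of_real (LINT x|lborel. a x * b x) = (LINT \<xi>|lborel. fourier a \<xi> * cnj (fourier b \<xi>))"
proof -
  obtain k where k: "has_ft (\<lambda>\<xi>. cnj (fourier b \<xi>)) k"
    using has_ft_exists[OF L2_cnj(1)[OF fourier_L2[OF b]]] by blast
  have "AE x in lborel. cnj (k x) = cx b x"
    by (rule has_ft_injective[OF has_ft_inverse[OF k] has_ft_fourier[OF b]]) simp
  then have kb: "AE x in lborel. k x = cx b x"
    by eventually_elim (metis complex_cnj_cnj complex_cnj_complex_of_real)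
  note [measurable] = L2_measurable[OF a] L2_measurable[OF b] L2_measurable[OF has_ftD(2)[OF k]]
  have "(LINT \<xi>|lborel. fourier a \<xi> * cnj (fourier b \<xi>)) = (LINT x|lborel. cx a x * k x)"
    by (rule has_ft_pairing[OF has_ft_fourier[OF a] k])
  also have "\<dots> = (LINT x|lborel. of_real (a x * b x))"
    by (rule integral_cong_AE) (simp_all, use kb in eventually_elim, simp)
  also have "\<dots> = of_real (LINT x|lborel. a x * b x)" by (rule integral_complex_of_real)
  finally show ?thesis ..
qed

locale swift_hohenberg =
  fixes \<mu> :: real
  assumes mu_pos: "\<mu> > 0"
begin

abbreviation "L \<equiv> LL \<mu>"
abbreviation "nl \<equiv> norm_l \<mu>"
abbreviation "H \<equiv> Hl \<mu>"
abbreviation "HD \<equiv> Hl_D2 \<mu>"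
abbreviation "lsym \<equiv> symbol_l \<mu>"

lemma symbol_ge: "\<mu> \<le> lsym \<xi>"
  by (simp add: symbol_l_def)

lemma symbol_pos: "0 < lsym \<xi>"
  using symbol_ge[of \<xi>] mu_pos by linarith

lemma symbol_nz [simp]: "lsym \<xi> \<noteq> 0"
  using symbol_pos[of \<xi>] by simp

lemma H_L2: "u \<in> H \<Longrightarrow> u \<in> L2"
  by (simp add: Hl_def)

lemma HD_H: "u \<in> HD \<Longrightarrow> u \<in> H"
  by (simp add: Hl_D2_def Hl_def)

lemma symbol_fourier_L2:
  assumes "u \<in> H" shows "(\<lambda>\<xi>. of_real (lsym \<xi>) * fourier u \<xi>) \<in> L2"
  using assms L2_measurable[OF fourier_L2[OF H_L2[OF assms]]]
  by (simp add: L2_def Hl_def norm_mult power_mult_distrib mult.commute)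

text \<open>
  The function chosen in the definition of \<open>LL\<close> exists: multiplication by the real and even symbol
  preserves Hermitian symmetry.
\<close>

lemma L_spec:
  assumes u: "u \<in> H"
  shows "L u \<in> L2" "fourier (L u) =ae (\<lambda>\<xi>. of_real (lsym \<xi>) * fourier u \<xi>)"
proof -
  have "AE \<xi> in lborel. of_real (lsym (- \<xi>)) * fourier u (- \<xi>) = cnj (of_real (lsym \<xi>) * fourier u \<xi>)"
    using fourier_hermitian[OF H_L2[OF u]] by eventually_elim simp
  from has_ft_real[OF symbol_fourier_L2[OF u] this]
  obtain f where f: "f \<in> L2" "has_ft (cx f) (\<lambda>\<xi>. of_real (lsym \<xi>) * fourier u \<xi>)" by blast
  then have "f \<in> L2 \<and> fourier f =ae (\<lambda>\<xi>. of_real (lsym \<xi>) * fourier u \<xi>)"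
    using fourier_eq[OF f] by (simp add: ae_eq_def)
  then have "L u \<in> L2 \<and> fourier (L u) =ae (\<lambda>\<xi>. of_real (lsym \<xi>) * fourier u \<xi>)"
    unfolding LL_def by (rule someI[where P="\<lambda>f. f \<in> L2 \<and> fourier f =ae (\<lambda>\<xi>. of_real (lsym \<xi>) * fourier u \<xi>)"])
  then show "L u \<in> L2" "fourier (L u) =ae (\<lambda>\<xi>. of_real (lsym \<xi>) * fourier u \<xi>)" by auto
qed

lemma has_ft_L:
  assumes u: "u \<in> H"
  shows "has_ft (cx (L u)) (\<lambda>\<xi>. of_real (lsym \<xi>) * fourier u \<xi>)"
  using has_ft_fourier[OF L_spec(1)[OF u]] L_spec(2)[OF u]
    L2_measurable[OF symbol_fourier_L2[OF u]] L2_measurable[OF L2_cx(1)[OF L_spec(1)[OF u]]]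
  by (auto simp: ae_eq_def intro: has_ft_cong_AE)

text \<open>
  All rules for \<open>L\<close> below follow this pattern: a candidate for \<open>L u\<close> is recognized by its
  transform.
\<close>

lemma H_I:
  assumes u: "u \<in> L2" and w: "w \<in> L2" and g: "has_ft (cx u) g"
    and sg: "has_ft (cx w) (\<lambda>\<xi>. of_real (lsym \<xi>) * g \<xi>)"
  shows "u \<in> H" "L u =ae w"
proof -
  note eq = fourier_eq[OF u g]
  note [measurable] = L2_measurable[OF has_ftD(2)[OF g]] L2_measurable[OF fourier_L2[OF u]]
  have "integrable lborel (\<lambda>\<xi>. (norm (of_real (lsym \<xi>) * g \<xi>))\<^sup>2)"
    by (rule L2_integrable[OF has_ftD(2)[OF sg]])
  then have "integrable lborel (\<lambda>\<xi>. (norm (fourier u \<xi>))\<^sup>2 * (lsym \<xi>)\<^sup>2)"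
    by (rule Bochner_Integration.integrable_cong_AE_imp)
       (simp, use eq in eventually_elim, simp add: norm_mult power_mult_distrib)
  then show uH: "u \<in> H" using u by (simp add: Hl_def)
  have "AE \<xi> in lborel. of_real (lsym \<xi>) * fourier u \<xi> = of_real (lsym \<xi>) * g \<xi>"
    using eq by eventually_elim simp
  then have "AE x in lborel. cx (L u) x = cx w x"
    by (rule has_ft_injective[OF has_ft_L[OF uH] sg])
  then show "L u =ae w" by (simp add: ae_eq_def)
qed

lemma L_add:
  assumes u: "u \<in> H" and v: "v \<in> H"
  shows "(\<lambda>x. u x + v x) \<in> H" "L (\<lambda>x. u x + v x) =ae (\<lambda>x. L u x + L v x)"
proof -
  have 1: "has_ft (cx (\<lambda>x. u x + v x)) (\<lambda>\<xi>. fourier u \<xi> + fourier v \<xi>)"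
    using has_ft_add[OF has_ft_fourier[OF H_L2[OF u]] has_ft_fourier[OF H_L2[OF v]]] by simp
  have 2: "has_ft (cx (\<lambda>x. L u x + L v x)) (\<lambda>\<xi>. of_real (lsym \<xi>) * (fourier u \<xi> + fourier v \<xi>))"
    using has_ft_add[OF has_ft_L[OF u] has_ft_L[OF v]] by (simp add: distrib_left)
  show "(\<lambda>x. u x + v x) \<in> H" "L (\<lambda>x. u x + v x) =ae (\<lambda>x. L u x + L v x)"
    using H_I[OF _ _ 1 2] L2_add(1) H_L2 L_spec u v by auto
qed

lemma L_cmult:
  assumes u: "u \<in> H"
  shows "(\<lambda>x. c * u x) \<in> H" "L (\<lambda>x. c * u x) =ae (\<lambda>x. c * L u x)"
proof -
  have 1: "has_ft (cx (\<lambda>x. c * u x)) (\<lambda>\<xi>. of_real c * fourier u \<xi>)"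
    using has_ft_cmult[OF has_ft_fourier[OF H_L2[OF u]]] by simp
  have 2: "has_ft (cx (\<lambda>x. c * L u x)) (\<lambda>\<xi>. of_real (lsym \<xi>) * (of_real c * fourier u \<xi>))"
    using has_ft_cmult[OF has_ft_L[OF u], of "of_real c"] by (simp add: mult_ac)
  show "(\<lambda>x. c * u x) \<in> H" "L (\<lambda>x. c * u x) =ae (\<lambda>x. c * L u x)"
    using H_I[OF _ _ 1 2] L2_cmult(1)[of u c] L2_cmult(1)[of "L u" c] H_L2 L_spec u by auto
qed

lemma L_diff:
  assumes u: "u \<in> H" and v: "v \<in> H"
  shows "(\<lambda>x. u x - v x) \<in> H" "L (\<lambda>x. u x - v x) =ae (\<lambda>x. L u x - L v x)"
proof -
  note m = L_cmult[OF v, of "-1"]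
  have "L (\<lambda>x. u x + (-1) * v x) =ae (\<lambda>x. L u x + L (\<lambda>x. (-1) * v x) x)"
    by (rule L_add[OF u m(1)])
  also have "\<dots> =ae (\<lambda>x. L u x + (-1) * L v x)" by (rule ae_eq_compose2[OF _ m(2)]) simp
  finally show "L (\<lambda>x. u x - v x) =ae (\<lambda>x. L u x - L v x)" by simp
  show "(\<lambda>x. u x - v x) \<in> H" using L_add(1)[OF u m(1)] by simp
qed

lemma L_cong:
  assumes u: "u \<in> H" and eq: "v =ae u" and v: "v \<in> borel_measurable borel"
  shows "v \<in> H" "L v =ae L u"
proof -
  have vL2: "v \<in> L2" using L2_cong_AE[OF v H_L2[OF u]] eq by (simp add: ae_eq_def)
  note [measurable] = v L2_measurable[OF fourier_L2[OF H_L2[OF u]]]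
  have 1: "has_ft (cx v) (fourier u)"
    using eq by (intro has_ft_cong_AE[OF has_ft_fourier[OF H_L2[OF u]]]) (auto simp: ae_eq_def eq_commute)
  show "v \<in> H" "L v =ae L u" using H_I[OF vL2 L_spec(1)[OF u] 1 has_ft_L[OF u]] by auto
qed

lemma L_injective:
  assumes u: "u \<in> H" and v: "v \<in> H" and eq: "L u =ae L v"
  shows "u =ae v"
proof -
  have "AE \<xi> in lborel. of_real (lsym \<xi>) * fourier u \<xi> = of_real (lsym \<xi>) * fourier v \<xi>"
  proof (rule has_ft_unique[OF has_ft_L[OF u]])
    show "has_ft (cx (L u)) (\<lambda>\<xi>. of_real (lsym \<xi>) * fourier v \<xi>)"
      using eq L2_measurable[OF L2_cx(1)[OF L_spec(1)[OF u]]] L2_measurable[OF symbol_fourier_L2[OF v]]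
      by (intro has_ft_cong_AE[OF has_ft_L[OF v]]) (auto simp: ae_eq_def eq_commute)
  qed
  then have "AE \<xi> in lborel. fourier u \<xi> = fourier v \<xi>" by eventually_elim simp
  from has_ft_injective[OF has_ft_fourier[OF H_L2[OF u]] has_ft_fourier[OF H_L2[OF v]] this]
  show ?thesis by (simp add: ae_eq_def)
qed

lemma L_surjective:
  assumes w: "w \<in> L2"
  shows "\<exists>u\<in>H. L u =ae w"
proof -
  define h where "h \<xi> = fourier w \<xi> / of_real (lsym \<xi>)" for \<xi>
  note [measurable] = L2_measurable[OF fourier_L2[OF w]] L2_measurable[OF w]
  have [measurable]: "h \<in> borel_measurable borel" unfolding h_def[abs_def] by measurable
  have "norm (h \<xi>) \<le> inverse \<mu> * norm (fourier w \<xi>)" for \<xi>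
  proof -
    have "inverse (lsym \<xi>) * norm (fourier w \<xi>) \<le> inverse \<mu> * norm (fourier w \<xi>)"
      using symbol_ge[of \<xi>] mu_pos by (intro mult_right_mono le_imp_inverse_le) auto
    then show ?thesis using symbol_pos[of \<xi>] by (simp add: h_def norm_divide divide_inverse[of "norm _"] mult.commute)
  qed
  then have hL2: "h \<in> L2"
    using mu_pos by (intro L2_dominated(1)[OF _ fourier_L2[OF w], of _ "inverse \<mu>"]) auto
  have "AE \<xi> in lborel. h (- \<xi>) = cnj (h \<xi>)"
    using fourier_hermitian[OF w] by eventually_elim (simp add: h_def)
  from has_ft_real[OF hL2 this] obtain u where u: "u \<in> L2" "has_ft (cx u) h" by blast
  have "has_ft (cx w) (\<lambda>\<xi>. of_real (lsym \<xi>) * h \<xi>)"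
    by (rule has_ft_cong_AE[OF has_ft_fourier[OF w]]) (auto simp: h_def)
  with H_I[OF u(1) w u(2)] show ?thesis by blast
qed

text \<open>
  By Parseval's identity, since the symbol is real.
\<close>

lemma L_symmetric:
  assumes u: "u \<in> H" and v: "v \<in> H"
  shows "(LINT x|lborel. L u x * v x) = (LINT x|lborel. u x * L v x)"
proof -
  note [measurable] = L2_measurable[OF fourier_L2[OF L_spec(1)[OF u]]]
    L2_measurable[OF fourier_L2[OF L_spec(1)[OF v]]]
    L2_measurable[OF fourier_L2[OF H_L2[OF u]]] L2_measurable[OF fourier_L2[OF H_L2[OF v]]]
  have "complex_of_real (LINT x|lborel. L u x * v x)
      = (LINT \<xi>|lborel. of_real (lsym \<xi>) * fourier u \<xi> * cnj (fourier v \<xi>))"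
    unfolding parseval[OF L_spec(1)[OF u] H_L2[OF v]]
    by (rule integral_ae_cong) (use L_spec(2)[OF u] in \<open>auto simp: ae_eq_def\<close>)
  also have "\<dots> = complex_of_real (LINT x|lborel. u x * L v x)"
    unfolding parseval[OF H_L2[OF u] L_spec(1)[OF v]]
    by (rule integral_ae_cong) (use L_spec(2)[OF v] in \<open>auto simp: ae_eq_def elim!: eventually_mono\<close>)
  finally show ?thesis by (simp only: of_real_eq_iff)
qed

lemma nl_nonneg [simp]: "0 \<le> nl u"
  by (simp add: norm_l_def)

lemma nl_diff:
  assumes "u \<in> H" "v \<in> H" shows "nl (\<lambda>x. u x - v x) = norm2 (\<lambda>x. L u x - L v x)"
  using L2_diff[OF L_spec(1)[OF assms(1)] L_spec(1)[OF assms(2)]]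
    norm2_ae_cong[OF L_spec(1)[OF L_diff(1)[OF assms]] _ L_diff(2)[OF assms]]
  by (simp add: norm_l_def)

lemma nl_cmult:
  assumes "u \<in> H" shows "nl (\<lambda>x. c * u x) = \<bar>c\<bar> * nl u"
  using L2_cmult[OF L_spec(1)[OF assms], of c]
    norm2_ae_cong[OF L_spec(1)[OF L_cmult(1)[OF assms]] _ L_cmult(2)[OF assms], of c]
  by (simp add: norm_l_def)

lemma nl_cong:
  assumes u: "u \<in> H" and eq: "v =ae u" and v: "v \<in> borel_measurable borel"
  shows "nl v = nl u"
  using norm2_ae_cong[OF L_spec(1)[OF L_cong(1)[OF assms]] L_spec(1)[OF u] L_cong(2)[OF assms]]
  by (simp add: norm_l_def)

lemma zero_H: "(\<lambda>x. 0) \<in> H" "L (\<lambda>x. 0) =ae (\<lambda>x. 0)"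
proof -
  obtain u where u: "u \<in> H" using L_surjective[OF L2_zero] by blast
  show "(\<lambda>x. 0) \<in> H" "L (\<lambda>x. 0) =ae (\<lambda>x. 0)" using L_cmult[OF u, of 0] by simp_all
qed

lemma nl_eq_0:
  assumes u: "u \<in> H" "nl u = 0" shows "u =ae (\<lambda>x. 0)"
proof -
  have "L u =ae (\<lambda>x. 0)"
    using norm2_eq_0_iff[OF L_spec(1)[OF u(1)]] u(2) by (simp add: norm_l_def ae_eq_def)
  also have "(\<lambda>x. 0) =ae L (\<lambda>x. 0)" by (rule ae_eq_sym[OF zero_H(2)])
  finally show ?thesis by (rule L_injective[OF u(1) zero_H(1)])
qed

lemma norm2_le_nl:
  assumes u: "u \<in> H" shows "norm2 u \<le> inverse \<mu> * nl u"
proof -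
  have pt: "norm (fourier u \<xi>) \<le> inverse \<mu> * norm (of_real (lsym \<xi>) * fourier u \<xi>)" for \<xi>
  proof -
    have "\<mu> * norm (fourier u \<xi>) \<le> lsym \<xi> * norm (fourier u \<xi>)"
      using symbol_ge by (intro mult_right_mono) auto
    then show ?thesis using symbol_pos[of \<xi>] mu_pos by (simp add: norm_mult field_simps)
  qed
  have "norm2 (fourier u) \<le> inverse \<mu> * norm2 (\<lambda>\<xi>. of_real (lsym \<xi>) * fourier u \<xi>)"
    using mu_pos pt
    by (intro L2_dominated(2)[OF L2_measurable[OF fourier_L2[OF H_L2[OF u]]] symbol_fourier_L2[OF u]]) auto
  then show ?thesis
    using has_ft_isometric[OF has_ft_fourier[OF H_L2[OF u]]] has_ft_isometric[OF has_ft_L[OF u]]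
    by (simp add: L2_cx(2) norm_l_def)
qed

text \<open>
  The constant of the embedding into the bounded functions.
\<close>

definition sobolev_const :: real where "sobolev_const = norm2 (\<lambda>\<xi>. inverse (lsym \<xi>))"

lemma sobolev_const_nonneg [simp]: "0 \<le> sobolev_const" by (simp add: sobolev_const_def)

text \<open>
  Writing the transform of \<open>u\<close> as the inverse symbol times the transform of \<open>L u\<close>, the
  Cauchy-Schwarz inequality bounds its integral, which dominates \<open>u\<close>.
\<close>

lemma sup_le_nl:
  assumes u: "u \<in> H" shows "AE x in lborel. \<bar>u x\<bar> \<le> sobolev_const * nl u"
proof -
  note s = symbol_fourier_L2[OF u] and i = inverse_symbol_L2[OF mu_pos]
  note [measurable] = L2_measurable[OF fourier_L2[OF H_L2[OF u]]]
  have eq: "norm (inverse (lsym \<xi>)) * norm (of_real (lsym \<xi>) * fourier u \<xi>) = norm (fourier u \<xi>)" for \<xi>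
    using symbol_pos[of \<xi>] by (simp add: norm_mult)
  have int: "integrable lborel (fourier u)"
    using integrable_norm_mult_L2(1)[OF i s] unfolding eq by (simp add: integrable_norm_iff)
  have "(LINT \<xi>|lborel. norm (fourier u \<xi>)) \<le> sobolev_const * nl u"
    using integrable_norm_mult_L2(2)[OF i s] has_ft_isometric[OF has_ft_L[OF u]]
    unfolding eq by (simp add: sobolev_const_def norm_l_def L2_cx(2))
  then show ?thesis
    using has_ft_sup_bound[OF has_ft_fourier[OF H_L2[OF u]] int]
    by (auto elim!: eventually_mono)
qed

lemma H_reflect:
  assumes ab: "\<bar>a\<bar> = 1" "\<bar>b\<bar> = 1" and u: "u \<in> H"
  shows "(\<lambda>x. u (reflect a b x)) \<in> H" "L (\<lambda>x. u (reflect a b x)) =ae (\<lambda>x. L u (reflect a b x))"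
proof -
  have 1: "has_ft (cx (\<lambda>x. u (reflect a b x))) (\<lambda>\<xi>. fourier u (reflect a b \<xi>))"
    by (rule has_ft_reflect[OF ab has_ft_fourier[OF H_L2[OF u]]])
  have 2: "has_ft (cx (\<lambda>x. L u (reflect a b x))) (\<lambda>\<xi>. of_real (lsym \<xi>) * fourier u (reflect a b \<xi>))"
    using has_ft_reflect[OF ab has_ft_L[OF u]] by (simp add: symbol_reflect[OF ab])
  show "(\<lambda>x. u (reflect a b x)) \<in> H" "L (\<lambda>x. u (reflect a b x)) =ae (\<lambda>x. L u (reflect a b x))"
    using H_I[OF L2_reflect(1)[OF ab H_L2[OF u]] L2_reflect(1)[OF ab L_spec(1)[OF u]] 1 2] by auto
qed

end

lemma D2_symmetric_iff:
  "D2_symmetric u \<longleftrightarrow> (AE x in lborel. u (reflect (-1) 1 x) = u x) \<and> (AE x in lborel. u (reflect 1 (-1) x) = u x)"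
  by (simp add: D2_symmetric_def ae_eq_def reflect_def case_prod_beta' eq_commute)

lemma D2_symmetric_compose2:
  assumes "D2_symmetric u" "D2_symmetric v" shows "D2_symmetric (\<lambda>x. \<phi> (u x) (v x))"
proof -
  have u: "AE x in lborel. u (reflect (-1) 1 x) = u x" "AE x in lborel. u (reflect 1 (-1) x) = u x"
    and v: "AE x in lborel. v (reflect (-1) 1 x) = v x" "AE x in lborel. v (reflect 1 (-1) x) = v x"
    using assms by (auto simp: D2_symmetric_iff)
  show ?thesis
    unfolding D2_symmetric_iff
  proof
    show "AE x in lborel. \<phi> (u (reflect (-1) 1 x)) (v (reflect (-1) 1 x)) = \<phi> (u x) (v x)"
      using u(1) v(1) by eventually_elim simp
    show "AE x in lborel. \<phi> (u (reflect 1 (-1) x)) (v (reflect 1 (-1) x)) = \<phi> (u x) (v x)"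
      using u(2) v(2) by eventually_elim simp
  qed
qed

lemma D2_symmetric_cong:
  assumes u: "D2_symmetric u" and eq: "v =ae u" shows "D2_symmetric v"
  unfolding D2_symmetric_iff
proof
  have "AE x in lborel. v (reflect a b x) = v x"
    if ab: "\<bar>a\<bar> = 1" "\<bar>b\<bar> = 1" and "AE x in lborel. u (reflect a b x) = u x" for a b
    using AE_reflect[OF ab eq[unfolded ae_eq_def]] eq[unfolded ae_eq_def] that(3)
    by eventually_elim simp
  then show "AE x in lborel. v (reflect (-1) 1 x) = v x" "AE x in lborel. v (reflect 1 (-1) x) = v x"
    using u by (auto simp: D2_symmetric_iff)
qed

lemma D2_symmetric_limit:
  assumes f: "\<And>n. f n \<in> L2" "\<And>n. D2_symmetric (f n)" and g: "g \<in> L2"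
    and lim: "L2_lim f g"
  shows "D2_symmetric g"
proof -
  have "AE x in lborel. g (reflect a b x) = g x"
    if ab: "\<bar>a\<bar> = 1" "\<bar>b\<bar> = 1" and sy: "\<And>n. AE x in lborel. f n (reflect a b x) = f n x" for a b
  proof (rule L2_limit_unique[OF f(1) L2_reflect(1)[OF ab g] _ g lim])
    have "norm2 (\<lambda>x. f n x - g (reflect a b x)) = norm2 (\<lambda>x. f n x - g x)" for n
    proof -
      note [measurable] = L2_measurable[OF f(1)] L2_measurable[OF g]
      have "norm2 (\<lambda>x. f n x - g (reflect a b x)) = norm2 (\<lambda>x. f n (reflect a b x) - g (reflect a b x))"
        by (rule norm2_cong_AE) (simp_all, use sy[of n] in eventually_elim, simp)
      also have "\<dots> = norm2 (\<lambda>x. f n x - g x)" by (rule L2_reflect(2)[OF ab L2_diff(1)[OF f(1) g]])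
      finally show ?thesis .
    qed
    then show "(\<lambda>n. norm2 (\<lambda>x. f n x - g (reflect a b x))) \<longlonglongrightarrow> 0" using lim by simp
  qed
  then show ?thesis using f(2) by (simp add: D2_symmetric_iff)
qed

lemma L2_D2_D: "u \<in> L2_D2 \<Longrightarrow> u \<in> L2" "u \<in> L2_D2 \<Longrightarrow> D2_symmetric u"
  by (auto simp: L2_D2_def)

lemma L2_D2_add: "u \<in> L2_D2 \<Longrightarrow> v \<in> L2_D2 \<Longrightarrow> (\<lambda>x. u x + v x) \<in> L2_D2"
  by (simp add: L2_D2_def L2_add D2_symmetric_compose2)

lemma L2_D2_diff: "u \<in> L2_D2 \<Longrightarrow> v \<in> L2_D2 \<Longrightarrow> (\<lambda>x. u x - v x) \<in> L2_D2"
  by (simp add: L2_D2_def L2_diff D2_symmetric_compose2)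

lemma L2_D2_cmult: "u \<in> L2_D2 \<Longrightarrow> (\<lambda>x. c * u x) \<in> L2_D2"
  by (simp add: L2_D2_def L2_cmult D2_symmetric_compose2[of u u "\<lambda>a b. c * a"])

lemma L2_D2_cong:
  assumes u: "u \<in> L2_D2" and eq: "v =ae u" and v: "v \<in> borel_measurable borel"
  shows "v \<in> L2_D2"
  using L2_cong_AE[OF v L2_D2_D(1)[OF u] eq[unfolded ae_eq_def]] D2_symmetric_cong[OF L2_D2_D(2)[OF u] eq]
  by (simp add: L2_D2_def)

context swift_hohenberg
begin

text \<open>
  Because the symbol is invariant under the reflections, \<open>L\<close> commutes with them, and by injectivity
  \<open>u\<close> is symmetric if and only if \<open>L u\<close> is.
\<close>

lemma HD_iff: "u \<in> HD \<longleftrightarrow> u \<in> H \<and> L u \<in> L2_D2"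
proof
  assume "u \<in> HD"
  then have u: "u \<in> H" "D2_symmetric u" by (auto simp: Hl_D2_def)
  have "AE x in lborel. L u (reflect a b x) = L u x"
    if ab: "\<bar>a\<bar> = 1" "\<bar>b\<bar> = 1" and sy: "AE x in lborel. u (reflect a b x) = u x" for a b
  proof -
    have "(\<lambda>x. L u (reflect a b x)) =ae L (\<lambda>x. u (reflect a b x))"
      by (rule ae_eq_sym[OF H_reflect(2)[OF ab u(1)]])
    also have "\<dots> =ae L u"
      by (rule L_cong[OF u(1)]) (use sy L2_measurable[OF H_L2[OF u(1)]] in \<open>auto simp: ae_eq_def\<close>)
    finally show ?thesis by (simp add: ae_eq_def)
  qed
  then show "u \<in> H \<and> L u \<in> L2_D2"
    using u L_spec(1)[OF u(1)] by (auto simp: L2_D2_def D2_symmetric_iff)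
next
  assume "u \<in> H \<and> L u \<in> L2_D2"
  then have u: "u \<in> H" "D2_symmetric (L u)" by (auto simp: L2_D2_def)
  have "AE x in lborel. u (reflect a b x) = u x"
    if ab: "\<bar>a\<bar> = 1" "\<bar>b\<bar> = 1" and sy: "AE x in lborel. L u (reflect a b x) = L u x" for a b
  proof -
    have "L (\<lambda>x. u (reflect a b x)) =ae (\<lambda>x. L u (reflect a b x))" by (rule H_reflect(2)[OF ab u(1)])
    also have "\<dots> =ae L u" using sy by (simp add: ae_eq_def)
    finally have "(\<lambda>x. u (reflect a b x)) =ae u"
      by (rule L_injective[OF H_reflect(1)[OF ab u(1)] u(1)])
    then show ?thesis by (simp add: ae_eq_def)
  qed
  then show "u \<in> HD" using u by (auto simp: Hl_D2_def D2_symmetric_iff)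
qed

lemma HD_sym: "u \<in> HD \<Longrightarrow> D2_symmetric u"
  by (simp add: Hl_D2_def)

lemma HD_L2_D2: "u \<in> HD \<Longrightarrow> u \<in> L2_D2"
  by (simp add: L2_D2_def HD_sym H_L2 HD_H)

lemma HD_L: "u \<in> HD \<Longrightarrow> L u \<in> L2_D2"
  by (simp add: HD_iff)

lemma HD_add: "u \<in> HD \<Longrightarrow> v \<in> HD \<Longrightarrow> (\<lambda>x. u x + v x) \<in> HD"
  by (simp add: Hl_D2_def L_add D2_symmetric_compose2)

lemma HD_diff: "u \<in> HD \<Longrightarrow> v \<in> HD \<Longrightarrow> (\<lambda>x. u x - v x) \<in> HD"
  by (simp add: Hl_D2_def L_diff D2_symmetric_compose2)

lemma HD_cmult: "u \<in> HD \<Longrightarrow> (\<lambda>x. c * u x) \<in> HD"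
  by (simp add: Hl_D2_def L_cmult D2_symmetric_compose2[of u u "\<lambda>a b. c * a"])

lemma L_surjective_D2:
  assumes "w \<in> L2_D2" shows "\<exists>u\<in>HD. L u =ae w"
proof -
  obtain u where u: "u \<in> H" "L u =ae w" using L_surjective L2_D2_D(1)[OF assms] by blast
  then have "u \<in> HD"
    using L2_D2_cong[OF assms u(2)] L2_measurable[OF L_spec(1)[OF u(1)]] by (simp add: HD_iff)
  then show ?thesis using u by blast
qed

text \<open>
  The map \<open>L\<close> is an isometry onto \<open>L2_D2\<close>, which is complete.
\<close>

theorem HD_complete:
  assumes f: "\<And>n. f n \<in> HD"
    and Cauchy: "\<And>e. e > 0 \<Longrightarrow> \<exists>N. \<forall>m\<ge>N. \<forall>n\<ge>N. nl (\<lambda>x. f m x - f n x) < e"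
  shows "\<exists>g\<in>HD. (\<lambda>n. nl (\<lambda>x. f n x - g x)) \<longlonglongrightarrow> 0"
proof -
  note fL = L_spec(1)[OF HD_H[OF f]]
  have "\<exists>w\<in>L2. (\<lambda>n. norm2 (\<lambda>x. L (f n) x - w x)) \<longlonglongrightarrow> 0"
    using Cauchy by (intro L2_complete fL) (simp add: nl_diff HD_H f)
  then obtain w where w: "w \<in> L2" "(\<lambda>n. norm2 (\<lambda>x. L (f n) x - w x)) \<longlonglongrightarrow> 0" by blast
  have "w \<in> L2_D2"
    using D2_symmetric_limit[OF fL L2_D2_D(2)[OF HD_L[OF f]] w] w by (simp add: L2_D2_def)
  then obtain g where g: "g \<in> HD" "L g =ae w" using L_surjective_D2 by blast
  have "nl (\<lambda>x. f n x - g x) = norm2 (\<lambda>x. L (f n) x - w x)" for n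
    unfolding nl_diff[OF HD_H[OF f] HD_H[OF g(1)]]
    by (rule norm2_ae_cong[OF L2_diff(1)[OF fL L_spec(1)[OF HD_H[OF g(1)]]] L2_diff(1)[OF fL w(1)]])
       (rule ae_eq_compose2[OF ae_eq_refl g(2), where \<phi>="\<lambda>a b. a - b"])
  then have "(\<lambda>n. nl (\<lambda>x. f n x - g x)) \<longlonglongrightarrow> 0" using w(2) by presburger
  then show ?thesis using g(1) by blast
qed

end

section \<open>A contraction principle\<close>

text \<open>
  Functions that agree almost everywhere have distance zero, so the contraction principle is needed
  for a pseudometric; it then provides a point at distance zero from its image.
\<close>

lemma pseudometric_contraction:
  fixes d :: "'a \<Rightarrow> 'a \<Rightarrow> real"
  assumes ne: "x0 \<in> X" and map: "\<And>x. x \<in> X \<Longrightarrow> \<Phi> x \<in> X"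
    and nonneg: "\<And>x y. 0 \<le> d x y" and comm: "\<And>x y. d x y = d y x"
    and self: "\<And>x. x \<in> X \<Longrightarrow> d x x = 0"
    and tri: "\<And>x y z. x \<in> X \<Longrightarrow> y \<in> X \<Longrightarrow> z \<in> X \<Longrightarrow> d x z \<le> d x y + d y z"
    and q: "0 \<le> q" "q < 1"
    and contr: "\<And>x y. x \<in> X \<Longrightarrow> y \<in> X \<Longrightarrow> d (\<Phi> x) (\<Phi> y) \<le> q * d x y"
    and complete: "\<And>s :: nat \<Rightarrow> 'a. (\<And>n. s n \<in> X) \<Longrightarrow>
      (\<And>e. e > 0 \<Longrightarrow> \<exists>N. \<forall>m\<ge>N. \<forall>n\<ge>N. d (s m) (s n) < e) \<Longrightarrow> \<exists>x\<in>X. (\<lambda>n. d (s n) x) \<longlonglongrightarrow> 0"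
  shows "\<exists>x\<in>X. d (\<Phi> x) x = 0"
proof -
  define s where "s n = (\<Phi> ^^ n) x0" for n
  define D where "D = d x0 (\<Phi> x0)"
  have D0: "0 \<le> D" by (simp add: D_def nonneg)
  have sS: "s (Suc n) = \<Phi> (s n)" for n by (simp add: s_def)
  have sX: "s n \<in> X" for n by (induction n) (simp_all add: s_def ne map)
  have step: "d (s n) (s (Suc n)) \<le> q ^ n * D" for n
  proof (induction n)
    case (Suc n)
    have "d (s (Suc n)) (s (Suc (Suc n))) \<le> q * d (s n) (s (Suc n))"
      unfolding sS[of "Suc n"] using contr[OF sX sX, of n "Suc n"] by (simp add: sS)
    also have "\<dots> \<le> q * (q ^ n * D)" using Suc q by (intro mult_left_mono)
    finally show ?case by simp
  qed (simp add: s_def D_def)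
  have far: "d (s m) (s (m + k)) \<le> q ^ m * D * (\<Sum>i<k. q ^ i)" for m k
  proof (induction k)
    case (Suc k)
    have "d (s m) (s (m + Suc k)) \<le> d (s m) (s (m + k)) + d (s (m + k)) (s (Suc (m + k)))"
      using tri[OF sX sX sX] by simp
    also have "\<dots> \<le> q ^ m * D * (\<Sum>i<k. q ^ i) + q ^ (m + k) * D"
      by (intro add_mono Suc step)
    finally show ?case by (simp add: algebra_simps power_add)
  qed (simp add: self sX)
  have "(\<Sum>i<k. q ^ i) \<le> 1 / (1 - q)" for k
    using q by (simp add: sum_gp_strict divide_right_mono)
  then have far': "d (s m) (s (m + k)) \<le> q ^ m * D * (1 / (1 - q))" for m k
    using far[of m k] q D0 by (meson mult_left_mono mult_nonneg_nonneg order_trans zero_le_power)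
  have lim0: "(\<lambda>m. q ^ m * D * (1 / (1 - q))) \<longlonglongrightarrow> 0"
    using tendsto_mult[OF tendsto_mult[OF LIMSEQ_power_zero[of q] tendsto_const[of D]] tendsto_const[of "1 / (1 - q)"]]
      q by simp
  have "\<exists>x\<in>X. (\<lambda>n. d (s n) x) \<longlonglongrightarrow> 0"
  proof (rule complete[OF sX])
    fix e :: real assume "e > 0"
    then obtain N where N: "\<And>m. m \<ge> N \<Longrightarrow> q ^ m * D * (1 / (1 - q)) < e"
      using order_tendstoD(2)[OF lim0] by (auto simp: eventually_sequentially)
    have less: "d (s m) (s n) < e" if "m \<ge> N" "m \<le> n" for m n
      using far'[of m "n - m"] N[OF that(1)] that(2) by simp
    have "d (s m) (s n) < e" if "m \<ge> N" "n \<ge> N" for m n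
      using less[of m n] less[of n m] that comm[of "s m" "s n"] by (cases "m \<le> n") auto
    then show "\<exists>N. \<forall>m\<ge>N. \<forall>n\<ge>N. d (s m) (s n) < e" by blast
  qed
  then obtain x where x: "x \<in> X" "(\<lambda>n. d (s n) x) \<longlonglongrightarrow> 0" by blast
  have "d (\<Phi> x) x \<le> q * d (s n) x + d (s (Suc n)) x" for n
    using tri[OF map[OF x(1)] sX x(1), of "Suc n"] contr[OF sX x(1), of n] comm[of "\<Phi> x" "s (Suc n)"]
    by (simp add: sS)
  moreover have "(\<lambda>n. q * d (s n) x + d (s (Suc n)) x) \<longlonglongrightarrow> q * 0 + 0"
    using x(2) by (intro tendsto_intros LIMSEQ_Suc)
  ultimately have "d (\<Phi> x) x \<le> q * 0 + 0" by (intro LIMSEQ_le_const) auto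
  then show ?thesis using x(1) nonneg[of "\<Phi> x" x] by (auto intro!: bexI[of _ x] antisym)
qed

section \<open>The Swift-Hohenberg map and its derivative\<close>

lemma mult_bounded_L2:
  fixes V w :: "plane \<Rightarrow> real"
  assumes [measurable]: "V \<in> borel_measurable borel" and w: "w \<in> L2"
    and m: "0 \<le> m" "AE x in lborel. \<bar>V x\<bar> \<le> m"
  shows "(\<lambda>x. V x * w x) \<in> L2" "norm2 (\<lambda>x. V x * w x) \<le> m * norm2 w"
proof -
  note [measurable] = L2_measurable[OF w]
  have "AE x in lborel. norm (V x * w x) \<le> m * norm (w x)"
    using m(2) by eventually_elim (simp add: abs_mult mult_right_mono)
  then show "(\<lambda>x. V x * w x) \<in> L2" "norm2 (\<lambda>x. V x * w x) \<le> m * norm2 w"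
    using L2_dominated[OF _ w m(1), of "\<lambda>x. V x * w x"] by auto
qed

locale swift_hohenberg_nl = swift_hohenberg +
  fixes \<nu>\<^sub>1 \<nu>\<^sub>2 :: real
begin

abbreviation "F \<equiv> FF \<mu> \<nu>\<^sub>1 \<nu>\<^sub>2"
abbreviation "DF \<equiv> DFF \<mu> \<nu>\<^sub>1 \<nu>\<^sub>2"

text \<open>
  The derivative of the nonlinear term \<open>GG\<close>, as a function by which to multiply.
\<close>

definition V :: "(plane \<Rightarrow> real) \<Rightarrow> plane \<Rightarrow> real" where
  "V u x = 2 * \<nu>\<^sub>1 * u x + 3 * \<nu>\<^sub>2 * (u x)\<^sup>2"

text \<open>
  The derivative of \<open>F\<close> at \<open>u\<close> in closed form.
\<close>

definition J :: "(plane \<Rightarrow> real) \<Rightarrow> (plane \<Rightarrow> real) \<Rightarrow> plane \<Rightarrow> real" where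
  "J u h x = L h x + V u x * h x"

lemma HD_meas: "u \<in> HD \<Longrightarrow> u \<in> borel_measurable borel"
  by (rule L2_measurable[OF H_L2[OF HD_H]])

lemma V_meas: "u \<in> HD \<Longrightarrow> V u \<in> borel_measurable borel"
  unfolding V_def[abs_def] using HD_meas[of u] by measurable

lemma V_sym: "u \<in> HD \<Longrightarrow> D2_symmetric (V u)"
  unfolding V_def[abs_def]
  by (rule D2_symmetric_compose2[of u u "\<lambda>a b. 2 * \<nu>\<^sub>1 * a + 3 * \<nu>\<^sub>2 * b\<^sup>2"]) (simp_all add: HD_sym)

lemma quadratic_bounded:
  assumes u: "u \<in> HD"
  shows "\<exists>m\<ge>0. AE x in lborel. \<bar>\<alpha> * u x + \<beta> * (u x)\<^sup>2\<bar> \<le> m"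
proof (intro exI conjI)
  let ?c = "sobolev_const * nl u"
  show "0 \<le> \<bar>\<alpha>\<bar> * ?c + \<bar>\<beta>\<bar> * ?c\<^sup>2" by simp
  show "AE x in lborel. \<bar>\<alpha> * u x + \<beta> * (u x)\<^sup>2\<bar> \<le> \<bar>\<alpha>\<bar> * ?c + \<bar>\<beta>\<bar> * ?c\<^sup>2"
    using sup_le_nl[OF HD_H[OF u]]
  proof eventually_elim
    case (elim x)
    have "(u x)\<^sup>2 \<le> ?c\<^sup>2" using elim power_mono[of "\<bar>u x\<bar>" ?c 2] by simp
    have "\<bar>\<alpha> * u x + \<beta> * (u x)\<^sup>2\<bar> \<le> \<bar>\<alpha>\<bar> * \<bar>u x\<bar> + \<bar>\<beta>\<bar> * (u x)\<^sup>2"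
      by (rule order_trans[OF abs_triangle_ineq]) (simp add: abs_mult)
    also have "\<dots> \<le> \<bar>\<alpha>\<bar> * ?c + \<bar>\<beta>\<bar> * ?c\<^sup>2"
      using elim \<open>(u x)\<^sup>2 \<le> ?c\<^sup>2\<close> by (intro add_mono mult_left_mono) auto
    finally show ?case .
  qed
qed

lemma V_bounded: "u \<in> HD \<Longrightarrow> \<exists>m\<ge>0. AE x in lborel. \<bar>V u x\<bar> \<le> m"
  unfolding V_def by (rule quadratic_bounded)

lemma V_mult:
  assumes u: "u \<in> HD" and h: "h \<in> L2_D2"
  shows "(\<lambda>x. V u x * h x) \<in> L2_D2"
proof -
  obtain m where "0 \<le> m" "AE x in lborel. \<bar>V u x\<bar> \<le> m" using V_bounded[OF u] by blast
  from mult_bounded_L2(1)[OF V_meas[OF u] L2_D2_D(1)[OF h] this]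
  show ?thesis
    using D2_symmetric_compose2[OF V_sym[OF u] L2_D2_D(2)[OF h], of "(*)"] by (simp add: L2_D2_def)
qed

lemma J_L2_D2: "u \<in> HD \<Longrightarrow> h \<in> HD \<Longrightarrow> J u h \<in> L2_D2"
  unfolding J_def[abs_def] by (intro L2_D2_add V_mult HD_L HD_L2_D2)

lemma J_bounded:
  assumes u: "u \<in> HD"
  shows "\<exists>M>0. \<forall>h\<in>HD. norm2 (J u h) \<le> M * nl h"
proof -
  obtain m where m: "0 \<le> m" "AE x in lborel. \<bar>V u x\<bar> \<le> m" using V_bounded[OF u] by blast
  have "norm2 (J u h) \<le> (1 + m * inverse \<mu>) * nl h" if h: "h \<in> HD" for h
  proof -
    note hm = mult_bounded_L2[OF V_meas[OF u] L2_D2_D(1)[OF HD_L2_D2[OF h]] m]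
    have "norm2 (J u h) \<le> norm2 (L h) + norm2 (\<lambda>x. V u x * h x)"
      unfolding J_def[abs_def] by (rule L2_add(2)[OF L_spec(1)[OF HD_H[OF h]] hm(1)])
    also have "\<dots> \<le> nl h + m * norm2 h" using hm(2) by (simp add: norm_l_def)
    also have "\<dots> \<le> nl h + m * (inverse \<mu> * nl h)"
      using m norm2_le_nl[OF HD_H[OF h]] by (intro add_left_mono mult_left_mono)
    finally show ?thesis by (simp add: algebra_simps)
  qed
  moreover have "0 < 1 + m * inverse \<mu>" using m mu_pos by (simp add: add_pos_nonneg)
  ultimately show ?thesis by blast
qed

lemma J_cong: "h \<in> HD \<Longrightarrow> k \<in> HD \<Longrightarrow> h =ae k \<Longrightarrow> J u h =ae J u k"
  using L_cong(2)[OF HD_H[of k] _ HD_meas[of h]]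
  unfolding J_def[abs_def] ae_eq_def by (auto elim: eventually_elim2)

lemma J_add: "h \<in> HD \<Longrightarrow> k \<in> HD \<Longrightarrow> J u (\<lambda>x. h x + k x) =ae (\<lambda>x. J u h x + J u k x)"
  using L_add(2)[OF HD_H[of h] HD_H[of k]]
  unfolding J_def[abs_def] ae_eq_def by (auto elim!: eventually_mono simp: algebra_simps)

lemma J_cmult: "h \<in> HD \<Longrightarrow> J u (\<lambda>x. c * h x) =ae (\<lambda>x. c * J u h x)"
  using L_cmult(2)[OF HD_H[of h], of c]
  unfolding J_def[abs_def] ae_eq_def by (auto elim!: eventually_mono simp: algebra_simps)

lemma J_bounded_linear_op:
  assumes u: "u \<in> HD" shows "bounded_linear_op HD nl L2_D2 norm2 (J u)"
  unfolding bounded_linear_op_def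
  using J_L2_D2[OF u] J_cong J_add J_cmult J_bounded[OF u] by blast

lemma F_L2_D2:
  assumes u: "u \<in> HD" shows "F u \<in> L2_D2"
proof -
  note [measurable] = HD_meas[OF u] L2_measurable[OF L_spec(1)[OF HD_H[OF u]]]
  obtain m where "0 \<le> m" "AE x in lborel. \<bar>\<nu>\<^sub>1 * u x + \<nu>\<^sub>2 * (u x)\<^sup>2\<bar> \<le> m"
    using quadratic_bounded[OF u] by blast
  from mult_bounded_L2(1)[OF _ H_L2[OF HD_H[OF u]] this]
  have "(\<lambda>x. (\<nu>\<^sub>1 * u x + \<nu>\<^sub>2 * (u x)\<^sup>2) * u x) \<in> L2" by measurable
  then have "(\<lambda>x. L u x + (\<nu>\<^sub>1 * u x + \<nu>\<^sub>2 * (u x)\<^sup>2) * u x) \<in> L2"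
    by (rule L2_add(1)[OF L_spec(1)[OF HD_H[OF u]]])
  then have "F u \<in> L2"
    by (simp add: FF_def GG_def power3_eq_cube power2_eq_square algebra_simps)
  moreover have "D2_symmetric (F u)"
    unfolding FF_def GG_def
    by (rule D2_symmetric_compose2[of "L u" u "\<lambda>a b. a + (\<nu>\<^sub>1 * b\<^sup>2 + \<nu>\<^sub>2 * b ^ 3)"])
       (auto intro: L2_D2_D HD_L HD_sym u)
  ultimately show ?thesis by (simp add: L2_D2_def)
qed

lemma F_remainder:
  assumes u: "u \<in> HD" and h: "h \<in> HD"
  shows "(\<lambda>x. F (\<lambda>y. u y + h y) x - F u x - J u h x) =ae
    (\<lambda>x. (\<nu>\<^sub>1 + 3 * \<nu>\<^sub>2 * u x + \<nu>\<^sub>2 * h x) * h x * h x)"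
  using L_add(2)[OF HD_H[OF u] HD_H[OF h]] unfolding ae_eq_def
  by eventually_elim (simp add: FF_def GG_def J_def V_def power2_eq_square power3_eq_cube algebra_simps)

text \<open>
  The remainder is a bounded function times \<open>h * h\<close>. One factor \<open>h\<close> is estimated uniformly and the
  other one in the square norm.
\<close>

lemma F_has_derivative:
  assumes u: "u \<in> HD"
  shows "has_frechet_derivative_on HD nl L2_D2 norm2 F u (J u)"
  unfolding has_frechet_derivative_on_def
proof (intro conjI allI impI ballI F_L2_D2 J_bounded_linear_op[OF u])
  define R where "R = \<bar>\<nu>\<^sub>1\<bar> + 3 * \<bar>\<nu>\<^sub>2\<bar> * (sobolev_const * nl u) + \<bar>\<nu>\<^sub>2\<bar> * sobolev_const"
  define K where "K = R * sobolev_const * inverse \<mu>"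
  have R0: "0 \<le> R" by (simp add: R_def)
  have K0: "0 \<le> K" using R0 mu_pos by (simp add: K_def)
  have quad: "norm2 (\<lambda>x. F (\<lambda>y. u y + h y) x - F u x - J u h x) \<le> K * (nl h)\<^sup>2"
    if h: "h \<in> HD" and h1: "nl h \<le> 1" for h
  proof -
    note [measurable] = HD_meas[OF u] HD_meas[OF h]
    have b: "AE x in lborel. \<bar>(\<nu>\<^sub>1 + 3 * \<nu>\<^sub>2 * u x + \<nu>\<^sub>2 * h x) * h x\<bar> \<le> R * (sobolev_const * nl h)"
      using sup_le_nl[OF HD_H[OF u]] sup_le_nl[OF HD_H[OF h]]
    proof eventually_elim
      case (elim x)
      have "\<bar>h x\<bar> \<le> sobolev_const * 1" using elim(2) mult_left_mono[OF h1 sobolev_const_nonneg] by linarith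
      have "\<bar>\<nu>\<^sub>1 + 3 * \<nu>\<^sub>2 * u x + \<nu>\<^sub>2 * h x\<bar> \<le> \<bar>\<nu>\<^sub>1\<bar> + 3 * \<bar>\<nu>\<^sub>2\<bar> * \<bar>u x\<bar> + \<bar>\<nu>\<^sub>2\<bar> * \<bar>h x\<bar>"
        by (intro order_trans[OF abs_triangle_ineq] add_mono) (auto simp: abs_mult)
      also have "\<dots> \<le> R"
        unfolding R_def using elim \<open>\<bar>h x\<bar> \<le> sobolev_const * 1\<close> by (intro add_mono mult_left_mono) auto
      finally show ?case unfolding abs_mult using elim R0 by (intro mult_mono) auto
    qed
    note mb = mult_bounded_L2[OF _ H_L2[OF HD_H[OF h]] _ b]
    have "norm2 (\<lambda>x. F (\<lambda>y. u y + h y) x - F u x - J u h x)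
        = norm2 (\<lambda>x. (\<nu>\<^sub>1 + 3 * \<nu>\<^sub>2 * u x + \<nu>\<^sub>2 * h x) * h x * h x)"
      by (rule norm2_ae_cong[OF _ _ F_remainder[OF u h]])
        (use R0 mb(1) in \<open>auto intro!: L2_diff(1) L2_D2_D(1)[OF F_L2_D2] L2_D2_D(1)[OF J_L2_D2] HD_add u h\<close>)
    also have "\<dots> \<le> R * (sobolev_const * nl h) * norm2 h"
      using R0 by (intro mb(2)) auto
    also have "\<dots> \<le> R * (sobolev_const * nl h) * (inverse \<mu> * nl h)"
      using R0 norm2_le_nl[OF HD_H[OF h]] by (intro mult_left_mono) auto
    also have "\<dots> = K * (nl h)\<^sup>2" by (simp add: K_def power2_eq_square)
    finally show ?thesis .
  qed
  fix e :: real assume e: "e > 0"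
  show "\<exists>\<delta>>0. \<forall>h\<in>HD. nl h < \<delta> \<longrightarrow> norm2 (\<lambda>x. F (\<lambda>y. u y + h y) x - F u x - J u h x) \<le> e * nl h"
  proof (intro exI[of _ "min 1 (e / (K + 1))"] conjI ballI impI)
    show "0 < min 1 (e / (K + 1))" using e K0 by simp
    fix h assume h: "h \<in> HD" and small: "nl h < min 1 (e / (K + 1))"
    then have "nl h * (K + 1) \<le> e" using K0 by (simp add: field_simps)
    then have "nl h + K * nl h \<le> e" by (simp add: algebra_simps)
    then have "K * nl h \<le> e" using nl_nonneg[of h] by linarith
    then have "K * nl h * nl h \<le> e * nl h" by (intro mult_right_mono) auto
    then show "norm2 (\<lambda>x. F (\<lambda>y. u y + h y) x - F u x - J u h x) \<le> e * nl h"
      using quad[OF h] small by (simp add: power2_eq_square mult.assoc)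
  qed
qed

text \<open>
  The usual scaling argument, on representatives: apply both approximations to \<open>t * h\<close> for small
  \<open>t > 0\<close> and divide by \<open>t\<close>.
\<close>

lemma derivative_unique:
  assumes u: "u \<in> HD" and h: "h \<in> HD"
    and D: "has_frechet_derivative_on HD nl L2_D2 norm2 F u D"
    and E: "has_frechet_derivative_on HD nl L2_D2 norm2 F u E"
  shows "D h =ae E h"
proof -
  have DE: "\<And>g. g \<in> HD \<Longrightarrow> D g \<in> L2" "\<And>g. g \<in> HD \<Longrightarrow> E g \<in> L2"
    and Dc: "\<And>c. D (\<lambda>x. c * h x) =ae (\<lambda>x. c * D h x)" and Ec: "\<And>c. E (\<lambda>x. c * h x) =ae (\<lambda>x. c * E h x)"
    using D E h unfolding has_frechet_derivative_on_def bounded_linear_op_def by (auto dest: L2_D2_D)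
  have "norm2 (\<lambda>x. D h x - E h x) \<le> 2 * e * nl h" if e: "e > 0" for e
  proof -
    obtain d1 where d1: "d1 > 0" "\<And>k. k \<in> HD \<Longrightarrow> nl k < d1 \<Longrightarrow>
        norm2 (\<lambda>x. F (\<lambda>y. u y + k y) x - F u x - D k x) \<le> e * nl k"
      using D e unfolding has_frechet_derivative_on_def by blast
    obtain d2 where d2: "d2 > 0" "\<And>k. k \<in> HD \<Longrightarrow> nl k < d2 \<Longrightarrow>
        norm2 (\<lambda>x. F (\<lambda>y. u y + k y) x - F u x - E k x) \<le> e * nl k"
      using E e unfolding has_frechet_derivative_on_def by blast
    define t where "t = min d1 d2 / (nl h + 1)"
    have nh: "0 < nl h + 1" using nl_nonneg[of h] by linarith
    have t: "t > 0" using d1 d2 nh by (simp add: t_def)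
    define k where "k x = t * h x" for x
    have k: "k \<in> HD" unfolding k_def[abs_def] by (rule HD_cmult[OF h])
    have nk: "nl k = t * nl h" using t nl_cmult[OF HD_H[OF h], of t] by (simp add: k_def[abs_def])
    have "t * nl h < t * (nl h + 1)" using t by simp
    also have "\<dots> = min d1 d2" using nh by (simp add: t_def)
    finally have small: "nl k < d1" "nl k < d2" by (auto simp: nk)
    define G where "G x = F (\<lambda>y. u y + k y) x - F u x" for x
    have G: "G \<in> L2" unfolding G_def[abs_def] by (intro L2_diff L2_D2_D F_L2_D2 HD_add u k)
    have "norm2 (\<lambda>x. D k x - E k x) \<le> norm2 (\<lambda>x. D k x - G x) + norm2 (\<lambda>x. G x - E k x)"
      by (intro norm2_triangle_diff DE k G)
    also have "\<dots> \<le> e * nl k + e * nl k"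
      using d1(2)[OF k small(1)] d2(2)[OF k small(2)] norm2_diff_commute[of "D k" G]
      by (simp add: G_def)
    finally have 1: "norm2 (\<lambda>x. D k x - E k x) \<le> 2 * e * (t * nl h)" by (simp add: nk)
    have "(\<lambda>x. D k x - E k x) =ae (\<lambda>x. t * (D h x - E h x))"
      using Dc[of t] Ec[of t] unfolding k_def[abs_def] ae_eq_def by eventually_elim (simp add: algebra_simps)
    then have "norm2 (\<lambda>x. D k x - E k x) = norm2 (\<lambda>x. t * (D h x - E h x))"
      by (intro norm2_ae_cong L2_diff L2_cmult DE k h)
    also have "\<dots> = t * norm2 (\<lambda>x. D h x - E h x)"
      using t by (simp add: L2_cmult(2) L2_diff DE h)
    finally show ?thesis using 1 t by simp
  qed
  note close = this
  have "norm2 (\<lambda>x. D h x - E h x) \<le> 0 + e" if e: "e > 0" for e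
  proof -
    have nh: "0 < nl h + 1" using nl_nonneg[of h] by linarith
    have "norm2 (\<lambda>x. D h x - E h x) \<le> 2 * (e / (2 * (nl h + 1))) * nl h"
      using e nh by (intro close) simp
    also have "\<dots> = e * (nl h / (nl h + 1))" using nh by (simp add: field_simps)
    also have "\<dots> \<le> e * 1" using e nh by (intro mult_left_mono) auto
    finally show ?thesis by simp
  qed
  then have "norm2 (\<lambda>x. D h x - E h x) \<le> 0" by (rule field_le_epsilon)
  then have "norm2 (\<lambda>x. D h x - E h x) = 0" using norm2_nonneg by (rule antisym)
  then show ?thesis
    using norm2_eq_0_iff[OF L2_diff(1)[OF DE(1)[OF h] DE(2)[OF h]]] by (simp add: ae_eq_def)
qed

lemma DF_derivative:
  assumes u: "u \<in> HD" shows "has_frechet_derivative_on HD nl L2_D2 norm2 F u (DF u)"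
  unfolding DFF_def 
  by (rule someI[where P="has_frechet_derivative_on HD nl L2_D2 norm2 F u", OF F_has_derivative[OF u]])

lemma DF_eq: "u \<in> HD \<Longrightarrow> h \<in> HD \<Longrightarrow> DF u h =ae J u h"
  using derivative_unique DF_derivative F_has_derivative by blast

lemma DF_L2_D2: "u \<in> HD \<Longrightarrow> h \<in> HD \<Longrightarrow> DF u h \<in> L2_D2"
  using DF_derivative unfolding has_frechet_derivative_on_def bounded_linear_op_def by blast

end

section \<open>Surjectivity of the derivative\<close>

context swift_hohenberg
begin

definition Linv :: "(plane \<Rightarrow> real) \<Rightarrow> plane \<Rightarrow> real" where
  "Linv w = (SOME u. u \<in> HD \<and> L u =ae w)"

lemma Linv:
  assumes "w \<in> L2_D2" shows "Linv w \<in> HD" "L (Linv w) =ae w"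
proof -
  have "\<exists>u. u \<in> HD \<and> L u =ae w" using L_surjective_D2[OF assms] by blast
  then have "Linv w \<in> HD \<and> L (Linv w) =ae w"
    unfolding Linv_def by (rule someI_ex)
  then show "Linv w \<in> HD" "L (Linv w) =ae w" by auto
qed

lemma Linv_diff:
  assumes v: "v \<in> L2_D2" and w: "w \<in> L2_D2"
  shows "Linv (\<lambda>x. v x - w x) =ae (\<lambda>x. Linv v x - Linv w x)"
proof (rule L_injective)
  note vw = L2_D2_diff[OF v w]
  show "Linv (\<lambda>x. v x - w x) \<in> H" "(\<lambda>x. Linv v x - Linv w x) \<in> H"
    using Linv(1) v w vw HD_diff by (auto intro!: HD_H)
  have "L (Linv (\<lambda>x. v x - w x)) =ae (\<lambda>x. v x - w x)" by (rule Linv(2)[OF vw])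
  also have "\<dots> =ae (\<lambda>x. L (Linv v) x - L (Linv w) x)"
    by (rule ae_eq_sym[OF ae_eq_compose2[OF Linv(2)[OF v] Linv(2)[OF w], where \<phi>="\<lambda>a b. a - b"]])
  also have "\<dots> =ae L (\<lambda>x. Linv v x - Linv w x)"
    by (rule ae_eq_sym[OF L_diff(2)[OF HD_H[OF Linv(1)[OF v]] HD_H[OF Linv(1)[OF w]]]])
  finally show "L (Linv (\<lambda>x. v x - w x)) =ae L (\<lambda>x. Linv v x - Linv w x)" .
qed

lemma Linv_cong:
  assumes v: "v \<in> L2_D2" and w: "w \<in> L2_D2" and eq: "v =ae w"
  shows "Linv v =ae Linv w"
proof (rule L_injective[OF HD_H[OF Linv(1)[OF v]] HD_H[OF Linv(1)[OF w]]])
  show "L (Linv v) =ae L (Linv w)"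
    using Linv(2)[OF v] eq Linv(2)[OF w] by (meson ae_eq_trans ae_eq_sym)
qed

end

context swift_hohenberg_nl
begin

lemma J_diff:
  assumes h: "h \<in> HD" and k: "k \<in> HD"
  shows "J u (\<lambda>x. h x - k x) =ae (\<lambda>x. J u h x - J u k x)"
  using L_diff(2)[OF HD_H[OF h] HD_H[OF k]]
  unfolding J_def[abs_def] ae_eq_def by (auto elim!: eventually_mono simp: algebra_simps)

text \<open>
  The operator \<open>J\<close> is a perturbation of \<open>L\<close> by the bounded multiplication \<open>V\<close>. Its adjoint, for
  the inner products that belong to \<open>nl\<close> and \<open>norm2\<close>, sends \<open>z\<close> to \<open>G z = Linv (z + Linv (V z))\<close>;
  \<open>adj\<close> is the quadratic form of this identity. The adjoint is bounded below as well: for \<open>p = Linv (V z)\<close> one has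
  \<open>J p = V (z + p)\<close>, so the lower bound for \<open>J\<close> controls \<open>p\<close>, and hence \<open>z\<close>, by \<open>z + p\<close>.
  Therefore \<open>J G\<close> is symmetric, bounded and coercive, and \<open>x \<mapsto> x + t * (y - J (G x))\<close> is a
  contraction for small \<open>t > 0\<close>. Its fixed point solves \<open>J (G x) = y\<close>.
\<close>

lemma J_surjective:
  assumes u: "u \<in> HD" and c: "c > 0" "\<And>h. h \<in> HD \<Longrightarrow> c * nl h \<le> norm2 (J u h)"
    and y: "y \<in> L2_D2"
  shows "\<exists>h\<in>HD. J u h =ae y"
proof -
  obtain m where m: "0 \<le> m" "AE x in lborel. \<bar>V u x\<bar> \<le> m" using V_bounded[OF u] by blast
  obtain M0 where M0: "M0 > 0" "\<And>h. h \<in> HD \<Longrightarrow> norm2 (J u h) \<le> M0 * nl h" using J_bounded[OF u] by blast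
  define Vm where "Vm z = (\<lambda>x. V u x * z x)" for z :: "plane \<Rightarrow> real"
  define Bt where "Bt z = (\<lambda>x. z x + Linv (Vm z) x)" for z
  define G where "G z = Linv (Bt z)" for z
  have Vm: "Vm z \<in> L2_D2" if "z \<in> L2_D2" for z unfolding Vm_def by (rule V_mult[OF u that])
  have LV: "Linv (Vm z) \<in> HD" "L (Linv (Vm z)) =ae Vm z" if "z \<in> L2_D2" for z
    using Linv Vm[OF that] by auto
  have Bt: "Bt z \<in> L2_D2" if "z \<in> L2_D2" for z
    unfolding Bt_def by (intro L2_D2_add that HD_L2_D2 LV)
  have G: "G z \<in> HD" "L (G z) =ae Bt z" if "z \<in> L2_D2" for z
    unfolding G_def using Linv Bt[OF that] by auto
  have nG: "nl (G z) = norm2 (Bt z)" if z: "z \<in> L2_D2" for z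
    unfolding norm_l_def by (rule norm2_ae_cong[OF L_spec(1)[OF HD_H[OF G(1)[OF z]]] L2_D2_D(1)[OF Bt[OF z]] G(2)[OF z]])
  define c' where "c' = 1 / (1 + inverse \<mu> * (m / c))"
  have c'pos: "c' > 0" using m c mu_pos by (simp add: c'_def add_pos_nonneg)
  have lower: "c' * norm2 z \<le> nl (G z)" if z: "z \<in> L2_D2" for z
  proof -
    let ?p = "Linv (Vm z)"
    note p = LV[OF z]
    have "J u ?p =ae (\<lambda>x. V u x * Bt z x)"
      using p(2) unfolding ae_eq_def
      by eventually_elim (simp add: J_def Vm_def Bt_def algebra_simps)
    then have "norm2 (J u ?p) = norm2 (\<lambda>x. V u x * Bt z x)"
      by (intro norm2_ae_cong L2_D2_D(1)[OF J_L2_D2[OF u p(1)]] L2_D2_D(1)[OF V_mult[OF u Bt[OF z]]])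
    also have "\<dots> \<le> m * norm2 (Bt z)"
      by (rule mult_bounded_L2(2)[OF V_meas[OF u] L2_D2_D(1)[OF Bt[OF z]] m])
    finally have "c * nl ?p \<le> m * norm2 (Bt z)" using c(2)[OF p(1)] by linarith
    then have np: "nl ?p \<le> (m / c) * norm2 (Bt z)" using c by (simp add: field_simps)
    have "norm2 z = norm2 (\<lambda>x. Bt z x - ?p x)" by (simp add: Bt_def)
    also have "\<dots> \<le> norm2 (Bt z) + norm2 ?p"
      by (rule L2_diff(2)[OF L2_D2_D(1)[OF Bt[OF z]] H_L2[OF HD_H[OF p(1)]]])
    also have "norm2 ?p \<le> inverse \<mu> * nl ?p" by (rule norm2_le_nl[OF HD_H[OF p(1)]])
    also have "\<dots> \<le> inverse \<mu> * ((m / c) * norm2 (Bt z))" using mu_pos np by (intro mult_left_mono) auto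
    finally have "norm2 z \<le> (1 + inverse \<mu> * (m / c)) * norm2 (Bt z)" by (simp add: algebra_simps)
    then show ?thesis
      using m c mu_pos add_pos_nonneg[of 1 "inverse \<mu> * (m / c)"] by (simp add: c'_def nG[OF z] divide_le_eq mult.commute)
  qed
  have adj: "(LINT x|lborel. J u (G z) x * z x) = (nl (G z))\<^sup>2" if z: "z \<in> L2_D2" for z
  proof -
    note g = G[OF z] and p = LV[OF z]
    let ?p = "Linv (Vm z)"
    note L2s = L_spec(1)[OF HD_H[OF g(1)]] H_L2[OF HD_H[OF g(1)]] H_L2[OF HD_H[OF p(1)]]
      L2_D2_D(1)[OF z] L2_D2_D(1)[OF Vm[OF z]] L_spec(1)[OF HD_H[OF p(1)]] L2_D2_D(1)[OF Bt[OF z]]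
    note [measurable] = L2s[THEN L2_measurable]
    have "(LINT x|lborel. J u (G z) x * z x) = (LINT x|lborel. L (G z) x * z x + G z x * Vm z x)"
      by (intro Bochner_Integration.integral_cong refl) (simp add: J_def Vm_def algebra_simps)
    also have "\<dots> = (LINT x|lborel. L (G z) x * z x) + (LINT x|lborel. G z x * Vm z x)"
      by (intro Bochner_Integration.integral_add integrable_mult_L2 L2s)
    also have "(LINT x|lborel. G z x * Vm z x) = (LINT x|lborel. G z x * L ?p x)"
      by (rule integral_ae_cong) (use p(2) in \<open>auto simp: ae_eq_def\<close>)
    also have "\<dots> = (LINT x|lborel. L (G z) x * ?p x)"
      by (rule L_symmetric[OF HD_H[OF g(1)] HD_H[OF p(1)], symmetric])
    also have "(LINT x|lborel. L (G z) x * z x) + (LINT x|lborel. L (G z) x * ?p x)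
        = (LINT x|lborel. L (G z) x * Bt z x)"
      unfolding Bt_def distrib_left
      by (intro Bochner_Integration.integral_add[symmetric] integrable_mult_L2 L2s)
    also have "\<dots> = (LINT x|lborel. (L (G z) x)\<^sup>2)"
      by (rule integral_ae_cong) (use g(2) in \<open>auto simp: ae_eq_def power2_eq_square\<close>)
    also have "\<dots> = (nl (G z))\<^sup>2" by (simp add: norm_l_def norm2_squared)
    finally show ?thesis .
  qed
  \<comment> \<open>Taking \<open>M \<ge> c'\<close> ensures that the contraction factor \<open>q\<close> is the root of a nonnegative number.\<close>
  define M where "M = max M0 c'"
  have M: "M > 0" "c' \<le> M" using M0(1) by (auto simp: M_def)
  have JM: "norm2 (J u h) \<le> M * nl h" if "h \<in> HD" for h
    unfolding M_def by (rule order_trans[OF M0(2)[OF that] mult_right_mono[OF max.cobounded1 nl_nonneg]])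
  define t where "t = 1 / M\<^sup>2"
  have t: "t > 0" "t * M\<^sup>2 = 1" using M by (auto simp: t_def)
  define q where "q = sqrt (1 - t * c'\<^sup>2)"
  have tc: "t * c'\<^sup>2 \<le> 1"
    using M c'pos power_mono[of c' M 2] by (simp add: t_def)
  have q: "0 \<le> q" "q < 1" using tc t c'pos by (auto simp: q_def real_sqrt_lt_1_iff)
  have contr: "norm2 (\<lambda>x. z x - t * J u (G z) x) \<le> q * norm2 z" if z: "z \<in> L2_D2" for z
  proof -
    note zL = L2_D2_D(1)[OF z] and JL = L2_D2_D(1)[OF J_L2_D2[OF u G(1)[OF z]]]
    have ints: "integrable lborel (\<lambda>x. (z x)\<^sup>2)" "integrable lborel (\<lambda>x. (J u (G z) x)\<^sup>2)"
      "integrable lborel (\<lambda>x. J u (G z) x * z x)"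
      using L2_integrable[OF zL] L2_integrable[OF JL] integrable_mult_L2(1)[OF JL zL] by simp_all
    have "(norm2 (\<lambda>x. z x - t * J u (G z) x))\<^sup>2
        = (LINT x|lborel. (z x)\<^sup>2 - 2 * t * (J u (G z) x * z x) + t\<^sup>2 * (J u (G z) x)\<^sup>2)"
      unfolding norm2_squared
      by (intro Bochner_Integration.integral_cong refl) (simp add: power2_eq_square algebra_simps)
    also have "\<dots> = (norm2 z)\<^sup>2 - 2 * t * (nl (G z))\<^sup>2 + t\<^sup>2 * (norm2 (J u (G z)))\<^sup>2"
      using ints by (simp add: norm2_squared adj[OF z])
    also have "\<dots> \<le> (norm2 z)\<^sup>2 - 2 * t * (nl (G z))\<^sup>2 + t\<^sup>2 * (M * nl (G z))\<^sup>2"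
      using JM[OF G(1)[OF z]] by (intro add_left_mono mult_left_mono power_mono) auto
    also have "t\<^sup>2 * (M * nl (G z))\<^sup>2 = t * (t * M\<^sup>2) * (nl (G z))\<^sup>2" by (simp add: power2_eq_square)
    also have "\<dots> = t * (nl (G z))\<^sup>2" unfolding t(2) by simp
    finally have "(norm2 (\<lambda>x. z x - t * J u (G z) x))\<^sup>2 \<le> (norm2 z)\<^sup>2 - t * (nl (G z))\<^sup>2" by simp
    also have "t * (c' * norm2 z)\<^sup>2 \<le> t * (nl (G z))\<^sup>2"
      using t c'pos lower[OF z] by (intro mult_left_mono power_mono) auto
    then have "(norm2 z)\<^sup>2 - t * (nl (G z))\<^sup>2 \<le> (norm2 z)\<^sup>2 - t * (c' * norm2 z)\<^sup>2" by simp
    also have "\<dots> = (q * norm2 z)\<^sup>2"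
      using tc by (simp add: q_def power_mult_distrib algebra_simps)
    finally show ?thesis by (rule power2_le_imp_le) (use q in simp)
  qed
  define \<Psi> where "\<Psi> x = (\<lambda>s. x s + t * (y s - J u (G x) s))" for x
  have "\<exists>x\<in>L2_D2. norm2 (\<lambda>s. \<Psi> x s - x s) = 0"
  proof (rule pseudometric_contraction[where d="\<lambda>f g. norm2 (\<lambda>s. f s - g s)" and q=q and X=L2_D2, OF y])
    show "\<Psi> x \<in> L2_D2" if "x \<in> L2_D2" for x
      unfolding \<Psi>_def by (intro L2_D2_add L2_D2_cmult L2_D2_diff J_L2_D2 G u y that)
    show "norm2 (\<lambda>s. \<Psi> x s - \<Psi> z s) \<le> q * norm2 (\<lambda>s. x s - z s)" if x: "x \<in> L2_D2" and z: "z \<in> L2_D2" for x z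
    proof -
      note xz = L2_D2_diff[OF x z]
      have "Vm (\<lambda>s. x s - z s) = (\<lambda>s. Vm x s - Vm z s)" by (simp add: Vm_def algebra_simps)
      then have "Linv (Vm (\<lambda>s. x s - z s)) =ae (\<lambda>s. Linv (Vm x) s - Linv (Vm z) s)"
        using Linv_diff[OF Vm[OF x] Vm[OF z]] by simp
      then have "Bt (\<lambda>s. x s - z s) =ae (\<lambda>s. Bt x s - Bt z s)"
        unfolding ae_eq_def by eventually_elim (simp add: Bt_def)
      then have "G (\<lambda>s. x s - z s) =ae Linv (\<lambda>s. Bt x s - Bt z s)"
        unfolding G_def by (rule Linv_cong[OF Bt[OF xz] L2_D2_diff[OF Bt[OF x] Bt[OF z]]])
      also have "\<dots> =ae (\<lambda>s. G x s - G z s)"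
        unfolding G_def by (rule Linv_diff[OF Bt[OF x] Bt[OF z]])
      finally have "J u (G (\<lambda>s. x s - z s)) =ae J u (\<lambda>s. G x s - G z s)"
        by (intro J_cong G HD_diff x z xz)
      also have "\<dots> =ae (\<lambda>s. J u (G x) s - J u (G z) s)"
        by (rule J_diff[OF G(1)[OF x] G(1)[OF z]])
      finally have "(\<lambda>s. \<Psi> x s - \<Psi> z s) =ae (\<lambda>s. (x s - z s) - t * J u (G (\<lambda>s. x s - z s)) s)"
        unfolding ae_eq_def
      proof eventually_elim
        case (elim w)
        show ?case unfolding elim \<Psi>_def by (simp add: algebra_simps)
      qed
      then have "norm2 (\<lambda>s. \<Psi> x s - \<Psi> z s) = norm2 (\<lambda>s. (x s - z s) - t * J u (G (\<lambda>s. x s - z s)) s)"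
        unfolding \<Psi>_def
        by (intro norm2_ae_cong L2_D2_D(1) L2_D2_add L2_D2_cmult L2_D2_diff J_L2_D2 G u y x z)
      then show ?thesis using contr[OF xz] by simp
    qed
    show "\<exists>x\<in>L2_D2. L2_lim s x"
      if s: "\<And>n. s n \<in> L2_D2" and C: "\<And>e. e > 0 \<Longrightarrow> \<exists>N. \<forall>m\<ge>N. \<forall>n\<ge>N. norm2 (\<lambda>w. s m w - s n w) < e" for s
    proof -
      obtain g where g: "g \<in> L2" "L2_lim s g"
        using L2_complete[OF L2_D2_D(1)[OF s] C] by blast
      have "D2_symmetric g" by (rule D2_symmetric_limit[OF L2_D2_D(1)[OF s] L2_D2_D(2)[OF s] g])
      then show ?thesis using g by (auto simp: L2_D2_def)
    qed
  qed (use q in \<open>auto intro: norm2_diff_commute norm2_triangle_diff L2_D2_D(1)\<close>)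
  then obtain x where x: "x \<in> L2_D2" "norm2 (\<lambda>s. \<Psi> x s - x s) = 0" by blast
  have "(\<lambda>s. \<Psi> x s - x s) \<in> L2"
    unfolding \<Psi>_def by (intro L2_D2_D(1) L2_D2_add L2_D2_cmult L2_D2_diff J_L2_D2 G u y x)
  then have "AE s in lborel. \<Psi> x s - x s = 0" using x(2) norm2_eq_0_iff by blast
  then have "J u (G x) =ae y"
    unfolding ae_eq_def by eventually_elim (use t in \<open>simp add: \<Psi>_def\<close>)
  then show ?thesis using G(1)[OF x(1)] by blast
qed

end

section \<open>The Newton map\<close>

context swift_hohenberg_nl
begin

lemma nl_ae: "u \<in> HD \<Longrightarrow> v \<in> HD \<Longrightarrow> v =ae u \<Longrightarrow> nl v = nl u"
  by (rule nl_cong[OF HD_H _ HD_meas])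

lemma nl_triangle:
  assumes "u \<in> HD" "v \<in> HD" shows "nl (\<lambda>x. u x + v x) \<le> nl u + nl v"
proof -
  note H = HD_H[OF assms(1)] HD_H[OF assms(2)]
  show ?thesis
    using L2_add[OF L_spec(1)[OF H(1)] L_spec(1)[OF H(2)]]
      norm2_ae_cong[OF L_spec(1)[OF L_add(1)[OF H]] _ L_add(2)[OF H]] by (simp add: norm_l_def)
qed

lemma nl_diff_commute: "u \<in> HD \<Longrightarrow> v \<in> HD \<Longrightarrow> nl (\<lambda>x. u x - v x) = nl (\<lambda>x. v x - u x)"
  using nl_diff[of u v] nl_diff[of v u] norm2_diff_commute[of "L u" "L v"] by (simp add: HD_H)

lemma nl_minus: "u \<in> HD \<Longrightarrow> nl (\<lambda>x. - u x) = nl u"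
  using nl_cmult[of u "-1"] by (simp add: HD_H)

lemma nl_diff_le: "u \<in> HD \<Longrightarrow> v \<in> HD \<Longrightarrow> nl (\<lambda>x. u x - v x) \<le> nl u + nl v"
  using nl_triangle[of u "\<lambda>x. - v x"] nl_minus[of v] HD_cmult[of v "-1"] by simp

lemma nl_zero: "nl (\<lambda>x. 0) = 0"
  using nl_cmult[OF zero_H(1), of 0] by simp

text \<open>
  A point at distance exactly \<open>r\<close> is approximated by moving it slightly towards the center.
\<close>

lemma closed_ball_eq:
  assumes u: "u \<in> HD" and r: "r > 0"
  shows "closure_l \<mu> (ball_l \<mu> u r) = {v \<in> HD. nl (\<lambda>x. v x - u x) \<le> r}"
proof (intro equalityI subsetI)
  fix v assume "v \<in> closure_l \<mu> (ball_l \<mu> u r)"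
  then have v: "v \<in> HD" and cl: "\<And>e. e > 0 \<Longrightarrow> \<exists>w\<in>ball_l \<mu> u r. nl (\<lambda>x. v x - w x) < e"
    by (auto simp: closure_l_def)
  have "nl (\<lambda>x. v x - u x) \<le> r + e" if e: "e > 0" for e
  proof -
    obtain w where w: "w \<in> HD" "nl (\<lambda>x. w x - u x) < r" "nl (\<lambda>x. v x - w x) < e"
      using cl[OF e] by (auto simp: ball_l_def)
    then show ?thesis
      using nl_triangle[OF HD_diff[OF v w(1)] HD_diff[OF w(1) u]] by simp
  qed
  then have "nl (\<lambda>x. v x - u x) \<le> r" by (rule field_le_epsilon)
  then show "v \<in> {v \<in> HD. nl (\<lambda>x. v x - u x) \<le> r}" using v by simp
next
  fix v assume "v \<in> {v \<in> HD. nl (\<lambda>x. v x - u x) \<le> r}"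
  then have v: "v \<in> HD" and le: "nl (\<lambda>x. v x - u x) \<le> r" by auto
  define k where "k x = v x - u x" for x
  have k: "k \<in> HD" unfolding k_def[abs_def] by (rule HD_diff[OF v u])
  have nk: "nl k \<le> r" using le by (simp add: k_def[abs_def])
  show "v \<in> closure_l \<mu> (ball_l \<mu> u r)"
    unfolding closure_l_def
  proof (intro CollectI conjI v allI impI)
    fix e :: real assume e: "e > 0"
    \<comment> \<open>The point \<open>u + (1 - s) * (v - u)\<close> has distance less than \<open>r\<close> from \<open>u\<close> and less than \<open>e\<close> from \<open>v\<close>.\<close>
    define s where "s = min 1 (e / (2 * r))"
    have s: "0 < s" "s \<le> 1" "s * r < e"
      using e r by (auto simp: s_def min_def field_simps)
    define w where "w x = u x + (1 - s) * k x" for x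
    have w: "w \<in> HD" unfolding w_def[abs_def] by (intro HD_add HD_cmult u k)
    have "nl (\<lambda>x. w x - u x) = (1 - s) * nl k"
      using nl_cmult[OF HD_H[OF k], of "1 - s"] s by (simp add: w_def)
    also have "\<dots> \<le> (1 - s) * r" using s nk by (intro mult_left_mono) auto
    also have "\<dots> < r" using s r by simp
    finally have 1: "nl (\<lambda>x. w x - u x) < r" .
    have "v x - w x = s * k x" for x by (simp add: w_def k_def algebra_simps)
    then have "nl (\<lambda>x. v x - w x) = s * nl k"
      using nl_cmult[OF HD_H[OF k], of s] s by simp
    also have "\<dots> \<le> s * r" using s nk by (intro mult_left_mono) auto
    finally show "\<exists>w\<in>ball_l \<mu> u r. nl (\<lambda>x. v x - w x) < e"
      using w 1 s(3) by (auto simp: ball_l_def intro!: bexI[of _ w])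
  qed
qed

text \<open>
  The a priori bound \<open>C\<close> matters, since the supremum in \<open>onorm_l\<close> is meaningful only for a set that
  is bounded above.
\<close>

lemma onorm_l_bound:
  assumes C: "\<And>h. h \<in> HD \<Longrightarrow> nl (T h) \<le> C * nl h" and h: "h \<in> HD"
  shows "nl (T h) \<le> onorm_l \<mu> T * nl h"
proof (cases "nl h = 0")
  case True
  then show ?thesis using C[OF h] by simp
next
  case False
  then have pos: "nl h > 0" using nl_nonneg[of h] by linarith
  have "bdd_above ((\<lambda>h. nl (T h) / nl h) ` HD)"
  proof (rule bdd_aboveI2)
    fix k assume k: "k \<in> HD"
    show "nl (T k) / nl k \<le> \<bar>C\<bar>"
    proof (cases "nl k = 0")
      case False
      then have "nl k > 0" using nl_nonneg[of k] by linarith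
      then have "nl (T k) / nl k \<le> C" using C[OF k] by (simp add: divide_le_eq)
      then show ?thesis by linarith
    qed simp
  qed
  then have "nl (T h) / nl h \<le> onorm_l \<mu> T"
    unfolding onorm_l_def using h by (intro cSUP_upper) auto
  then show ?thesis using pos by (simp add: divide_le_eq)
qed

text \<open>
  The change of the derivative, \<open>J (u + w) h - J u h\<close>, in which the unbounded part \<open>L h\<close> has
  cancelled.
\<close>

definition J_shift :: "(plane \<Rightarrow> real) \<Rightarrow> (plane \<Rightarrow> real) \<Rightarrow> (plane \<Rightarrow> real) \<Rightarrow> plane \<Rightarrow> real" where
  "J_shift u w h x = (V (\<lambda>s. u s + w s) x - V u x) * h x"

lemma J_shift_eq: "J_shift u w h = (\<lambda>x. J (\<lambda>s. u s + w s) h x - J u h x)"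
  by (simp add: J_shift_def[abs_def] J_def left_diff_distrib)

lemma J_shift_L2_D2: "u \<in> HD \<Longrightarrow> w \<in> HD \<Longrightarrow> h \<in> HD \<Longrightarrow> J_shift u w h \<in> L2_D2"
  unfolding J_shift_eq by (intro L2_D2_diff J_L2_D2 HD_add)

text \<open>
  Along the segment from \<open>u + w\<close> to \<open>u + v\<close> the derivative is a polynomial of degree at most two
  in the parameter, so Simpson's rule integrates it exactly. Its weights are positive with sum \<open>1\<close>, and its
  nodes stay in a ball that contains \<open>v\<close> and \<open>w\<close>.
\<close>

lemma F_increment_Simpson:
  assumes u: "u \<in> HD" and v: "v \<in> HD" and w: "w \<in> HD"
  shows "(\<lambda>x. F (\<lambda>s. u s + v s) x - F (\<lambda>s. u s + w s) x) =ae
    (\<lambda>x. J u (\<lambda>s. v s - w s) x + (1/6 * J_shift u v (\<lambda>s. v s - w s) x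
      + (4/6 * J_shift u (\<lambda>s. 1/2 * (v s + w s)) (\<lambda>s. v s - w s) x + 1/6 * J_shift u w (\<lambda>s. v s - w s) x)))"
  using L_add(2)[OF HD_H[OF u] HD_H[OF v]] L_add(2)[OF HD_H[OF u] HD_H[OF w]] L_diff(2)[OF HD_H[OF v] HD_H[OF w]]
  unfolding ae_eq_def
proof eventually_elim
  case (elim x)
  show ?case
    unfolding FF_def GG_def J_def J_shift_def V_def elim
    by (simp add: power2_eq_square power3_eq_cube field_simps)
qed

text \<open>
  Write \<open>J_shift u (s * w) w\<close> as \<open>s * \<alpha> + s\<^sup>2 * \<beta>\<close>. Its integral over \<open>0 \<le> s \<le> 1\<close> is
  \<open>\<alpha> / 2 + \<beta> / 3\<close>, and the values at \<open>w\<close> and \<open>-w\<close> are \<open>\<alpha> + \<beta>\<close> and \<open>\<beta> - \<alpha>\<close>; solving for the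
  weights gives \<open>5/12\<close> and \<open>-1/12\<close>. What matters is that their absolute values add up to \<open>1/2\<close>.
\<close>

lemma F_increment_center:
  assumes u: "u \<in> HD" and w: "w \<in> HD"
  shows "(\<lambda>x. F (\<lambda>s. u s + w s) x - F u x) =ae
    (\<lambda>x. J u w x + (5/12 * J_shift u w w x + -1/12 * J_shift u (\<lambda>s. -1 * w s) w x))"
  using L_add(2)[OF HD_H[OF u] HD_H[OF w]]
  unfolding ae_eq_def
proof eventually_elim
  case (elim x)
  show ?case
    unfolding FF_def GG_def J_def J_shift_def V_def elim
    by (simp add: power2_eq_square power3_eq_cube field_simps)
qed

end

locale bounded_operator = swift_hohenberg_nl +
  fixes A :: "(plane \<Rightarrow> real) \<Rightarrow> plane \<Rightarrow> real"
  assumes A: "bounded_linear_op L2_D2 norm2 HD nl A"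
begin

lemma A_HD: "f \<in> L2_D2 \<Longrightarrow> A f \<in> HD"
  using A by (simp add: bounded_linear_op_def)

lemma A_cong: "f \<in> L2_D2 \<Longrightarrow> g \<in> L2_D2 \<Longrightarrow> f =ae g \<Longrightarrow> A f =ae A g"
  using A by (simp add: bounded_linear_op_def)

lemma A_add: "f \<in> L2_D2 \<Longrightarrow> g \<in> L2_D2 \<Longrightarrow> A (\<lambda>x. f x + g x) =ae (\<lambda>x. A f x + A g x)"
  using A by (simp add: bounded_linear_op_def)

lemma A_cmult: "f \<in> L2_D2 \<Longrightarrow> A (\<lambda>x. c * f x) =ae (\<lambda>x. c * A f x)"
  using A by (simp add: bounded_linear_op_def)

lemma A_bound: "\<exists>K>0. \<forall>f\<in>L2_D2. nl (A f) \<le> K * norm2 f"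
proof -
  obtain K where K: "\<And>f. f \<in> L2_D2 \<Longrightarrow> nl (A f) \<le> K * norm2 f"
    using A unfolding bounded_linear_op_def by blast
  have "nl (A f) \<le> max K 1 * norm2 f" if "f \<in> L2_D2" for f
    by (rule order_trans[OF K[OF that] mult_right_mono[OF max.cobounded1 norm2_nonneg]])
  then show ?thesis by (intro exI[of _ "max K 1"]) auto
qed

lemma A_diff:
  assumes f: "f \<in> L2_D2" and g: "g \<in> L2_D2"
  shows "A (\<lambda>x. f x - g x) =ae (\<lambda>x. A f x - A g x)"
  using A_add[OF f L2_D2_cmult[OF g, of "-1"]] A_cmult[OF g, of "-1"]
  unfolding ae_eq_def by (simp, eventually_elim, simp)

lemma nlA_cong: "f \<in> L2_D2 \<Longrightarrow> g \<in> L2_D2 \<Longrightarrow> f =ae g \<Longrightarrow> nl (A f) = nl (A g)"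
  by (rule nl_ae[OF A_HD A_HD A_cong])

lemma nlA_add:
  assumes f: "f \<in> L2_D2" and g: "g \<in> L2_D2"
  shows "nl (A (\<lambda>x. f x + g x)) \<le> nl (A f) + nl (A g)"
  using nl_ae[OF HD_add[OF A_HD[OF f] A_HD[OF g]] A_HD[OF L2_D2_add[OF f g]] A_add[OF f g]]
    nl_triangle[OF A_HD[OF f] A_HD[OF g]] by simp

lemma nlA_cmult:
  assumes f: "f \<in> L2_D2"
  shows "nl (A (\<lambda>x. c * f x)) = \<bar>c\<bar> * nl (A f)"
  using nl_ae[OF HD_cmult[OF A_HD[OF f]] A_HD[OF L2_D2_cmult[OF f]] A_cmult[OF f], of c]
    nl_cmult[OF HD_H[OF A_HD[OF f]], of c] by simp

lemma nlA_null:
  assumes f: "f \<in> L2_D2" "f =ae (\<lambda>x. 0)" shows "nl (A f) = 0"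
  using nlA_cong[OF f(1) L2_D2_cmult[OF f(1), of 0]] nlA_cmult[OF f(1), of 0] f(2) by simp

lemma nlA_lincomb:
  assumes f: "f \<in> L2_D2" and g: "g \<in> L2_D2"
  shows "nl (A (\<lambda>x. \<alpha> * f x + \<beta> * g x)) \<le> \<bar>\<alpha>\<bar> * nl (A f) + \<bar>\<beta>\<bar> * nl (A g)"
  using nlA_add[OF L2_D2_cmult[OF f, of \<alpha>] L2_D2_cmult[OF g, of \<beta>]]
  by (simp add: nlA_cmult f g)

lemma A_DF_bound:
  assumes v: "v \<in> HD" shows "\<exists>C. \<forall>h\<in>HD. nl (A (DF v h)) \<le> C * nl h"
proof -
  obtain K where K: "K > 0" "\<And>f. f \<in> L2_D2 \<Longrightarrow> nl (A f) \<le> K * norm2 f" using A_bound by blast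
  obtain M where M: "\<And>h. h \<in> HD \<Longrightarrow> norm2 (J v h) \<le> M * nl h" using J_bounded[OF v] by blast
  have "nl (A (DF v h)) \<le> K * M * nl h" if h: "h \<in> HD" for h
  proof -
    note D = DF_L2_D2[OF v h] and Jh = J_L2_D2[OF v h]
    have "nl (A (DF v h)) \<le> K * norm2 (J v h)"
      using K(2)[OF D] norm2_ae_cong[OF L2_D2_D(1)[OF D] L2_D2_D(1)[OF Jh] DF_eq[OF v h]] by simp
    also have "\<dots> \<le> K * (M * nl h)" using K(1) M[OF h] by (intro mult_left_mono) auto
    finally show ?thesis by simp
  qed
  then show ?thesis by blast
qed

lemma onorm_l_defect:
  assumes u: "u \<in> HD" and h: "h \<in> HD"
  shows "nl (\<lambda>x. h x - A (J u h) x) \<le> onorm_l \<mu> (\<lambda>k x. k x - A (DF u k) x) * nl h"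
proof -
  obtain C where C: "\<And>k. k \<in> HD \<Longrightarrow> nl (A (DF u k)) \<le> C * nl k" using A_DF_bound[OF u] by blast
  have "nl (\<lambda>x. k x - A (DF u k) x) \<le> (1 + C) * nl k" if k: "k \<in> HD" for k
    using nl_diff_le[OF k A_HD[OF DF_L2_D2[OF u k]]] C[OF k] by (simp add: distrib_right)
  note le = onorm_l_bound[of "\<lambda>k x. k x - A (DF u k) x", OF this h]
  have "A (J u h) =ae A (DF u h)"
    by (rule A_cong[OF J_L2_D2[OF u h] DF_L2_D2[OF u h] ae_eq_sym[OF DF_eq[OF u h]]])
  then have "(\<lambda>x. h x - A (J u h) x) =ae (\<lambda>x. h x - A (DF u h) x)"
    by (rule ae_eq_compose2[OF ae_eq_refl, where \<phi>="\<lambda>a b. a - b"])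
  then have "nl (\<lambda>x. h x - A (J u h) x) = nl (\<lambda>x. h x - A (DF u h) x)"
    by (intro nl_ae HD_diff A_HD J_L2_D2 DF_L2_D2 u h)
  then show ?thesis using le by simp
qed

text \<open>
  Combines the choice of the derivative in \<open>DFF\<close> with the closed form; the bounds on the
  derivatives make the supremum in \<open>onorm_l\<close> a bound.
\<close>

lemma onorm_l_shift:
  assumes u: "u \<in> HD" and w: "w \<in> HD" and h: "h \<in> HD"
  shows "nl (A (J_shift u w h)) \<le>
    onorm_l \<mu> (\<lambda>k. A (\<lambda>x. DF (\<lambda>s. u s + w s) k x - DF u k x)) * nl h"
proof -
  let ?v = "\<lambda>s. u s + w s"
  let ?D = "\<lambda>k x. DF ?v k x - DF u k x"
  note v = HD_add[OF u w]
  obtain C where C: "\<And>k. k \<in> HD \<Longrightarrow> nl (A (DF u k)) \<le> C * nl k" using A_DF_bound[OF u] by blast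
  obtain C' where C': "\<And>k. k \<in> HD \<Longrightarrow> nl (A (DF ?v k)) \<le> C' * nl k" using A_DF_bound[OF v] by blast
  have "nl (A (?D k)) \<le> (C' + C) * nl k" if k: "k \<in> HD" for k
    using nlA_lincomb[OF DF_L2_D2[OF v k] DF_L2_D2[OF u k], of 1 "-1"] C[OF k] C'[OF k]
    by (simp add: distrib_right)
  note le = onorm_l_bound[of "\<lambda>k. A (?D k)", OF this h]
  have "J_shift u w h =ae ?D h"
    unfolding J_shift_eq
    by (rule ae_eq_compose2[OF ae_eq_sym[OF DF_eq[OF v h]] ae_eq_sym[OF DF_eq[OF u h]],
          where \<phi>="\<lambda>a b. a - b"])
  then have "nl (A (J_shift u w h)) = nl (A (?D h))"
    by (intro nlA_cong L2_D2_diff DF_L2_D2 J_shift_L2_D2 v u w h)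
  then show ?thesis using le by simp
qed

end

locale approx_inverse = bounded_operator +
  fixes u0 :: "plane \<Rightarrow> real" and z1 :: real
  assumes u0: "u0 \<in> HD"
    and z1: "z1 < 1"
    and AJ: "h \<in> HD \<Longrightarrow> nl (\<lambda>x. h x - A (J u0 h) x) \<le> z1 * nl h"
begin

text \<open>
  This makes \<open>J u0\<close> bounded below, because \<open>A\<close> is bounded.
\<close>

lemma J_lower:
  assumes h: "h \<in> HD" shows "(1 - z1) * nl h \<le> nl (A (J u0 h))"
proof -
  have "nl h \<le> nl (\<lambda>x. h x - A (J u0 h) x) + nl (A (J u0 h))"
    using nl_triangle[OF HD_diff[OF h A_HD[OF J_L2_D2[OF u0 h]]] A_HD[OF J_L2_D2[OF u0 h]]] by simp
  then show ?thesis using AJ[OF h] by (simp add: left_diff_distrib)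
qed

text \<open>
  Since \<open>J u0\<close> is onto, \<open>f\<close> can be written as \<open>J u0 h\<close>, and \<open>A (J u0 h) = 0\<close> forces \<open>h = 0\<close>.
\<close>

theorem A_injective:
  assumes f: "f \<in> L2_D2" and 0: "nl (A f) = 0"
  shows "f =ae (\<lambda>x. 0)"
proof -
  obtain K where K: "K > 0" "\<And>f. f \<in> L2_D2 \<Longrightarrow> nl (A f) \<le> K * norm2 f" using A_bound by blast
  obtain M where M: "\<And>h. h \<in> HD \<Longrightarrow> norm2 (J u0 h) \<le> M * nl h" using J_bounded[OF u0] by blast
  have "(1 - z1) / K * nl h \<le> norm2 (J u0 h)" if h: "h \<in> HD" for h
    using order_trans[OF J_lower[OF h] K(2)[OF J_L2_D2[OF u0 h]]] K(1) by (simp add: field_simps)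
  then obtain h where h: "h \<in> HD" "J u0 h =ae f"
    using J_surjective[OF u0 _ _ f, of "(1 - z1) / K"] z1 K(1) by auto
  have "(1 - z1) * nl h \<le> 0"
    using J_lower[OF h(1)] nlA_cong[OF J_L2_D2[OF u0 h(1)] f h(2)] 0 by simp
  then have "nl h = 0" using z1 nl_nonneg[of h] by (simp add: mult_le_0_iff)
  then have "norm2 (J u0 h) = 0" using M[OF h(1)] norm2_nonneg[of "J u0 h"] by simp
  then have "J u0 h =ae (\<lambda>x. 0)"
    using norm2_eq_0_iff[OF L2_D2_D(1)[OF J_L2_D2[OF u0 h(1)]]] by (simp add: ae_eq_def)
  then show ?thesis using h(2) ae_eq_sym ae_eq_trans by blast
qed

definition newton :: "(plane \<Rightarrow> real) \<Rightarrow> plane \<Rightarrow> real" where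
  "newton u x = u x - A (F u) x"

lemma newton_HD: "u \<in> HD \<Longrightarrow> newton u \<in> HD"
  unfolding newton_def[abs_def] by (intro HD_diff A_HD F_L2_D2)

text \<open>
  Here \<open>N\<close> is the part of the increment of \<open>F\<close> that the derivative at \<open>u0\<close> misses.
\<close>

lemma newton_difference:
  assumes u: "u \<in> HD" and v: "v \<in> HD" and h: "h \<in> HD" and N: "N \<in> L2_D2"
    and uv: "(\<lambda>x. u x - v x) = h"
    and eq: "(\<lambda>x. F u x - F v x) =ae (\<lambda>x. J u0 h x + N x)"
  shows "nl (\<lambda>x. newton u x - newton v x) \<le> z1 * nl h + nl (A N)"
proof -
  note Jh = J_L2_D2[OF u0 h] and Fu = F_L2_D2[OF u] and Fv = F_L2_D2[OF v]
  have "(\<lambda>x. A (F u) x - A (F v) x) =ae A (\<lambda>x. F u x - F v x)"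
    by (rule ae_eq_sym[OF A_diff[OF Fu Fv]])
  also have "\<dots> =ae A (\<lambda>x. J u0 h x + N x)"
    by (rule A_cong[OF L2_D2_diff[OF Fu Fv] L2_D2_add[OF Jh N] eq])
  also have "\<dots> =ae (\<lambda>x. A (J u0 h) x + A N x)" by (rule A_add[OF Jh N])
  finally have "(\<lambda>x. newton u x - newton v x) =ae (\<lambda>x. (h x - A (J u0 h) x) - A N x)"
    unfolding ae_eq_def using fun_cong[OF uv]
    by (auto simp: newton_def elim!: eventually_mono) (simp add: algebra_simps)
  then have "nl (\<lambda>x. newton u x - newton v x) = nl (\<lambda>x. (h x - A (J u0 h) x) - A N x)"
    by (intro nl_ae HD_diff newton_HD A_HD u v h Jh N)
  also have "\<dots> \<le> nl (\<lambda>x. h x - A (J u0 h) x) + nl (A N)"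
    by (intro nl_diff_le HD_diff A_HD h Jh N)
  finally show ?thesis using AJ[OF h] by simp
qed

text \<open>
  The bound \<open>z2\<close> is applied only at the nodes of the two quadrature rules, all of which lie in the
  ball. Every zero of \<open>F\<close> in the ball is a fixed point of \<open>newton\<close>, and \<open>A_injective\<close> gives the
  converse.
\<close>

theorem newton_kantorovich:
  assumes r: "r > 0"
    and y0: "nl (A (F u0)) \<le> y0"
    and z2: "\<And>w h. w \<in> HD \<Longrightarrow> h \<in> HD \<Longrightarrow> nl w \<le> r \<Longrightarrow> nl (A (J_shift u0 w h)) \<le> z2 * r * nl h"
    and nonneg: "0 \<le> z1" "0 \<le> z2"
    and selfmap: "1/2 * z2 * r\<^sup>2 - (1 - z1) * r + y0 < 0"
    and contr: "z1 + z2 * r < 1"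
  defines "B \<equiv> {v \<in> HD. nl (\<lambda>x. v x - u0 x) \<le> r}"
  shows "\<exists>u\<in>B. F u =ae (\<lambda>x. 0) \<and> (\<forall>v\<in>B. F v =ae (\<lambda>x. 0) \<longrightarrow> v =ae u)"
proof -
  define q where "q = z1 + z2 * r"
  have q: "0 \<le> q" "q < 1" using nonneg r contr by (simp_all add: q_def)
  have B_HD: "u \<in> B \<Longrightarrow> u \<in> HD" for u by (simp add: B_def)
  have ball: "newton u \<in> B" if "u \<in> B" for u
  proof -
    define w where "w x = u x - u0 x" for x
    have u: "u \<in> HD" "(\<lambda>x. u0 x + w x) = u" using that by (auto simp: B_def w_def)
    have w: "w \<in> HD" "nl w \<le> r" using that u0 HD_diff by (auto simp: B_def w_def[abs_def])
    have mw: "(\<lambda>s. -1 * w s) \<in> HD" "nl (\<lambda>s. -1 * w s) \<le> r"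
      using HD_cmult[OF w(1), of "-1"] nl_minus[OF w(1)] w(2) by simp_all
    define N where "N x = 5/12 * J_shift u0 w w x + -1/12 * J_shift u0 (\<lambda>s. -1 * w s) w x" for x
    have N: "N \<in> L2_D2"
      unfolding N_def[abs_def] by (intro L2_D2_add L2_D2_cmult J_shift_L2_D2 u0 w mw)
    have "nl (A N) \<le> \<bar>5/12\<bar> * nl (A (J_shift u0 w w)) + \<bar>-1/12\<bar> * nl (A (J_shift u0 (\<lambda>s. -1 * w s) w))"
      unfolding N_def[abs_def] by (intro nlA_lincomb J_shift_L2_D2 u0 w mw)
    also have "\<dots> \<le> \<bar>5/12\<bar> * (z2 * r * nl w) + \<bar>-1/12\<bar> * (z2 * r * nl w)"
      using z2[OF w(1) w(1) w(2)] z2[OF mw(1) w(1) mw(2)] by (intro add_mono mult_left_mono) auto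
    finally have AN: "nl (A N) \<le> 1/2 * (z2 * r * nl w)" by (simp add: mult_ac)
    have "nl (\<lambda>x. newton u x - newton u0 x) \<le> z1 * nl w + nl (A N)"
    proof (rule newton_difference[OF u(1) u0 w(1) N])
      show "(\<lambda>x. u x - u0 x) = w" by (simp add: w_def[abs_def])
      show "(\<lambda>x. F u x - F u0 x) =ae (\<lambda>x. J u0 w x + N x)"
        using F_increment_center[OF u0 w(1)] by (simp add: u(2) N_def)
    qed
    also have "\<dots> \<le> z1 * nl w + 1/2 * (z2 * r * nl w)" using AN by simp
    also have "\<dots> \<le> z1 * r + 1/2 * (z2 * r * r)"
      using nonneg r w(2) by (intro add_mono mult_left_mono) auto
    finally have 1: "nl (\<lambda>x. newton u x - newton u0 x) \<le> z1 * r + 1/2 * (z2 * r * r)" .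
    have "nl (\<lambda>x. newton u0 x - u0 x) = nl (A (F u0))"
      using nl_minus[OF A_HD[OF F_L2_D2[OF u0]]] by (simp add: newton_def)
    then have "nl (\<lambda>x. newton u x - u0 x) \<le> z1 * r + 1/2 * (z2 * r * r) + y0"
      using nl_triangle[OF HD_diff[OF newton_HD[OF u(1)] newton_HD[OF u0]] HD_diff[OF newton_HD[OF u0] u0]]
        1 y0 by simp
    also have "\<dots> \<le> r" using selfmap by (simp add: power2_eq_square algebra_simps)
    finally show ?thesis using newton_HD[OF u(1)] by (simp add: B_def)
  qed
  have lip: "nl (\<lambda>x. newton u x - newton v x) \<le> q * nl (\<lambda>x. u x - v x)" if "u \<in> B" "v \<in> B" for u v
  proof -
    define a where "a x = u x - u0 x" for x
    define b where "b x = v x - u0 x" for x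
    have u: "u \<in> HD" "(\<lambda>x. u0 x + a x) = u" and v: "v \<in> HD" "(\<lambda>x. u0 x + b x) = v"
      using that by (auto simp: B_def a_def b_def)
    have a: "a \<in> HD" "nl a \<le> r" and b: "b \<in> HD" "nl b \<le> r"
      using that u0 HD_diff by (auto simp: B_def a_def[abs_def] b_def[abs_def])
    define c where "c x = 1/2 * (a x + b x)" for x
    have c: "c \<in> HD" unfolding c_def[abs_def] by (intro HD_cmult HD_add a b)
    have "nl c \<le> r"
      using nl_cmult[OF HD_H[OF HD_add[OF a(1) b(1)]], of "1/2"] nl_triangle[OF a(1) b(1)] a(2) b(2)
      by (simp add: c_def[abs_def])
    define h where "h x = a x - b x" for x
    have h: "h \<in> HD" unfolding h_def[abs_def] by (rule HD_diff[OF a(1) b(1)])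
    define N where "N x = 1/6 * J_shift u0 a h x + (4/6 * J_shift u0 c h x + 1/6 * J_shift u0 b h x)" for x
    note PL = J_shift_L2_D2[OF u0 a(1) h] J_shift_L2_D2[OF u0 c h] J_shift_L2_D2[OF u0 b(1) h]
    have N: "N \<in> L2_D2"
      unfolding N_def[abs_def] by (intro L2_D2_add L2_D2_cmult PL)
    have "nl (A N) \<le> nl (A (\<lambda>x. 1/6 * J_shift u0 a h x)) + nl (A (\<lambda>x. 4/6 * J_shift u0 c h x + 1/6 * J_shift u0 b h x))"
      unfolding N_def[abs_def] by (intro nlA_add L2_D2_add L2_D2_cmult PL)
    then have "nl (A N) \<le> 1/6 * nl (A (J_shift u0 a h)) + (4/6 * nl (A (J_shift u0 c h)) + 1/6 * nl (A (J_shift u0 b h)))"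
      using nlA_cmult[OF PL(1), of "1/6"] nlA_lincomb[OF PL(2,3), of "4/6" "1/6"] by simp
    also have "\<dots> \<le> 1/6 * (z2 * r * nl h) + (4/6 * (z2 * r * nl h) + 1/6 * (z2 * r * nl h))"
      using z2[OF a(1) h a(2)] z2[OF c h \<open>nl c \<le> r\<close>] z2[OF b(1) h b(2)] by (intro add_mono mult_left_mono) auto
    finally have AN: "nl (A N) \<le> z2 * r * nl h" by linarith
    have uvh: "(\<lambda>x. u x - v x) = h" by (simp add: h_def[abs_def] a_def b_def)
    have "nl (\<lambda>x. newton u x - newton v x) \<le> z1 * nl h + nl (A N)"
    proof (rule newton_difference[OF u(1) v(1) h N uvh])
      show "(\<lambda>x. F u x - F v x) =ae (\<lambda>x. J u0 h x + N x)"
        using F_increment_Simpson[OF u0 a(1) b(1)]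
        unfolding u(2) v(2) N_def h_def[abs_def] c_def[abs_def] .
    qed
    then show ?thesis using AN by (simp add: uvh q_def distrib_right)
  qed
  have "\<exists>u\<in>B. nl (\<lambda>x. newton u x - u x) = 0"
  proof -
    \<comment> \<open>This agrees with the distance of \<open>nl\<close> on \<open>HD\<close>, and is symmetric for arbitrary arguments.\<close>
    define d where "d u v = norm2 (\<lambda>x. L u x - L v x)" for u v
    have d: "d u v = nl (\<lambda>x. u x - v x)" if "u \<in> HD" "v \<in> HD" for u v
      using that by (simp add: d_def nl_diff HD_H)
    have "\<exists>u\<in>B. d (newton u) u = 0"
    proof (rule pseudometric_contraction[where d=d and q=q and X=B])
      show "u0 \<in> B" using u0 r by (simp add: B_def nl_zero)
      show "d (newton u) (newton v) \<le> q * d u v" if "u \<in> B" "v \<in> B" for u v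
        using lip[OF that] that by (simp add: d B_HD newton_HD)
      show "d u w \<le> d u v + d v w" if "u \<in> B" "v \<in> B" "w \<in> B" for u v w
        unfolding d_def using that by (intro norm2_triangle_diff L_spec HD_H B_HD)
      show "\<exists>u\<in>B. (\<lambda>n. d (s n) u) \<longlonglongrightarrow> 0"
        if s: "\<And>n. s n \<in> B" and C: "\<And>e. e > 0 \<Longrightarrow> \<exists>N. \<forall>m\<ge>N. \<forall>n\<ge>N. d (s m) (s n) < e" for s
      proof -
        have "\<exists>g\<in>HD. (\<lambda>n. nl (\<lambda>x. s n x - g x)) \<longlonglongrightarrow> 0"
          using HD_complete[of s] C d s B_HD by simp
        then obtain g where g: "g \<in> HD" "(\<lambda>n. nl (\<lambda>x. s n x - g x)) \<longlonglongrightarrow> 0" by blast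
        have "nl (\<lambda>x. g x - u0 x) \<le> nl (\<lambda>x. s n x - g x) + r" for n
        proof -
          have sn: "s n \<in> HD" "nl (\<lambda>x. s n x - u0 x) \<le> r" using s[of n] by (auto simp: B_def)
          show ?thesis
            using nl_triangle[OF HD_diff[OF g(1) sn(1)] HD_diff[OF sn(1) u0]] sn(2)
              nl_diff_commute[OF g(1) sn(1)] by simp
        qed
        moreover have "(\<lambda>n. nl (\<lambda>x. s n x - g x) + r) \<longlonglongrightarrow> 0 + r" by (intro tendsto_intros g)
        ultimately have "nl (\<lambda>x. g x - u0 x) \<le> 0 + r" by (intro LIMSEQ_le_const) auto
        then have "g \<in> B" using g(1) by (simp add: B_def)
        then show ?thesis using g s B_HD by (auto simp: d intro!: bexI[of _ g])
      qed
    qed (use q ball in \<open>auto simp: d_def intro: norm2_diff_commute\<close>)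
    then show ?thesis using d newton_HD B_HD by metis
  qed
  then obtain u where u: "u \<in> B" "nl (\<lambda>x. newton u x - u x) = 0" by blast
  have "nl (A (F u)) = 0"
    using u(2) nl_minus[OF A_HD[OF F_L2_D2[OF B_HD[OF u(1)]]]] by (simp add: newton_def)
  then have Fu: "F u =ae (\<lambda>x. 0)" by (rule A_injective[OF F_L2_D2[OF B_HD[OF u(1)]]])
  have "v =ae u" if v: "v \<in> B" and Fv: "F v =ae (\<lambda>x. 0)" for v
  proof -
    note vH = B_HD[OF v] and uH = B_HD[OF u(1)]
    note AF = A_HD[OF F_L2_D2[OF vH]] A_HD[OF F_L2_D2[OF uH]]
    have "v x - u x = (newton v x - newton u x) + (A (F v) x - A (F u) x)" for x
      by (simp add: newton_def)
    then have "nl (\<lambda>x. v x - u x) \<le> nl (\<lambda>x. newton v x - newton u x) + nl (\<lambda>x. A (F v) x - A (F u) x)"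
      using nl_triangle[OF HD_diff[OF newton_HD[OF vH] newton_HD[OF uH]] HD_diff[OF AF]] by simp
    also have "nl (\<lambda>x. A (F v) x - A (F u) x) \<le> 0"
      using nl_diff_le[OF AF] nlA_null[OF F_L2_D2[OF vH] Fv] nlA_null[OF F_L2_D2[OF uH] Fu] by simp
    finally have "(1 - q) * nl (\<lambda>x. v x - u x) \<le> 0"
      using lip[OF v u(1)] by (simp add: left_diff_distrib)
    then have "nl (\<lambda>x. v x - u x) = 0"
      using q nl_nonneg[of "\<lambda>x. v x - u x"] by (simp add: mult_le_0_iff)
    from nl_eq_0[OF HD_H[OF HD_diff[OF vH uH]] this] show ?thesis
      unfolding ae_eq_def by eventually_elim simp
  qed
  then show ?thesis using u(1) Fu by blast
qed

end

text \<open>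
  It remains to replace the derivative \<open>DFF\<close>, which is chosen by its defining property, by \<open>J\<close>, and
  to turn the bounds on \<open>onorm_l\<close> into pointwise ones.
\<close>

theorem theorem3p2:
  fixes \<mu> \<nu>\<^sub>1 \<nu>\<^sub>2 d Y\<^sub>0 Z\<^sub>1 :: real
    and u\<^sub>0 :: "plane \<Rightarrow> real"
    and N\<^sub>0 :: nat
    and a :: "nat \<Rightarrow> nat \<Rightarrow> real"
    and A :: "(plane \<Rightarrow> real) \<Rightarrow> plane \<Rightarrow> real"
    and Z\<^sub>2 :: "real \<Rightarrow> real"
  assumes "\<mu> > 0"
    and "d > 0"
    and "u\<^sub>0 \<in> Hl_D2 \<mu>"
    and "AE x in lborel. x \<notin> {-d..d} \<times> {-d..d} \<longrightarrow> u\<^sub>0 x = 0"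
    and "AE x in lborel. x \<in> {-d<..<d} \<times> {-d<..<d} \<longrightarrow>
           u\<^sub>0 x = (\<Sum>n\<^sub>1\<le>N\<^sub>0. \<Sum>n\<^sub>2\<le>N\<^sub>0.
             a n\<^sub>1 n\<^sub>2 * (cos (pi * real n\<^sub>1 * fst x / d) * cos (pi * real n\<^sub>2 * snd x / d)))"
    and "bounded_linear_op L2_D2 norm2 (Hl_D2 \<mu>) (norm_l \<mu>) A"
    and "Y\<^sub>0 \<ge> 0" and "Z\<^sub>1 \<ge> 0" and "\<And>r. r > 0 \<Longrightarrow> Z\<^sub>2 r \<ge> 0"
    and "norm_l \<mu> (A (FF \<mu> \<nu>\<^sub>1 \<nu>\<^sub>2 u\<^sub>0)) \<le> Y\<^sub>0"
    and "onorm_l \<mu> (\<lambda>h x. h x - A (DFF \<mu> \<nu>\<^sub>1 \<nu>\<^sub>2 u\<^sub>0 h) x) \<le> Z\<^sub>1"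
    and "\<And>r v. r > 0 \<Longrightarrow> v \<in> closure_l \<mu> (ball_l \<mu> u\<^sub>0 r) \<Longrightarrow>
           onorm_l \<mu> (\<lambda>h. A (\<lambda>x. DFF \<mu> \<nu>\<^sub>1 \<nu>\<^sub>2 v h x - DFF \<mu> \<nu>\<^sub>1 \<nu>\<^sub>2 u\<^sub>0 h x)) \<le> Z\<^sub>2 r * r"
    and "r > 0"
    and "1 / 2 * Z\<^sub>2 r * r\<^sup>2 - (1 - Z\<^sub>1) * r + Y\<^sub>0 < 0"
    and "Z\<^sub>1 + Z\<^sub>2 r * r < 1"
  shows "\<exists>u \<in> closure_l \<mu> (ball_l \<mu> u\<^sub>0 r).
           FF \<mu> \<nu>\<^sub>1 \<nu>\<^sub>2 u =ae (\<lambda>x. 0) \<and>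
           (\<forall>v \<in> closure_l \<mu> (ball_l \<mu> u\<^sub>0 r). FF \<mu> \<nu>\<^sub>1 \<nu>\<^sub>2 v =ae (\<lambda>x. 0) \<longrightarrow> v =ae u)"
proof -
  interpret bounded_operator \<mu> \<nu>\<^sub>1 \<nu>\<^sub>2 A by unfold_locales (rule assms(1) assms(6))+
  note u0 = assms(3) and r = assms(13)
  have Z1: "nl (\<lambda>x. h x - A (J u\<^sub>0 h) x) \<le> Z\<^sub>1 * nl h" if h: "h \<in> HD" for h
    using onorm_l_defect[OF u0 h] mult_right_mono[OF assms(11) nl_nonneg[of h]] by linarith
  have Z2: "nl (A (J_shift u\<^sub>0 w h)) \<le> Z\<^sub>2 r * r * nl h"
    if w: "w \<in> HD" "nl w \<le> r" and h: "h \<in> HD" for w h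
  proof -
    have "(\<lambda>s. u\<^sub>0 s + w s) \<in> closure_l \<mu> (ball_l \<mu> u\<^sub>0 r)"
      unfolding closed_ball_eq[OF u0 r] using HD_add[OF u0 w(1)] w(2) by simp
    from mult_right_mono[OF assms(12)[OF r this] nl_nonneg[of h]] show ?thesis
      using onorm_l_shift[OF u0 w(1) h] by linarith
  qed
  have "0 \<le> Z\<^sub>2 r * r" using assms(9)[OF r] r by simp
  then have "Z\<^sub>1 < 1" using assms(15) by linarith
  then interpret approx_inverse \<mu> \<nu>\<^sub>1 \<nu>\<^sub>2 A u\<^sub>0 Z\<^sub>1
    using u0 Z1 by unfold_locales auto
  show ?thesis
    unfolding closed_ball_eq[OF u0 r]
    by (rule newton_kantorovich[where ?y0.0=Y\<^sub>0 and ?z2.0="Z\<^sub>2 r"])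
       (use assms Z2 in auto)
qed

end
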